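(* Let $B\subset\mathbb{R}^2$ be a solid body with fluid domain $\Omega=\mathbb{R}^2\setminus B$. Assume that $B$ is symmetric under the reflection $(x,y)\mapsto(x,-y)$ and has two protruding corners that are not on the horizontal axis $\{y=0\}$. Then there is no nontrivial uniformly subsonic flow around $B$, and there is no nontrivial incompressible flow around $B$ with bounded velocity $\mathbf v$.
   Context: Body and fluid domain. The solid body $B\subset\mathbb{R}^2$ is a bounded closed set whose boundary $\partial B$ is a continuous curve composed of finitely many infinitely differentiable segments (a slit-like body such as a line segment is allowed). The fluid domain $\Omega=\mathbb{R}^2\setminus B$ is a connected open set. A point $\mathbf x_0\in\partial B$ is a protruding corner if there is a circular sector $S$ centered at $\mathbf x_0$, with some radius $\epsilon>0$ and some opening angle $\delta>\pi$ (at most $2\pi$), whose interior is contained in $\Omega$. Compressible flow. Fix an isentropic coefficient $\gamma>1$ and a Bernoulli constant $K>0$. The pressure law is $P=\varrho^\gamma$; the enthalpy per mass is $\hat p(\varrho)=\frac{\gamma}{\gamma-1}\varrho^{\gamma-1}$ and the sound speed is $c=\sqrt{\gamma\varrho^{\gamma-1}}$. A (steady, irrotational, inviscid) uniformly subsonic flow around $B$ is given by a stream function $\psi:\Omega\to\mathbb{R}$, velocity $\mathbf v=(v^x,v^y)$ and density $\varrho>0$ on $\Omega$ such that: $\psi$ is infinitely differentiable in $\Omega$ and up to (each side of) the smooth points of $\partial B$; $\nabla\psi$ is bounded on $\Omega$; $\varrho\mathbf v=(\psi_y,-\psi_x)$; the Bernoulli relation $\frac12|\mathbf v|^2+\hat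 p(\varrho)=K$ holds; $\partial_xv^y-\partial_yv^x=0$; the slip condition $\psi=0$ holds on $\partial B$ ($\psi$ extended continuously to $\partial B$); and the Mach number $M=|\mathbf v|/c$ satisfies $M\le 1-\delta$ on $\Omega$ for some constant $\delta>0$. Incompressible flow. An incompressible (irrotational) flow around $B$ is given by a harmonic $\psi:\Omega\to\mathbb{R}$, smooth up to (each side of) the smooth points of $\partial B$, with $\psi=0$ on $\partial B$ and velocity $\mathbf v=(\psi_y,-\psi_x)$. Conventions. The velocity has a limit $\mathbf v_\infty$ as $|\mathbf x|\to\infty$, and the coordinates are such that $\mathbf v_\infty=(v^x_\infty,0)$ with $v^x_\infty\ge0$. A flow is trivial if $\mathbf v\equiv0$, and nontrivial otherwise. *)

theory Defs
  imports "HOL-Analysis.Analysis"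
begin

text \<open>
  The plane is identified with the type \<^typ>\<open>complex\<close>: a point $(x,y)$ is \<open>Complex x y\<close>, the
  reflection $(x,y)\mapsto(x,-y)$ is \<^const>\<open>cnj\<close>, and a velocity field \<open>v\<close> has the components
  \<open>Re \<circ> v\<close> and \<open>Im \<circ> v\<close>. The fluid domain of a body \<open>B\<close> is \<open>- B\<close>; functions on the fluid domain
  are total functions whose values on \<open>B\<close> are never used.
\<close>

primrec Ck_on :: "nat \<Rightarrow> 'a::euclidean_space set \<Rightarrow> ('a \<Rightarrow> 'b::real_normed_vector) \<Rightarrow> bool" where
  "Ck_on 0 S f \<longleftrightarrow> continuous_on S f"
| "Ck_on (Suc k) S f \<longleftrightarrow>
     (\<forall>x\<in>S. f differentiable at x) \<and> (\<forall>h. Ck_on k S (\<lambda>x. frechet_derivative f (at x) h))"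

text \<open>To be used for open \<open>S\<close> only.\<close>

definition smooth_on :: "'a::euclidean_space set \<Rightarrow> ('a \<Rightarrow> 'b::real_normed_vector) \<Rightarrow> bool" where
  "smooth_on S f \<longleftrightarrow> (\<forall>k. Ck_on k S f)"

definition partial_x :: "(complex \<Rightarrow> real) \<Rightarrow> complex \<Rightarrow> real" where
  "partial_x f z = frechet_derivative f (at z) 1"

definition partial_y :: "(complex \<Rightarrow> real) \<Rightarrow> complex \<Rightarrow> real" where
  "partial_y f z = frechet_derivative f (at z) \<i>"

definition gradient :: "(complex \<Rightarrow> real) \<Rightarrow> complex \<Rightarrow> complex" where
  "gradient f z = Complex (partial_x f z) (partial_y f z)"

definition harmonic_on :: "complex set \<Rightarrow> (complex \<Rightarrow> real) \<Rightarrow> bool" where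
  "harmonic_on S f \<longleftrightarrow> Ck_on 2 S f \<and>
     (\<forall>z\<in>S. partial_x (partial_x f) z + partial_y (partial_y f) z = 0)"

text \<open>
  An infinitely differentiable segment: a curve that is smooth up to both endpoints and has
  nonvanishing velocity.
\<close>

definition smooth_segment :: "(real \<Rightarrow> complex) \<Rightarrow> real \<Rightarrow> real \<Rightarrow> bool" where
  "smooth_segment g a b \<longleftrightarrow>
     (\<exists>c U. open U \<and> {a..b} \<subseteq> U \<and> smooth_on U c \<and>
        (\<forall>t\<in>{a..b}. g t = c t \<and> vector_derivative c (at t) \<noteq> 0))"

definition piecewise_smooth_curve :: "(real \<Rightarrow> complex) \<Rightarrow> bool" where
  "piecewise_smooth_curve g \<longleftrightarrow> path g \<and>
     (\<exists>(n::nat) \<tau>. \<tau> 0 = 0 \<and> \<tau> n = 1 \<and>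
        (\<forall>i<n. \<tau> i < \<tau> (Suc i) \<and> smooth_segment g (\<tau> i) (\<tau> (Suc i))))"

text \<open>
  The boundary curve need not be simple or closed: slit-like bodies, such as a line segment, or
  bodies with slits attached to them are allowed.
\<close>

definition solid_body :: "complex set \<Rightarrow> bool" where
  "solid_body B \<longleftrightarrow> closed B \<and> bounded B \<and> connected (- B) \<and>
     (\<exists>g. piecewise_smooth_curve g \<and> path_image g = frontier B)"

text \<open>
  The interior of a circular sector with center \<open>p\<close>, radius \<open>\<epsilon>\<close> and opening angle \<open>\<delta>\<close>. For
  $\delta = 2\pi$ it is the disk slit along the radius at angle \<open>\<alpha>\<close>.
\<close>

definition open_sector :: "complex \<Rightarrow> real \<Rightarrow> real \<Rightarrow> real \<Rightarrow> complex set" where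
  "open_sector p \<epsilon> \<alpha> \<delta> =
     {p + of_real r * cis \<theta> | r \<theta>. 0 < r \<and> r < \<epsilon> \<and> \<alpha> < \<theta> \<and> \<theta> < \<alpha> + \<delta>}"

definition protruding_corner :: "complex set \<Rightarrow> complex \<Rightarrow> bool" where
  "protruding_corner B p \<longleftrightarrow> p \<in> frontier B \<and>
     (\<exists>\<epsilon> \<alpha> \<delta>. \<epsilon> > 0 \<and> pi < \<delta> \<and> \<delta> \<le> 2 * pi \<and> open_sector p \<epsilon> \<alpha> \<delta> \<subseteq> - B)"

text \<open>
  Near a smooth boundary point \<open>p\<close> the boundary is a regular level set of a smooth function \<open>h\<close>, and
  the two sides of the boundary are \<open>{z. h z > 0}\<close> and \<open>{z. h z < 0}\<close>. Both of them lie in the fluid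
  at a point of a slit.
\<close>

definition boundary_chart ::
  "complex set \<Rightarrow> complex \<Rightarrow> complex set \<Rightarrow> (complex \<Rightarrow> real) \<Rightarrow> bool" where
  "boundary_chart B p U h \<longleftrightarrow> p \<in> frontier B \<and> open U \<and> p \<in> U \<and> smooth_on U h \<and>
     (\<forall>z\<in>U. gradient h z \<noteq> 0) \<and> frontier B \<inter> U = {z \<in> U. h z = 0}"

text \<open>
  Infinitely differentiable in the fluid domain and up to each side of the smooth points of the
  boundary: near such a point the function has a separate smooth extension from either side.
\<close>

definition smooth_up_to_sides :: "complex set \<Rightarrow> (complex \<Rightarrow> real) \<Rightarrow> bool" where
  "smooth_up_to_sides B \<psi> \<longleftrightarrow> smooth_on (- B) \<psi> \<and>
     (\<forall>p U h. boundary_chart B p U h \<longrightarrow>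
        (\<exists>V \<psi>\<^sub>1 \<psi>\<^sub>2. open V \<and> p \<in> V \<and> V \<subseteq> U \<and> smooth_on V \<psi>\<^sub>1 \<and> smooth_on V \<psi>\<^sub>2 \<and>
           (\<forall>z \<in> V - B. (h z > 0 \<longrightarrow> \<psi> z = \<psi>\<^sub>1 z) \<and> (h z < 0 \<longrightarrow> \<psi> z = \<psi>\<^sub>2 z))))"

definition slip_condition :: "complex set \<Rightarrow> (complex \<Rightarrow> real) \<Rightarrow> bool" where
  "slip_condition B \<psi> \<longleftrightarrow> (\<forall>p\<in>frontier B. (\<psi> \<longlongrightarrow> 0) (at p within - B))"

definition enthalpy :: "real \<Rightarrow> real \<Rightarrow> real" where
  "enthalpy \<gamma> \<rho> = \<gamma> / (\<gamma> - 1) * \<rho> powr (\<gamma> - 1)"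

definition sound_speed :: "real \<Rightarrow> real \<Rightarrow> real" where
  "sound_speed \<gamma> \<rho> = sqrt (\<gamma> * \<rho> powr (\<gamma> - 1))"

definition curl :: "(complex \<Rightarrow> complex) \<Rightarrow> complex \<Rightarrow> real" where
  "curl v z = partial_x (\<lambda>w. Im (v w)) z - partial_y (\<lambda>w. Re (v w)) z"

text \<open>
  Differentiability of \<open>v\<close> is stated explicitly because \<^const>\<open>frechet_derivative\<close> is unspecified
  where the derivative does not exist.
\<close>

definition uniformly_subsonic_flow ::
  "real \<Rightarrow> real \<Rightarrow> complex set \<Rightarrow> (complex \<Rightarrow> real) \<Rightarrow> (complex \<Rightarrow> complex) \<Rightarrow> (complex \<Rightarrow> real) \<Rightarrow> bool"
  where
  "uniformly_subsonic_flow \<gamma> K B \<psi> v \<rho> \<longleftrightarrow>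
     smooth_up_to_sides B \<psi> \<and>
     bounded (gradient \<psi> ` (- B)) \<and>
     slip_condition B \<psi> \<and>
     (\<forall>z\<in>- B. \<rho> z > 0 \<and>
        of_real (\<rho> z) * v z = Complex (partial_y \<psi> z) (- partial_x \<psi> z) \<and>
        (norm (v z))\<^sup>2 / 2 + enthalpy \<gamma> (\<rho> z) = K \<and>
        v differentiable at z \<and> curl v z = 0) \<and>
     (\<exists>\<delta>>0. \<forall>z\<in>- B. norm (v z) / sound_speed \<gamma> (\<rho> z) \<le> 1 - \<delta>)"

definition incompressible_flow ::
  "complex set \<Rightarrow> (complex \<Rightarrow> real) \<Rightarrow> (complex \<Rightarrow> complex) \<Rightarrow> bool" where
  "incompressible_flow B \<psi> v \<longleftrightarrow>
     harmonic_on (- B) \<psi> \<and>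
     smooth_up_to_sides B \<psi> \<and>
     slip_condition B \<psi> \<and>
     (\<forall>z\<in>- B. v z = Complex (partial_y \<psi> z) (- partial_x \<psi> z))"

definition horizontal_at_infinity :: "(complex \<Rightarrow> complex) \<Rightarrow> bool" where
  "horizontal_at_infinity v \<longleftrightarrow> (\<exists>u\<ge>0. (v \<longlongrightarrow> Complex u 0) at_infinity)"

definition trivial_flow :: "complex set \<Rightarrow> (complex \<Rightarrow> complex) \<Rightarrow> bool" where
  "trivial_flow B v \<longleftrightarrow> (\<forall>z\<in>- B. v z = 0)"

end

theory Submission
  imports Defs
begin

text \<open>
  Why there is no such flow. All flows considered have a momentum of the form $r(|v|^2)\,v$ with a
  subsonic density law $r$ (constant for incompressible flow), so that the stream function $\psi$ solves
  $\psi_{xx}+\psi_{yy}-k\,(v\cdot D^2\psi\,v)=0$, a uniformly elliptic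
  equation; here $k^{-1/2}$ is the speed of sound.

  Corners. In a sector of opening angle above $\pi$ a positive solution of such an equation is bounded
  below by a multiple of $r^\alpha$ with some $\alpha<1$. Hence, if the gradient is bounded, $\psi$ cannot
  be positive in the sector (\<open>unbounded_gradient_at_corner\<close>): it has to change sign at every protruding
  corner, and it suffices to produce one corner where it does not.

  Symmetry. Let $u$ be the velocity at infinity. The reflection $\tilde\psi(z)=-\psi(\bar z)$ is the stream
  function of a flow around the same body with the same velocity at infinity. Suppose that the difference
  $W=\psi-\tilde\psi$, which vanishes on the boundary, has one sign, say $W\ge0$. On the axis $\psi=W/2\ge0$.
  If $u>0$, then $\psi$ is positive high above the body, the weak maximum principle gives $\psi\ge0$ and
  the strong one $\psi>0$ in the upper half of the fluid domain, a contradiction at the corner there. If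
  $W\le0$ the same argument applies to $\tilde\psi$. If $u=0$, compare $\psi$ with the fluid at rest
  instead: then $\psi$ itself has one sign, and it must vanish (\<open>symmetric_flow_trivial\<close>).

  One sign. That $W$ has one sign (\<open>W_sign\<close>) would follow from an expansion $W=\Gamma\log|z|+O(1)$ at
  infinity. The following argument avoids the expansion. The velocity difference is $\nabla\Phi$ for a (possibly multivalued) $\Phi$, and
  up to a factor $\Phi+iW$ is asymptotically conformal once the ellipses $x^2+\beta^2y^2=e^{2s}$
  of the Prandtl-Glauert transformation replace circles. The flux $I(s)=\oint W\,d\Phi$ over
  these ellipses is nondecreasing, because its derivative is comparable to a Dirichlet integral. If $W$ has no zero on arbitrarily large
  ellipses, the weak maximum principle gives the sign. Otherwise Wirtinger's inequality yields
  $I'\ge\frac45|I|$. Either $I$ becomes positive and grows like $e^{4s/5}$, or $I\le0$ stays bounded, the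
  Dirichlet integrals become small, $W$ tends to $0$ along a sequence of ellipses, and $W=0$. The growth
  is impossible because the gradients of $\psi$ and $\tilde\psi$ approach their common limit: in mean
  square over ellipses like $e^{-7s/5}$ (\<open>gradient_decay\<close>), so that $I=O(e^{3s/5})$. This decay is proved by the same method,
  applied to the pair $(\psi_y,\beta\psi_x)$ in place of $(W,\Phi)$. For exactly conformal pairs the
  exponents would be $1$ and $-2$ instead of $\frac45$ and $-\frac75$; the slack pays for the deviation.
\<close>

section \<open>Gradients and second derivatives in the plane\<close>

abbreviation has_gradient :: "(complex \<Rightarrow> real) \<Rightarrow> real \<Rightarrow> real \<Rightarrow> complex \<Rightarrow> bool" where
  "has_gradient f a b z \<equiv> (f has_derivative (\<lambda>h. a * Re h + b * Im h)) (at z)"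

text \<open>
  The partial derivatives are explicit arguments, so that differential identities become statements about
  named functions, without the choice operator behind \<^const>\<open>frechet_derivative\<close>.
\<close>

definition C1_on :: "complex set \<Rightarrow> (complex \<Rightarrow> real) \<Rightarrow> (complex \<Rightarrow> real) \<Rightarrow> (complex \<Rightarrow> real) \<Rightarrow> bool" where
  "C1_on S f fx fy \<longleftrightarrow>
     (\<forall>z\<in>S. has_gradient f (fx z) (fy z) z) \<and> continuous_on S fx \<and> continuous_on S fy"

lemma C1_onD:
  assumes "C1_on S f fx fy"
  shows "z \<in> S \<Longrightarrow> has_gradient f (fx z) (fy z) z" "continuous_on S fx" "continuous_on S fy"
    "continuous_on S f"
proof -
  show "z \<in> S \<Longrightarrow> has_gradient f (fx z) (fy z) z" "continuous_on S fx" "continuous_on S fy"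
    using assms by (auto simp: C1_on_def)
  show "continuous_on S f"
    using assms unfolding C1_on_def
    by (meson continuous_at_imp_continuous_on has_derivative_continuous)
qed

lemma differentiable_has_gradient:
  assumes "f differentiable at z"
  shows "has_gradient f (partial_x f z) (partial_y f z) z"
proof -
  have D: "(f has_derivative frechet_derivative f (at z)) (at z)"
    using assms frechet_derivative_works by blast
  then interpret bounded_linear "frechet_derivative f (at z)"
    by (rule has_derivative_bounded_linear)
  have "frechet_derivative f (at z) h = partial_x f z * Re h + partial_y f z * Im h" for h
  proof -
    have h: "h = Re h *\<^sub>R 1 + Im h *\<^sub>R \<i>"
      by (simp add: complex_eq_iff)
    show ?thesis
      by (subst h) (simp only: add scale partial_x_def partial_y_def, simp)
  qed
  then show ?thesis
    using D by (metis (no_types, lifting) ext)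
qed

lemma Ck_on_Suc_partials:
  assumes "Ck_on (Suc k) S f"
  shows "Ck_on k S (partial_x f)" "Ck_on k S (partial_y f)"
  using assms by (auto simp: partial_x_def[abs_def] partial_y_def[abs_def])

lemma Ck_on_Suc_continuous:
  assumes "Ck_on (Suc k) S f"
  shows "continuous_on S f"
  using assms by (auto intro!: continuous_at_imp_continuous_on differentiable_imp_continuous_within)

lemma Ck_on_C1_on:
  assumes "Ck_on (Suc k) S f"
  shows "C1_on S f (partial_x f) (partial_y f)"
proof -
  have "continuous_on S g" if "Ck_on k S g" for g
    using that by (cases k) (use Ck_on_Suc_continuous in auto)
  then have "continuous_on S (partial_x f)" "continuous_on S (partial_y f)"
    using Ck_on_Suc_partials[OF assms] by blast+
  moreover have "has_gradient f (partial_x f z) (partial_y f z) z" if "z \<in> S" for z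
    using assms that by (auto intro!: differentiable_has_gradient)
  ultimately show ?thesis unfolding C1_on_def by blast
qed

lemma has_gradient_along:
  assumes "has_gradient f a b (g t)" and "(g has_vector_derivative d) (at t within T)"
  shows "((\<lambda>s. f (g s)) has_real_derivative (a * Re d + b * Im d)) (at t within T)"
proof -
  have "((\<lambda>s. f (g s)) has_derivative (\<lambda>s. a * Re (s *\<^sub>R d) + b * Im (s *\<^sub>R d))) (at t within T)"
    using has_derivative_compose[OF assms(2)[unfolded has_vector_derivative_def] assms(1)] .
  then show ?thesis
    unfolding has_field_derivative_def
    by (rule has_derivative_eq_rhs) (auto simp: algebra_simps)
qed

lemma has_gradient_unique:
  assumes "has_gradient f a b z" "has_gradient f a' b' z"
  shows "a = a'" "b = b'"
proof -
  have eq: "(\<lambda>h. a * Re h + b * Im h) = (\<lambda>h. a' * Re h + b' * Im h)"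
    using has_derivative_unique[OF assms] .
  show "a = a'" using fun_cong[OF eq, of 1] by simp
  show "b = b'" using fun_cong[OF eq, of \<i>] by simp
qed

lemma coordinate_line_derivs:
  "((\<lambda>s. Complex s y) has_vector_derivative 1) (at x within X)"
  "((\<lambda>s. Complex x s) has_vector_derivative \<i>) (at y within X)"
proof -
  have 1: "(\<lambda>s. Complex s y) = (\<lambda>s. of_real s + \<i> * of_real y)"
    and 2: "(\<lambda>s. Complex x s) = (\<lambda>s. of_real x + \<i> * of_real s)"
    by (auto simp: complex_eq_iff)
  show "((\<lambda>s. Complex s y) has_vector_derivative 1) (at x within X)"
    unfolding 1 by (auto intro!: derivative_eq_intros)
  show "((\<lambda>s. Complex x s) has_vector_derivative \<i>) (at y within X)"
    unfolding 2 by (auto intro!: derivative_eq_intros)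
qed

text \<open>
  The classical argument: the second difference of \<open>f\<close> over a small square equals, by the mean value
  theorem in either order, a value of \<open>fxy\<close> or a value of \<open>fyx\<close> times the area of the square.
\<close>

lemma mixed_partials_commute:
  assumes "open S" and f: "C1_on S f fx fy" and fx: "C1_on S fx fxx fxy" and fy: "C1_on S fy fyx fyy"
    and z: "z \<in> S"
  shows "fxy z = fyx z"
proof (rule ccontr)
  assume ne: "fxy z \<noteq> fyx z"
  define e where "e = \<bar>fxy z - fyx z\<bar> / 2"
  have e: "e > 0" using ne by (simp add: e_def)
  have "continuous (at z) fxy" "continuous (at z) fyx"
    using fx fy z \<open>open S\<close> by (auto simp: C1_on_def continuous_on_eq_continuous_at)
  then obtain d1 d2 where d: "d1 > 0" "\<And>w. dist w z < d1 \<Longrightarrow> \<bar>fxy w - fxy z\<bar> < e"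
     "d2 > 0" "\<And>w. dist w z < d2 \<Longrightarrow> \<bar>fyx w - fyx z\<bar> < e"
    using e unfolding continuous_at_eps_delta dist_real_def by metis
  obtain d3 where d3: "d3 > 0" "ball z d3 \<subseteq> S"
    using \<open>open S\<close> z open_contains_ball by blast
  define h where "h = min d1 (min d2 d3) / 3"
  have h: "h > 0" using d d3 by (auto simp: h_def)
  obtain x y where xy: "z = Complex x y" by (cases z)
  have near: "dist (Complex s t) z < min d1 (min d2 d3)" if "s \<in> {x..x+h}" "t \<in> {y..y+h}" for s t
  proof -
    have "dist (Complex s t) z \<le> \<bar>s - x\<bar> + \<bar>t - y\<bar>"
      using cmod_le[of "Complex s t - z"] by (simp add: dist_norm xy)
    also have "\<dots> \<le> 2 * h" using that by auto
    also have "\<dots> < min d1 (min d2 d3)" using d d3 unfolding h_def by linarith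
    finally show ?thesis .
  qed
  have inS: "Complex s t \<in> S" if "s \<in> {x..x+h}" "t \<in> {y..y+h}" for s t
    using near[OF that] d3 by (auto simp: dist_commute)
  define \<Delta> where "\<Delta> = f (Complex (x+h) (y+h)) - f (Complex (x+h) y) - f (Complex x (y+h)) + f (Complex x y)"
  note along = has_gradient_along[OF _ coordinate_line_derivs(1), simplified]
    has_gradient_along[OF _ coordinate_line_derivs(2), simplified]
  have "\<exists>s>x. s < x+h \<and> (f (Complex (x+h) (y+h)) - f (Complex (x+h) y)) - (f (Complex x (y+h)) - f (Complex x y))
      = (x+h-x) * (fx (Complex s (y+h)) - fx (Complex s y))"
    using h by (intro MVT2) (auto intro!: DERIV_diff along C1_onD(1)[OF f] inS)
  then obtain s where s: "x < s" "s < x+h" "\<Delta> = h * (fx (Complex s (y+h)) - fx (Complex s y))"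
    by (auto simp: \<Delta>_def algebra_simps)
  have "\<exists>t>y. t < y+h \<and> fx (Complex s (y+h)) - fx (Complex s y) = (y+h-y) * fxy (Complex s t)"
    using h s by (intro MVT2) (auto intro!: along C1_onD(1)[OF fx] inS)
  then obtain t where t: "y < t" "t < y+h" "\<Delta> = h * (h * fxy (Complex s t))"
    using s by auto
  have "\<exists>t>y. t < y+h \<and> (f (Complex (x+h) (y+h)) - f (Complex x (y+h))) - (f (Complex (x+h) y) - f (Complex x y))
      = (y+h-y) * (fy (Complex (x+h) t) - fy (Complex x t))"
    using h by (intro MVT2) (auto intro!: DERIV_diff along C1_onD(1)[OF f] inS)
  then obtain t' where t': "y < t'" "t' < y+h" "\<Delta> = h * (fy (Complex (x+h) t') - fy (Complex x t'))"
    by (auto simp: \<Delta>_def algebra_simps)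
  have "\<exists>s>x. s < x+h \<and> fy (Complex (x+h) t') - fy (Complex x t') = (x+h-x) * fyx (Complex s t')"
    using h t' by (intro MVT2) (auto intro!: along C1_onD(1)[OF fy] inS)
  then obtain s' where s': "x < s'" "s' < x+h" "\<Delta> = h * (h * fyx (Complex s' t'))"
    using t' by auto
  have "fxy (Complex s t) = fyx (Complex s' t')"
    using t(3) s'(3) h by auto
  moreover have "\<bar>fxy (Complex s t) - fxy z\<bar> < e" "\<bar>fyx (Complex s' t') - fyx z\<bar> < e"
    using near[of s t] near[of s' t'] s t s' t' d by auto
  ultimately show False unfolding e_def by (auto simp: abs_if split: if_splits)
qed

lemma second_derivative_nonneg_at_min:
  fixes g :: "real \<Rightarrow> real"
  assumes "d > 0" and min: "\<And>t. \<bar>t\<bar> < d \<Longrightarrow> g 0 \<le> g t"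
    and g: "\<And>t. \<bar>t\<bar> < d \<Longrightarrow> (g has_real_derivative g' t) (at t)"
    and g': "(g' has_real_derivative D) (at 0)"
  shows "g' 0 = 0" "D \<ge> 0"
proof -
  show 0: "g' 0 = 0"
    using DERIV_local_min[OF g[of 0] \<open>d > 0\<close>] min \<open>d > 0\<close> by auto
  show "D \<ge> 0"
  proof (rule ccontr)
    assume "\<not> D \<ge> 0"
    then obtain e where e: "e > 0" "\<And>h. 0 < h \<Longrightarrow> h < e \<Longrightarrow> g' h < 0"
      using DERIV_neg_dec_right[OF g'] 0 by force
    define t where "t = min d e / 2"
    have t: "0 < t" "t < d" "t < e" using e \<open>d > 0\<close> by (auto simp: t_def)
    obtain s where "0 < s" "s < t" "g t - g 0 = (t - 0) * g' s"
      using MVT2[of 0 t g g'] g t by auto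
    moreover have "t * g' s < 0" using e(2)[of s] t calculation by (simp add: mult_pos_neg)
    ultimately show False using min[of t] t by auto
  qed
qed

lemma local_min_second_order:
  assumes "open U" "z \<in> U" and min: "\<And>w. w \<in> U \<Longrightarrow> f z \<le> f w"
    and f: "\<And>w. w \<in> U \<Longrightarrow> has_gradient f (fx w) (fy w) w"
    and fx: "has_gradient fx a b z" and fy: "has_gradient fy b c z"
  shows "fx z = 0" "fy z = 0" "a * s\<^sup>2 + 2 * b * s * t + c * t\<^sup>2 \<ge> 0"
proof -
  have *: "fx z * s + fy z * t = 0 \<and> a * s\<^sup>2 + 2 * b * s * t + c * t\<^sup>2 \<ge> 0" for s t
  proof -
    define \<gamma> where "\<gamma> \<tau> = z + of_real \<tau> * Complex s t" for \<tau>
    have \<gamma>: "(\<gamma> has_vector_derivative Complex s t) (at \<tau>)" for \<tau>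
      unfolding \<gamma>_def by (auto intro!: derivative_eq_intros)
    have "continuous (at 0) \<gamma>" using \<gamma> has_vector_derivative_continuous by blast
    moreover have "\<gamma> 0 = z" by (simp add: \<gamma>_def)
    ultimately obtain d where d: "d > 0" "\<And>\<tau>. \<bar>\<tau>\<bar> < d \<Longrightarrow> \<gamma> \<tau> \<in> U"
      using continuous_at_open[of 0 \<gamma>] \<open>open U\<close> \<open>z \<in> U\<close>
      by (metis (no_types) continuous_at_ball ball_def dist_0_norm image_eqI mem_Collect_eq open_contains_ball real_norm_def subset_iff)
    have g: "((\<lambda>\<tau>. f (\<gamma> \<tau>)) has_real_derivative (fx (\<gamma> \<tau>) * s + fy (\<gamma> \<tau>) * t)) (at \<tau>)" if "\<bar>\<tau>\<bar> < d" for \<tau>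
      using has_gradient_along[OF f \<gamma>] d(2)[OF that] by simp
    have g': "((\<lambda>\<tau>. fx (\<gamma> \<tau>) * s + fy (\<gamma> \<tau>) * t) has_real_derivative ((a * s + b * t) * s + (b * s + c * t) * t)) (at 0)"
      using has_gradient_along[of fx a b \<gamma> 0 _ UNIV, OF _ \<gamma>] has_gradient_along[of fy b c \<gamma> 0 _ UNIV, OF _ \<gamma>] fx fy \<open>\<gamma> 0 = z\<close>
      by (auto intro!: derivative_eq_intros)
    show ?thesis
      using second_derivative_nonneg_at_min[OF d(1) _ g g'] min d(2) \<open>\<gamma> 0 = z\<close>
      by (auto simp: power2_eq_square algebra_simps)
  qed
  show "fx z = 0" using *[of 1 0] by simp
  show "fy z = 0" using *[of 0 1] by simp
  show "a * s\<^sup>2 + 2 * b * s * t + c * t\<^sup>2 \<ge> 0" using * by simp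
qed

section \<open>Maximum principles\<close>

text \<open>
  The operator $w\mapsto\Delta w-n\cdot D^2w\,n$ applied to the Hessian with entries \<open>a\<close>, \<open>b\<close>, \<open>c\<close>. It is elliptic when
  $|n|<1$; for a flow $n$ is the velocity divided by the speed of sound.
\<close>

definition elliptic_op :: "complex \<Rightarrow> real \<Rightarrow> real \<Rightarrow> real \<Rightarrow> real" where
  "elliptic_op n a b c = a + c - ((Re n)\<^sup>2 * a + 2 * Re n * Im n * b + (Im n)\<^sup>2 * c)"

text \<open>
  Adding and subtracting $|n|^2\Delta w$ leaves the second derivative in the direction orthogonal to \<open>n\<close>.
  Both terms are nonnegative for a positive semidefinite Hessian.
\<close>

lemma elliptic_op_split:
  "elliptic_op n a b c = (1 - (norm n)\<^sup>2) * (a + c) + (a * (Im n)\<^sup>2 + 2 * b * Im n * (- Re n) + c * (- Re n)\<^sup>2)"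
  by (simp add: elliptic_op_def cmod_power2 algebra_simps)

lemma elliptic_op_nonneg:
  assumes "\<And>s t. a * s\<^sup>2 + 2 * b * s * t + c * t\<^sup>2 \<ge> 0" and "(norm n)\<^sup>2 \<le> 1"
  shows "elliptic_op n a b c \<ge> 0"
proof -
  have "a \<ge> 0" "c \<ge> 0" using assms(1)[of 1 0] assms(1)[of 0 1] by auto
  then show ?thesis unfolding elliptic_op_split using assms(1)[of "Im n" "- Re n"] assms(2) by simp
qed

definition C2_on where
  "C2_on S f fx fy fxx fxy fyy \<longleftrightarrow> C1_on S f fx fy \<and> C1_on S fx fxx fxy \<and> C1_on S fy fxy fyy"

lemma open_superlevel:
  fixes w :: "complex \<Rightarrow> real"
  assumes "open U" "continuous_on U w"
  shows "open {z \<in> U. w z > c}"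
proof -
  have "{z \<in> U. w z > c} = U \<inter> w -` {c<..}" by auto
  then show ?thesis using continuous_open_preimage[OF assms(2,1), of "{c<..}"] by simp
qed

text \<open>
  The first order terms are controlled on compact subsets of \<open>U\<close> only. A negative value
  of \<open>w\<close> confines the argument to the compact set where \<open>w\<close> is below half of it; there the
  first order terms are dominated by the second derivative of the perturbation \<open>- \<epsilon> * exp (\<alpha> * Re z)\<close>.
\<close>

lemma weak_max_principle:
  assumes U: "open U" "bounded U" and \<mu>: "\<mu> < 1"
    and w: "C2_on U w wx wy wxx wxy wyy"
    and op: "\<And>K. compact K \<Longrightarrow> K \<subseteq> U \<Longrightarrow>
       \<exists>C. \<forall>z\<in>K. \<exists>n. (norm n)\<^sup>2 \<le> \<mu> \<and> elliptic_op n (wxx z) (wxy z) (wyy z) \<le> C * (\<bar>wx z\<bar> + \<bar>wy z\<bar>)"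
    and bd: "\<And>y \<epsilon>. y \<in> frontier U \<Longrightarrow> \<epsilon> > 0 \<Longrightarrow> \<forall>\<^sub>F z in at y within U. w z \<ge> - \<epsilon>"
    and z: "z0 \<in> U"
  shows "w z0 \<ge> 0"
proof (rule ccontr)
  assume "\<not> w z0 \<ge> 0"
  define \<eta> where "\<eta> = - w z0 / 2"
  have \<eta>: "\<eta> > 0" "w z0 = - 2 * \<eta>" using \<open>\<not> w z0 \<ge> 0\<close> by (auto simp: \<eta>_def)
  have wc: "continuous_on U w" using w C1_onD(4) unfolding C2_on_def by blast
  define K where "K = {z \<in> U. w z \<le> - \<eta>}"
  have "closed K"
    unfolding closed_limpt
  proof (intro allI impI)
    fix y assume y: "y islimpt K"
    then have "y islimpt U" by (rule islimpt_subset) (auto simp: K_def)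
    then have cl: "y \<in> closure U" by (simp add: closure_def)
    show "y \<in> K"
    proof (cases "y \<in> U")
      case False
      then have "y \<in> frontier U" using cl interior_subset by (auto simp: frontier_def)
      from bd[OF this, of "\<eta>/2"] \<eta> obtain d where "d > 0"
        and d: "\<And>z. z \<in> U \<Longrightarrow> z \<noteq> y \<Longrightarrow> dist z y < d \<Longrightarrow> w z \<ge> - (\<eta>/2)"
        unfolding eventually_at by auto
      then obtain z where "z \<in> K" "z \<noteq> y" "dist z y < d" using y unfolding islimpt_approachable by blast
      then show ?thesis using d[of z] \<eta> by (auto simp: K_def)
    next
      case True
      have "w y \<le> - \<eta>"
      proof (rule ccontr)
        assume "\<not> w y \<le> - \<eta>"
        then have "y \<in> {z \<in> U. w z > - \<eta>}" using True by simp
        moreover have "open {z \<in> U. w z > - \<eta>}"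
          using open_superlevel[OF U(1) wc] .
        ultimately obtain z where "z \<in> K" "z \<in> {z \<in> U. w z > - \<eta>}"
          using islimptE[OF y, of "{z \<in> U. w z > - \<eta>}"] by metis
        then show False by (auto simp: K_def)
      qed
      then show ?thesis using True by (simp add: K_def)
    qed
  qed
  then have K: "compact K"
    using \<open>bounded U\<close> bounded_subset[of U K] by (auto simp: compact_eq_bounded_closed K_def)
  obtain C where C: "\<And>z. z \<in> K \<Longrightarrow> \<exists>n. (norm n)\<^sup>2 \<le> \<mu> \<and> elliptic_op n (wxx z) (wxy z) (wyy z) \<le> C * (\<bar>wx z\<bar> + \<bar>wy z\<bar>)"
    using op[OF K] by (auto simp: K_def)
  obtain R where R: "\<And>z. z \<in> U \<Longrightarrow> norm z \<le> R" using U(2) bounded_iff by blast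
  define \<alpha> where "\<alpha> = (\<bar>C\<bar> + 1) / (1 - \<mu>)"
  have \<alpha>: "\<alpha> > 0" "(1 - \<mu>) * \<alpha> > C" using \<mu> by (auto simp: \<alpha>_def)
  define \<epsilon> where "\<epsilon> = \<eta> / (2 * exp (\<alpha> * R))"
  have \<epsilon>: "\<epsilon> > 0" using \<eta> by (simp add: \<epsilon>_def)
  define E where "E z = \<epsilon> * exp (\<alpha> * Re z)" for z :: complex
  have E0: "E z > 0" for z using \<epsilon> by (simp add: E_def)
  have E_le: "E z \<le> \<eta> / 2" if "z \<in> U" for z
  proof -
    have "exp (\<alpha> * Re z) \<le> exp (\<alpha> * R)"
      using R[OF that] \<alpha> complex_Re_le_cmod[of z] by (simp add: order_trans)
    then have "\<epsilon> * exp (\<alpha> * Re z) \<le> \<epsilon> * exp (\<alpha> * R)" using \<epsilon> by simp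
    then show ?thesis by (simp add: E_def \<epsilon>_def)
  qed
  have Eg: "has_gradient E (\<alpha> * E z) 0 z" "has_gradient (\<lambda>z. \<alpha> * E z) (\<alpha>\<^sup>2 * E z) 0 z" for z
    unfolding E_def by (auto intro!: derivative_eq_intros simp: power2_eq_square)
  define v where "v z = w z - E z" for z
  have "continuous_on K v"
    unfolding v_def E_def using wc by (auto intro!: continuous_intros continuous_on_subset[of U w] simp: K_def)
  moreover have "z0 \<in> K" using z \<eta> by (auto simp: K_def)
  ultimately obtain z1 where z1: "z1 \<in> K" "\<And>z. z \<in> K \<Longrightarrow> v z1 \<le> v z"
    using continuous_attains_inf[OF K, of v] by blast
  have "w z1 < - \<eta>"
    using z1(2)[OF \<open>z0 \<in> K\<close>] E_le[of z1] E0[of z0] \<eta> z1(1) by (auto simp: v_def K_def)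
  define V where "V = {z \<in> U. w z < - \<eta>}"
  have "open V"
    using open_superlevel[OF U(1) continuous_on_minus[OF wc], of \<eta>]
    unfolding V_def by (rule subst[of _ _ "open", rotated]) auto
  have V: "V \<subseteq> K" "z1 \<in> V" using \<open>w z1 < - \<eta>\<close> z1(1) by (auto simp: V_def K_def)
  have z1U: "z1 \<in> U" using V by (auto simp: V_def)
  have vg: "has_gradient v (wx z - \<alpha> * E z) (wy z) z" if "z \<in> U" for z
    unfolding v_def using w Eg that unfolding C2_on_def C1_on_def
    by (auto intro!: derivative_eq_intros simp: algebra_simps)
  have vx: "has_gradient (\<lambda>z. wx z - \<alpha> * E z) (wxx z1 - \<alpha>\<^sup>2 * E z1) (wxy z1) z1"
    using has_derivative_diff[OF C1_onD(1)[of U wx wxx wxy z1] Eg(2)[of z1]] w z1U unfolding C2_on_def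
    by (simp add: algebra_simps)
  have vy: "has_gradient wy (wxy z1) (wyy z1) z1"
    using w z1U unfolding C2_on_def C1_on_def by blast
  have min: "v z1 \<le> v z" if "z \<in> V" for z using z1(2) V that by blast
  have vg': "has_gradient v (wx z - \<alpha> * E z) (wy z) z" if "z \<in> V" for z
    using vg that by (simp add: V_def)
  note m = local_min_second_order[OF \<open>open V\<close> V(2) min vg' vx vy]
  have g: "wx z1 = \<alpha> * E z1" using m(1) by linarith
  have g2: "wy z1 = 0" using m(2) .
  obtain n where n: "(norm n)\<^sup>2 \<le> \<mu>" "elliptic_op n (wxx z1) (wxy z1) (wyy z1) \<le> C * (\<bar>wx z1\<bar> + \<bar>wy z1\<bar>)"
    using C[OF z1(1)] by blast
  have "elliptic_op n (wxx z1 - \<alpha>\<^sup>2 * E z1) (wxy z1) (wyy z1) \<ge> 0"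
    using m(3) n \<mu> by (intro elliptic_op_nonneg) simp_all
  then have "elliptic_op n (wxx z1) (wxy z1) (wyy z1) \<ge> (1 - (Re n)\<^sup>2) * (\<alpha>\<^sup>2 * E z1)"
    by (simp add: elliptic_op_def algebra_simps)
  moreover have "(1 - (Re n)\<^sup>2) * (\<alpha>\<^sup>2 * E z1) \<ge> (1 - \<mu>) * (\<alpha>\<^sup>2 * E z1)"
  proof (rule mult_right_mono)
    show "1 - \<mu> \<le> 1 - (Re n)\<^sup>2"
      using n(1) zero_le_power2[of "Im n"] unfolding cmod_power2 by linarith
  qed (use E0[of z1] in simp)
  ultimately have "(1 - \<mu>) * (\<alpha>\<^sup>2 * E z1) \<le> C * (\<alpha> * E z1)"
    using n(2) mult_pos_pos[OF \<alpha>(1) E0[of z1]] unfolding g g2 by simp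
  then have "((1 - \<mu>) * \<alpha>) * (\<alpha> * E z1) \<le> C * (\<alpha> * E z1)"
    by (simp add: power2_eq_square algebra_simps)
  then show False using \<alpha> E0[of z1] by simp
qed

lemma C1_on_subset: "C1_on S f fx fy \<Longrightarrow> T \<subseteq> S \<Longrightarrow> C1_on T f fx fy"
  unfolding C1_on_def by (meson continuous_on_subset subset_iff)

lemma C2_on_subset: "C2_on S f fx fy fxx fxy fyy \<Longrightarrow> T \<subseteq> S \<Longrightarrow> C2_on T f fx fy fxx fxy fyy"
  unfolding C2_on_def using C1_on_subset by blast

lemma C1_on_add:
  assumes "C1_on S f fx fy" "C1_on S g gx gy"
  shows "C1_on S (\<lambda>z. f z + g z) (\<lambda>z. fx z + gx z) (\<lambda>z. fy z + gy z)"
  using assms unfolding C1_on_def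
  by (auto intro!: continuous_intros) (auto intro!: derivative_eq_intros simp: algebra_simps)

lemma C1_on_cmult:
  assumes "C1_on S f fx fy"
  shows "C1_on S (\<lambda>z. c * f z) (\<lambda>z. c * fx z) (\<lambda>z. c * fy z)"
  using assms unfolding C1_on_def
  by (auto intro!: continuous_intros) (auto intro!: derivative_eq_intros simp: algebra_simps)

lemma C1_on_mult:
  assumes "C1_on S f fx fy" "C1_on S g gx gy"
  shows "C1_on S (\<lambda>z. f z * g z) (\<lambda>z. f z * gx z + fx z * g z) (\<lambda>z. f z * gy z + fy z * g z)"
  using assms C1_onD(4)[OF assms(1)] C1_onD(4)[OF assms(2)] unfolding C1_on_def
  by (auto intro!: continuous_intros) (auto intro!: derivative_eq_intros simp: algebra_simps)

lemma C1_on_const: "C1_on S (\<lambda>z. c) (\<lambda>z. 0) (\<lambda>z. 0)"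
  unfolding C1_on_def by auto

lemma C1_on_linear: "C1_on S (\<lambda>z. a * Re (z - p) + b * Im (z - p)) (\<lambda>z. a) (\<lambda>z. b)"
  unfolding C1_on_def by (auto intro!: derivative_eq_intros)

lemma C2_on_add:
  assumes "C2_on S f fx fy fxx fxy fyy" "C2_on S g gx gy gxx gxy gyy"
  shows "C2_on S (\<lambda>z. f z + g z) (\<lambda>z. fx z + gx z) (\<lambda>z. fy z + gy z)
     (\<lambda>z. fxx z + gxx z) (\<lambda>z. fxy z + gxy z) (\<lambda>z. fyy z + gyy z)"
  using assms unfolding C2_on_def by (auto intro: C1_on_add)

lemma C2_on_cmult:
  assumes "C2_on S f fx fy fxx fxy fyy"
  shows "C2_on S (\<lambda>z. c * f z) (\<lambda>z. c * fx z) (\<lambda>z. c * fy z)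
     (\<lambda>z. c * fxx z) (\<lambda>z. c * fxy z) (\<lambda>z. c * fyy z)"
  using assms unfolding C2_on_def by (auto intro: C1_on_cmult)

lemma C2_on_const: "C2_on S (\<lambda>z. c) (\<lambda>z. 0) (\<lambda>z. 0) (\<lambda>z. 0) (\<lambda>z. 0) (\<lambda>z. 0)"
  unfolding C2_on_def by (auto intro: C1_on_const)

lemma C2_on_linear_mult:
  fixes a b :: real and p :: complex
  assumes "C2_on S f fx fy fxx fxy fyy"
  defines "X \<equiv> \<lambda>z. a * Re (z - p) + b * Im (z - p)"
  shows "C2_on S (\<lambda>z. X z * f z) (\<lambda>z. X z * fx z + a * f z) (\<lambda>z. X z * fy z + b * f z)
     (\<lambda>z. X z * fxx z + 2 * a * fx z) (\<lambda>z. X z * fxy z + (a * fy z + b * fx z)) (\<lambda>z. X z * fyy z + 2 * b * fy z)"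
proof -
  have X: "C1_on S X (\<lambda>z. a) (\<lambda>z. b)" unfolding X_def by (rule C1_on_linear)
  have f: "C1_on S f fx fy" "C1_on S fx fxx fxy" "C1_on S fy fxy fyy"
    using assms by (auto simp: C2_on_def)
  have "C1_on S (\<lambda>z. X z * fx z + a * f z) (\<lambda>z. (X z * fxx z + a * fx z) + a * fx z) (\<lambda>z. (X z * fxy z + b * fx z) + a * fy z)"
    by (intro C1_on_add C1_on_mult[OF X f(2)] C1_on_cmult f)
  moreover have "C1_on S (\<lambda>z. X z * fy z + b * f z) (\<lambda>z. (X z * fxy z + a * fy z) + b * fx z) (\<lambda>z. (X z * fyy z + b * fy z) + b * fy z)"
    by (intro C1_on_add C1_on_mult[OF X f(3)] C1_on_cmult f)
  ultimately show ?thesis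
    unfolding C2_on_def using C1_on_mult[OF X f(1)] by (simp add: algebra_simps)
qed

section \<open>Barriers and the strong maximum principle\<close>

text \<open>
  Powers of the distance to \<open>p\<close>, written as powers of its square. All barriers are built from these functions.
\<close>

lemma norm_powr_C2:
  fixes p :: complex and q :: real
  defines "r2 \<equiv> \<lambda>z. (norm (z - p))\<^sup>2"
  defines "X \<equiv> \<lambda>z. Re (z - p)"
  defines "Y \<equiv> \<lambda>z. Im (z - p)"
  shows "C2_on (- {p}) (\<lambda>z. r2 z powr q)
     (\<lambda>z. 2 * q * X z * r2 z powr (q - 1)) (\<lambda>z. 2 * q * Y z * r2 z powr (q - 1))
     (\<lambda>z. 2 * q * r2 z powr (q - 1) + 4 * q * (q - 1) * (X z)\<^sup>2 * r2 z powr (q - 2))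
     (\<lambda>z. 4 * q * (q - 1) * X z * Y z * r2 z powr (q - 2))
     (\<lambda>z. 2 * q * r2 z powr (q - 1) + 4 * q * (q - 1) * (Y z)\<^sup>2 * r2 z powr (q - 2))"
proof -
  have pos: "r2 z > 0" if "z \<in> - {p}" for z using that by (simp add: r2_def)
  have r2: "r2 = (\<lambda>z. X z ^ 2 + Y z ^ 2)" by (simp add: r2_def X_def Y_def cmod_power2)
  have 1: "C1_on (- {p}) (\<lambda>z. r2 z powr q) (\<lambda>z. 2 * q * X z * r2 z powr (q - 1)) (\<lambda>z. 2 * q * Y z * r2 z powr (q - 1))" for q
    unfolding C1_on_def
  proof (intro conjI ballI)
    fix z assume z: "z \<in> - {p}"
    have *: "has_gradient r2 (2 * X z) (2 * Y z) z"
      unfolding r2 X_def Y_def by (auto intro!: derivative_eq_intros simp: algebra_simps)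
    have "((\<lambda>x. x powr q) has_real_derivative q * r2 z powr (q - 1)) (at (r2 z))"
      by (rule has_real_derivative_powr[OF pos[OF z]])
    from has_derivative_compose[OF * this[unfolded has_field_derivative_def]]
    show "has_gradient (\<lambda>z. r2 z powr q) (2 * q * X z * r2 z powr (q - 1)) (2 * q * Y z * r2 z powr (q - 1)) z"
      by (rule has_derivative_eq_rhs) (auto simp: algebra_simps)
  qed (auto intro!: continuous_intros simp: r2_def X_def Y_def)
  have X: "C1_on (- {p}) X (\<lambda>z. 1) (\<lambda>z. 0)" and Y: "C1_on (- {p}) Y (\<lambda>z. 0) (\<lambda>z. 1)"
    using C1_on_linear[of "- {p}" 1 p 0] C1_on_linear[of "- {p}" 0 p 1] by (auto simp: X_def Y_def)
  have e: "q - 1 - 1 = q - 2" by simp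
  show ?thesis
    unfolding C2_on_def
    using 1[of q] C1_on_cmult[OF C1_on_mult[OF X 1[of "q - 1"]], of "2 * q"]
       C1_on_cmult[OF C1_on_mult[OF Y 1[of "q - 1"]], of "2 * q"]
    by (simp add: algebra_simps e power2_eq_square)
qed

lemma C1_on_continuous_at: "C1_on S f fx fy \<Longrightarrow> z \<in> S \<Longrightarrow> continuous (at z) f"
  using C1_onD(1) has_derivative_continuous by blast

lemma eventually_ge_neg_within:
  fixes w :: "complex \<Rightarrow> real"
  assumes "continuous (at v) w" "w v \<ge> 0" "\<epsilon> > 0"
  shows "\<forall>\<^sub>F z in at v within U. w z \<ge> - \<epsilon>"
proof -
  have "(w \<longlongrightarrow> w v) (at v within U)"
    using assms(1) unfolding continuous_at by (rule tendsto_within_subset) simp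
  then have "\<forall>\<^sub>F z in at v within U. w z > - \<epsilon>"
    using assms by (intro order_tendstoD(1)) auto
  then show ?thesis by eventually_elim simp
qed

text \<open>
  A multiple of the decreasing radial function $|z-y|^{-2p}-R^{-2p}$, a subsolution for large \<open>p\<close>,
  lies below \<open>f\<close> on both boundary circles of the annulus, hence inside it, and is positive there.
\<close>

lemma positivity_spreads:
  assumes \<mu>: "\<mu> < 1" and r0: "0 < r0" "r0 < R" and D: "cball y R \<subseteq> D" "open D"
    and f: "C2_on D f fx fy fxx fxy fyy"
    and op: "\<And>z. z \<in> D \<Longrightarrow> \<exists>n. (norm n)\<^sup>2 \<le> \<mu> \<and> elliptic_op n (fxx z) (fxy z) (fyy z) \<le> 0"
    and nonneg: "\<And>z. z \<in> D \<Longrightarrow> f z \<ge> 0"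
    and m: "m > 0" "\<And>z. z \<in> cball y r0 \<Longrightarrow> f z \<ge> m"
    and z0: "z0 \<in> ball y R"
  shows "f z0 > 0"
proof (cases "z0 \<in> cball y r0")
  case True then show ?thesis using m by force
next
  case False
  define p where "p = 1 / (1 - \<mu>)"
  have p: "p > 0" "(1 - \<mu>) * p = 1" using \<mu> by (auto simp: p_def)
  define r2 where "r2 z = (norm (z - y))\<^sup>2" for z
  define U where "U = ball y R - cball y r0"
  have U: "open U" "bounded U" "U \<subseteq> D" "U \<subseteq> - {y}"
    using D r0 by (auto simp: U_def intro: bounded_subset[OF bounded_ball])
  define c where "c = m / (r0\<^sup>2) powr (- p)"
  have c: "c > 0" using m r0 by (simp add: c_def)
  define b where "b z = r2 z powr (- p) - (R\<^sup>2) powr (- p)" for z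
  define bxx where "bxx z = 2 * (- p) * r2 z powr (- p - 1) + 4 * (- p) * (- p - 1) * (Re (z - y))\<^sup>2 * r2 z powr (- p - 2)" for z
  define bxy where "bxy z = 4 * (- p) * (- p - 1) * Re (z - y) * Im (z - y) * r2 z powr (- p - 2)" for z
  define byy where "byy z = 2 * (- p) * r2 z powr (- p - 1) + 4 * (- p) * (- p - 1) * (Im (z - y))\<^sup>2 * r2 z powr (- p - 2)" for z
  obtain bx by' where b: "C2_on (- {y}) b bx by' bxx bxy byy"
    using C2_on_add[OF norm_powr_C2[of y "- p"] C2_on_const[of _ "- ((R\<^sup>2) powr (- p))"]]
    unfolding b_def[abs_def] r2_def[abs_def] bxx_def[abs_def] bxy_def[abs_def] byy_def[abs_def] by simp
  define w where "w z = f z + (- c) * b z" for z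
  have w: "C2_on U w (\<lambda>z. fx z + (- c) * bx z) (\<lambda>z. fy z + (- c) * by' z)
     (\<lambda>z. fxx z + (- c) * bxx z) (\<lambda>z. fxy z + (- c) * bxy z) (\<lambda>z. fyy z + (- c) * byy z)"
    unfolding w_def
    by (intro C2_on_add C2_on_cmult C2_on_subset[OF f U(3)] C2_on_subset[OF b U(4)])
  have b_op: "elliptic_op n (bxx z) (bxy z) (byy z) \<ge> 0" if "z \<in> U" and n: "(norm n)\<^sup>2 \<le> \<mu>" for z n
  proof -
    have "r2 z > 0" using that U by (auto simp: r2_def)
    define S where "S = r2 z powr (- p - 2)"
    have e: "- p - 1 = 1 + (- p - 2)" by simp
    have S: "S > 0" "r2 z powr (- p - 1) = r2 z * S"
      using \<open>r2 z > 0\<close> by (simp add: S_def, unfold e powr_add S_def, simp)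
    define X Y where "X = Re (z - y)" and "Y = Im (z - y)"
    have r: "r2 z = X\<^sup>2 + Y\<^sup>2" by (simp add: r2_def X_def Y_def cmod_power2)
    have b': "bxx z = - 2 * p * (r2 z * S) + 4 * p * (p + 1) * X\<^sup>2 * S"
      "byy z = - 2 * p * (r2 z * S) + 4 * p * (p + 1) * Y\<^sup>2 * S"
      "bxy z = 4 * p * (p + 1) * X * Y * S"
      unfolding bxx_def byy_def bxy_def S(2) X_def[symmetric] Y_def[symmetric] S_def[symmetric]
      by (simp_all add: algebra_simps)
    have t1: "bxx z + byy z = 4 * p\<^sup>2 * r2 z * S"
      unfolding b' r
      by (simp add: algebra_simps power2_eq_square)
    have t2: "bxx z * (Im n)\<^sup>2 + 2 * bxy z * Im n * (- Re n) + byy z * (- Re n)\<^sup>2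
       = - 2 * p * r2 z * S * (norm n)\<^sup>2 + 4 * p * (p + 1) * (X * Im n - Y * Re n)\<^sup>2 * S"
      unfolding b' r cmod_power2
      by (simp add: algebra_simps power2_eq_square)
    have "- 2 * p * r2 z * S * (norm n)\<^sup>2 \<ge> - 2 * p * r2 z * S * 1"
      using p \<open>r2 z > 0\<close> S n \<mu> by (intro mult_left_mono_neg) auto
    moreover have "(1 - (norm n)\<^sup>2) * (4 * p\<^sup>2 * r2 z * S) \<ge> (1 - \<mu>) * (4 * p\<^sup>2 * r2 z * S)"
      using n \<open>r2 z > 0\<close> S by (intro mult_right_mono) auto
    moreover have "(1 - \<mu>) * (4 * p\<^sup>2 * r2 z * S) = 4 * p * r2 z * S"
      using p(2) by (simp add: power2_eq_square)
    moreover have "4 * p * (p + 1) * (X * Im n - Y * Re n)\<^sup>2 * S \<ge> 0" "p * r2 z * S > 0"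
      using p \<open>r2 z > 0\<close> S by auto
    ultimately show ?thesis unfolding elliptic_op_split t1 t2 by linarith
  qed
  have "w z0 \<ge> 0"
  proof (rule weak_max_principle[OF U(1,2) \<mu> w])
    fix K assume "K \<subseteq> U"
    have "\<exists>n. (norm n)\<^sup>2 \<le> \<mu> \<and> elliptic_op n (fxx z + - c * bxx z) (fxy z + - c * bxy z) (fyy z + - c * byy z) \<le> 0" if "z \<in> K" for z
    proof -
      have z: "z \<in> U" "z \<in> D" using that \<open>K \<subseteq> U\<close> U by auto
      obtain n where n: "(norm n)\<^sup>2 \<le> \<mu>" "elliptic_op n (fxx z) (fxy z) (fyy z) \<le> 0" using op[OF z(2)] by blast
      have "elliptic_op n (fxx z + - c * bxx z) (fxy z + - c * bxy z) (fyy z + - c * byy z)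
        = elliptic_op n (fxx z) (fxy z) (fyy z) - c * elliptic_op n (bxx z) (bxy z) (byy z)"
        by (simp add: elliptic_op_def algebra_simps)
      moreover have "c * elliptic_op n (bxx z) (bxy z) (byy z) \<ge> 0"
        using b_op[OF z(1) n(1)] c by simp
      ultimately have "elliptic_op n (fxx z + - c * bxx z) (fxy z + - c * bxy z) (fyy z + - c * byy z) \<le> 0"
        using n(2) by linarith
      then show ?thesis using n(1) by blast
    qed
    then show "\<exists>C. \<forall>z\<in>K. \<exists>n. (norm n)\<^sup>2 \<le> \<mu> \<and> elliptic_op n (fxx z + - c * bxx z) (fxy z + - c * bxy z) (fyy z + - c * byy z)
       \<le> C * (\<bar>fx z + - c * bx z\<bar> + \<bar>fy z + - c * by' z\<bar>)"
      by (intro exI[of _ 0]) simp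
  next
    fix x \<epsilon> :: real and v assume v: "v \<in> frontier U" and "\<epsilon> > 0"
    have "closure U \<subseteq> {z. r0 \<le> dist y z \<and> dist y z \<le> R}"
      by (rule closure_minimal) (auto simp: U_def intro!: closed_Collect_conj closed_Collect_le continuous_intros)
    then have vd: "dist y v = r0 \<or> dist y v = R"
      using v U(1) by (auto simp: frontier_def interior_open U_def)
    have vD: "v \<in> D" "v \<in> - {y}" using vd r0 D(1) by (auto simp: subset_iff)
    have "w v \<ge> 0"
      using vd
    proof
      assume d: "dist y v = r0"
      then have "f v \<ge> m" using m by simp
      moreover have "c * b v \<le> m"
        using d c m r0 by (simp add: b_def r2_def c_def dist_norm norm_minus_commute algebra_simps)
      ultimately show ?thesis by (simp add: w_def)
    next
      assume "dist y v = R"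
      then show ?thesis using nonneg[OF vD(1)] by (simp add: w_def b_def r2_def dist_norm norm_minus_commute)
    qed
    have "continuous (at v) w"
      unfolding w_def
      by (intro continuous_intros C1_on_continuous_at[of D] C1_on_continuous_at[of "- {y}"] vD)
        (use f b in \<open>auto simp: C2_on_def\<close>)
    then show "\<forall>\<^sub>F z in at v within U. w z \<ge> - \<epsilon>"
      using eventually_ge_neg_within \<open>w v \<ge> 0\<close> \<open>\<epsilon> > 0\<close> by blast
  next
    show "z0 \<in> U" using z0 False by (simp add: U_def)
  qed
  moreover have "c * b z0 > 0"
  proof (rule mult_pos_pos[OF c])
    have "0 < r2 z0" "r2 z0 < R\<^sup>2"
      using z0 False r0 by (auto simp: r2_def dist_norm norm_minus_commute power2_less_imp_less intro!: power_strict_mono)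
    then show "b z0 > 0" using p by (simp add: b_def powr_less_mono2_neg)
  qed
  ultimately show ?thesis unfolding w_def by linarith
qed

text \<open>
  By \<open>positivity_spreads\<close> the set where \<open>f\<close> is positive is relatively closed as well as open.
\<close>

lemma strong_max_principle:
  assumes \<mu>: "\<mu> < 1" and D: "open D" "connected D"
    and f: "C2_on D f fx fy fxx fxy fyy"
    and op: "\<And>z. z \<in> D \<Longrightarrow> \<exists>n. (norm n)\<^sup>2 \<le> \<mu> \<and> elliptic_op n (fxx z) (fxy z) (fyy z) \<le> 0"
    and nonneg: "\<And>z. z \<in> D \<Longrightarrow> f z \<ge> 0"
    and z: "z \<in> D" "f z = 0" and z': "z' \<in> D"
  shows "f z' = 0"
proof -
  have fc: "continuous_on D f" using f C1_onD(4) unfolding C2_on_def by blast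
  define P where "P = {z \<in> D. f z > 0}"
  have "open P" unfolding P_def by (rule open_superlevel[OF D(1) fc])
  have "open (D - P)"
    unfolding open_contains_ball
  proof
    fix z assume z: "z \<in> D - P"
    then have fz: "f z = 0" using nonneg[of z] by (auto simp: P_def)
    obtain e where e: "e > 0" "ball z e \<subseteq> D" using z D(1) open_contains_ball by blast
    have "f y = 0" if y: "y \<in> ball z (e/4)" for y
    proof (rule ccontr)
      assume "f y \<noteq> 0"
      have yD: "y \<in> D" using y e by (auto simp: subset_iff)
      then have "f y > 0" using nonneg[of y] \<open>f y \<noteq> 0\<close> by simp
      then have "y \<in> {z \<in> D. f z > f y / 2}" using yD by simp
      then obtain r where r: "r > 0" "cball y r \<subseteq> {z \<in> D. f z > f y / 2}"
        using open_superlevel[OF D(1) fc] open_contains_cball by metis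
      have "cball y (e/2) \<subseteq> ball z e"
      proof
        fix x assume "x \<in> cball y (e/2)"
        then show "x \<in> ball z e" using y dist_triangle[of z x y] e by auto
      qed
      moreover have "f x \<ge> f y / 2" if "x \<in> cball y (min r (e/4))" for x
        using r(2) that by (auto simp: subset_iff less_imp_le)
      ultimately have "f z > 0"
        using e r y \<open>f y > 0\<close>
        by (intro positivity_spreads[OF \<mu> _ _ _ D(1) f op nonneg, of "min r (e/4)" "e/2" y "f y / 2"])
          (auto simp: dist_commute)
      then show False using fz by simp
    qed
    then show "\<exists>e>0. ball z e \<subseteq> D - P" using e
      by (intro exI[of _ "e/4"]) (auto simp: P_def subset_iff)
  qed
  then have "P \<inter> D = {} \<or> (D - P) \<inter> D = {}"
    using connectedD[OF D(2) \<open>open P\<close>, of "D - P"] by auto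
  moreover have "z \<in> D - P" using z by (auto simp: P_def)
  ultimately have "P \<inter> D = {}" by blast
  then show ?thesis using z' nonneg[OF z'] by (force simp: P_def)
qed

section \<open>Positive solutions near a protruding corner\<close>

text \<open>
  In polar coordinates about \<open>p\<close>, with the angle $\theta$ measured from the direction \<open>d\<close>, the barrier is
  $r^{1-2q}(\cos\theta+\tau)$. It is positive in a sector wider than a half plane. For $q=0$ the Hessian has
  the single nonzero entry $\tau/r$, in the angular direction, because a function $r\,s(\theta)$ has
  only the entry $(s''+s)/r$. So the barrier is a subsolution of every elliptic operator with $q=0$, with room of order $\tau$
  that absorbs the terms of order $q$ created by lowering the exponent below $1$.
\<close>

lemma corner_barrier:
  fixes d p :: complex and \<tau> \<mu> q :: real
  assumes d: "norm d = 1" and \<tau>: "0 < \<tau>" "\<tau> \<le> 1" and \<mu>: "0 \<le> \<mu>" "\<mu> < 1" and q: "0 < q" "q \<le> (1 - \<mu>) * \<tau> / 100"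
  defines "b \<equiv> \<lambda>z. (Re d * Re (z - p) + Im d * Im (z - p)) * ((norm (z - p))\<^sup>2) powr (- q) + \<tau> * ((norm (z - p))\<^sup>2) powr (1/2 - q)"
  shows "\<exists>bx by' bxx bxy byy. C2_on (- {p}) b bx by' bxx bxy byy \<and>
    (\<forall>z\<in>-{p}. \<forall>n. (norm n)\<^sup>2 \<le> \<mu> \<longrightarrow> elliptic_op n (bxx z) (bxy z) (byy z) \<ge> 0)"
proof -
  define r2 where "r2 z = (norm (z - p))\<^sup>2" for z
  define X where "X z = Re (z - p)" for z
  define Y where "Y z = Im (z - p)" for z
  define u where "u q z = r2 z powr q" for q z
  define uxx where "uxx q z = 2 * q * u (q - 1) z + 4 * q * (q - 1) * (X z)\<^sup>2 * u (q - 2) z" for q z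
  define uyy where "uyy q z = 2 * q * u (q - 1) z + 4 * q * (q - 1) * (Y z)\<^sup>2 * u (q - 2) z" for q z
  define uxy where "uxy q z = 4 * q * (q - 1) * X z * Y z * u (q - 2) z" for q z
  define L where "L z = Re d * Re (z - p) + Im d * Im (z - p)" for z
  define q' where "q' = 1/2 - q"
  have U: "C2_on (- {p}) (u q) (\<lambda>z. 2 * q * X z * u (q - 1) z) (\<lambda>z. 2 * q * Y z * u (q - 1) z) (uxx q) (uxy q) (uyy q)" for q
    using norm_powr_C2[of p q] unfolding u_def[abs_def] uxx_def[abs_def] uxy_def[abs_def] uyy_def[abs_def] r2_def X_def Y_def .
  define bxx where "bxx z = (L z * uxx (-q) z + 2 * Re d * (2 * (-q) * X z * u (-q - 1) z)) + \<tau> * uxx q' z" for z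
  define bxy where "bxy z = (L z * uxy (-q) z + (Re d * (2 * (-q) * Y z * u (-q - 1) z) + Im d * (2 * (-q) * X z * u (-q - 1) z))) + \<tau> * uxy q' z" for z
  define byy where "byy z = (L z * uyy (-q) z + 2 * Im d * (2 * (-q) * Y z * u (-q - 1) z)) + \<tau> * uyy q' z" for z
  have "b = (\<lambda>z. L z * u (-q) z + \<tau> * u q' z)"
    by (auto simp: b_def L_def u_def r2_def q'_def)
  moreover note C2_on_add[OF C2_on_linear_mult[OF U[of "- q"], of "Re d" p "Im d"] C2_on_cmult[OF U[of q'], of \<tau>]]
  ultimately obtain bx by' where C2: "C2_on (- {p}) b bx by' bxx bxy byy"
    unfolding bxx_def[abs_def] bxy_def[abs_def] byy_def[abs_def] L_def by simp
  have "elliptic_op n (bxx z) (bxy z) (byy z) \<ge> 0" if z: "z \<in> - {p}" and n: "(norm n)\<^sup>2 \<le> \<mu>" for z n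
  proof -
    define x y where "x = X z" and "y = Y z"
    define e f where "e = Re d" and "f = Im d"
    define R where "R = norm (z - p)"
    define S where "S = u (- q - 2) z"
    define m1 m2 where "m1 = Im n" and "m2 = - Re n"
    have R: "R > 0" "R\<^sup>2 = x\<^sup>2 + y\<^sup>2" "r2 z = R\<^sup>2"
      using z by (auto simp: R_def x_def y_def X_def Y_def r2_def cmod_power2)
    have S: "S > 0" using R(1) unfolding S_def u_def R(3) by simp
    have E: "- q - 1 = 1 + (- q - 2)" "q' - 1 = 3/2 + (- q - 2)" "q' - 2 = 1/2 + (- q - 2)"
      by (auto simp: q'_def)
    have h: "R\<^sup>2 powr (1/2) = R" "R\<^sup>2 powr (3/2) = R * R\<^sup>2"
    proof -
      show 1: "R\<^sup>2 powr (1/2) = R" using R(1) by (simp add: powr_half_sqrt)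
      have "R\<^sup>2 powr (3/2) = R\<^sup>2 powr (1/2 + 1)" by simp
      also have "\<dots> = R * R\<^sup>2" unfolding powr_add 1 using R(1) by simp
      finally show "R\<^sup>2 powr (3/2) = R * R\<^sup>2" .
    qed
    have u: "u (- q - 1) z = R\<^sup>2 * S" "u (q' - 1) z = R * R\<^sup>2 * S" "u (q' - 2) z = R * S"
      unfolding u_def S_def R(3) E powr_add h using R(1) by simp_all
    define l where "l = e * x + f * y"
    have l: "L z = l" by (simp add: L_def l_def e_def f_def x_def y_def X_def Y_def)
    have ef: "e\<^sup>2 + f\<^sup>2 = 1" using d by (simp add: e_def f_def cmod_power2[symmetric])
    have lR: "\<bar>l\<bar> \<le> R"
    proof -
      have "l\<^sup>2 + (e * y - f * x)\<^sup>2 = (e\<^sup>2 + f\<^sup>2) * R\<^sup>2" unfolding l_def R(2) by algebra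
      then have "l\<^sup>2 \<le> R\<^sup>2" unfolding ef using zero_le_power2[of "e * y - f * x"] by linarith
      then show ?thesis using R(1) by (simp add: abs_le_square_iff[symmetric])
    qed
    define M where "M = m1\<^sup>2 + m2\<^sup>2"
    have M: "0 \<le> M" "M \<le> 1" "(norm n)\<^sup>2 = M" using n \<mu> by (auto simp: M_def m1_def m2_def cmod_power2)
    define k where "k = x * m1 + y * m2"
    have k: "k\<^sup>2 \<le> R\<^sup>2 * M" "k\<^sup>2 \<le> R\<^sup>2"
    proof -
      have "k\<^sup>2 + (x * m2 - y * m1)\<^sup>2 = R\<^sup>2 * M" unfolding k_def R(2) M_def by algebra
      moreover have "R\<^sup>2 * M \<le> R\<^sup>2 * 1" using M by (intro mult_left_mono) auto
      ultimately show "k\<^sup>2 \<le> R\<^sup>2 * M" "k\<^sup>2 \<le> R\<^sup>2" using zero_le_power2[of "x * m2 - y * m1"] by linarith+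
    qed
    define g where "g = e * m1 + f * m2"
    have g: "g\<^sup>2 \<le> 1"
    proof -
      have "g\<^sup>2 + (e * m2 - f * m1)\<^sup>2 = (e\<^sup>2 + f\<^sup>2) * M" unfolding g_def M_def by algebra
      then show ?thesis using M zero_le_power2[of "e * m2 - f * m1"] unfolding ef by linarith
    qed
    have q14: "q \<le> 1/100" "q \<le> \<tau>/100"
    proof -
      have *: "(1 - \<mu>) * \<tau> \<le> 1 * 1" "(1 - \<mu>) * \<tau> \<le> 1 * \<tau>" using \<mu> \<tau> by (intro mult_mono; simp)+
      then show "q \<le> 1/100" "q \<le> \<tau>/100" using q by auto
    qed
    have hess: "bxx z = S * (l * (- 2 * q * R\<^sup>2 + 4 * q * (q + 1) * x\<^sup>2) - 4 * q * e * x * R\<^sup>2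
          + \<tau> * (2 * q' * (R * R\<^sup>2) + 4 * q' * (q' - 1) * x\<^sup>2 * R))"
      "bxy z = S * (l * (4 * q * (q + 1) * x * y) - 2 * q * (e * y + f * x) * R\<^sup>2
          + \<tau> * (4 * q' * (q' - 1) * x * y * R))"
      "byy z = S * (l * (- 2 * q * R\<^sup>2 + 4 * q * (q + 1) * y\<^sup>2) - 4 * q * f * y * R\<^sup>2
          + \<tau> * (2 * q' * (R * R\<^sup>2) + 4 * q' * (q' - 1) * y\<^sup>2 * R))"
      unfolding bxx_def bxy_def byy_def uxx_def uxy_def uyy_def u l
        x_def[symmetric] y_def[symmetric] e_def[symmetric] f_def[symmetric] S_def[symmetric]
      by algebra+
    have lap: "bxx z + byy z = S * (l * (4 * q\<^sup>2 - 4 * q) * R\<^sup>2 + 4 * \<tau> * q'\<^sup>2 * (R * R\<^sup>2))"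
      unfolding hess using R(2) l_def by algebra
    have quad: "bxx z * m1\<^sup>2 + 2 * bxy z * m1 * m2 + byy z * m2\<^sup>2
       = S * (l * (- 2 * q * R\<^sup>2 * M + 4 * q * (q + 1) * k\<^sup>2) - 4 * q * g * k * R\<^sup>2
           + \<tau> * (2 * q' * (R * R\<^sup>2) * M + 4 * q' * (q' - 1) * k\<^sup>2 * R))"
      unfolding hess M_def k_def g_def by algebra
    define T where "T = R * R\<^sup>2"
    have T: "T > 0" using R(1) by (simp add: T_def)
    have q': "q' \<ge> 49/100" "q' \<le> 1/2" "q' - 1 = - (1/2 + q)" using q14 q by (auto simp: q'_def)
    have lap_ge: "l * (4 * q\<^sup>2 - 4 * q) * R\<^sup>2 + 4 * \<tau> * q'\<^sup>2 * T \<ge> (92/100) * \<tau> * T"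
    proof -
      have "4 * q - 4 * q\<^sup>2 \<ge> 0" using q14 q by (simp add: power2_eq_square)
      then have "l * ((4 * q - 4 * q\<^sup>2) * R\<^sup>2) \<le> R * ((4 * q - 4 * q\<^sup>2) * R\<^sup>2)"
        using lR by (intro mult_right_mono) auto
      also have "\<dots> \<le> R * (4 * q * R\<^sup>2)" using R(1) by (intro mult_left_mono mult_right_mono) auto
      also have "\<dots> = 4 * q * T" by (simp add: T_def)
      also have "\<dots> \<le> (4/100) * \<tau> * T" using q14 T by (intro mult_right_mono) auto
      finally have 1: "l * ((4 * q - 4 * q\<^sup>2) * R\<^sup>2) \<le> (4/100) * \<tau> * T" .
      have "(49/100)\<^sup>2 \<le> q'\<^sup>2" using q' by (intro power_mono) auto
      then have "(96/100) * (\<tau> * T) \<le> (4 * q'\<^sup>2) * (\<tau> * T)" using \<tau> T by (intro mult_right_mono) (auto simp: power2_eq_square)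
      then show ?thesis using 1 by (simp add: algebra_simps)
    qed
    have 1: "(1 - M) * (l * (4 * q\<^sup>2 - 4 * q) * R\<^sup>2 + 4 * \<tau> * q'\<^sup>2 * T) \<ge> 92 * q * T"
    proof -
      have "92 * q * T \<le> (92/100) * ((1 - \<mu>) * \<tau>) * T" using q T by (intro mult_right_mono) (simp_all add: mult.commute)
      also have "\<dots> = (1 - \<mu>) * ((92/100) * \<tau> * T)" by simp
      also have "\<dots> \<le> (1 - M) * (l * (4 * q\<^sup>2 - 4 * q) * R\<^sup>2 + 4 * \<tau> * q'\<^sup>2 * T)"
        using lap_ge \<mu> n \<tau> T M by (intro mult_mono) auto
      finally show ?thesis .
    qed
    have 2: "l * (- 2 * q * R\<^sup>2 * M + 4 * q * (q + 1) * k\<^sup>2) \<ge> - (7 * q * T)"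
    proof -
      have "R\<^sup>2 * M \<le> R\<^sup>2 * 1" using M by (intro mult_left_mono) auto
      then have a: "q * (R\<^sup>2 * M) \<le> q * R\<^sup>2" "0 \<le> q * (R\<^sup>2 * M)" using q M by (auto intro!: mult_left_mono mult_nonneg_nonneg)
      have "(q + 1) * k\<^sup>2 \<le> (101/100) * R\<^sup>2" using k q14 q by (intro mult_mono) auto
      then have b: "q * ((q + 1) * k\<^sup>2) \<le> q * ((101/100) * R\<^sup>2)" "0 \<le> q * ((q + 1) * k\<^sup>2)" using q by (auto intro!: mult_left_mono mult_nonneg_nonneg)
      have "\<bar>- 2 * q * R\<^sup>2 * M + 4 * q * (q + 1) * k\<^sup>2\<bar> = \<bar>- 2 * (q * (R\<^sup>2 * M)) + 4 * (q * ((q + 1) * k\<^sup>2))\<bar>" by (simp add: algebra_simps)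
      also have "\<dots> \<le> 7 * (q * R\<^sup>2)" using a b q zero_le_power2[of R] by linarith
      finally have "\<bar>l\<bar> * \<bar>- 2 * q * R\<^sup>2 * M + 4 * q * (q + 1) * k\<^sup>2\<bar> \<le> R * (7 * (q * R\<^sup>2))"
        using lR by (intro mult_mono) auto
      then have "\<bar>l * (- 2 * q * R\<^sup>2 * M + 4 * q * (q + 1) * k\<^sup>2)\<bar> \<le> 7 * q * T"
        by (simp add: abs_mult T_def mult_ac)
      then show ?thesis by linarith
    qed
    have 3: "- 4 * q * g * k * R\<^sup>2 \<ge> - (4 * q * T)"
    proof -
      have "\<bar>g\<bar> \<le> 1" "\<bar>k\<bar> \<le> R" using g k(2) R(1) by (auto simp: abs_le_square_iff[symmetric] abs_square_le_1)
      then have "\<bar>g\<bar> * \<bar>k\<bar> \<le> 1 * R" by (intro mult_mono) auto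
      then have "(\<bar>g\<bar> * \<bar>k\<bar>) * (4 * q * R\<^sup>2) \<le> R * (4 * q * R\<^sup>2)" using q by (intro mult_right_mono) auto
      then have "\<bar>- 4 * q * g * k * R\<^sup>2\<bar> \<le> 4 * q * T"
        using q by (simp add: abs_mult T_def mult_ac)
      then show ?thesis by linarith
    qed
    have 4: "\<tau> * (2 * q' * T * M + 4 * q' * (q' - 1) * k\<^sup>2 * R) \<ge> - (2 * q * T)"
    proof -
      have "(4 * q' * (1/2 + q) * R) * k\<^sup>2 \<le> (4 * q' * (1/2 + q) * R) * (R\<^sup>2 * M)"
        using k(1) q' q R(1) by (intro mult_left_mono) auto
      then have "2 * q' * T * M + 4 * q' * (q' - 1) * k\<^sup>2 * R \<ge> - (4 * q * q' * T * M)"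
        unfolding q'(3) T_def by (simp add: algebra_simps)
      moreover have "4 * q * q' * T * M \<le> 4 * q * (1/2) * T * 1" using q' M q T by (intro mult_mono) auto
      ultimately have *: "2 * q' * T * M + 4 * q' * (q' - 1) * k\<^sup>2 * R \<ge> - (2 * q * T)" by linarith
      have "\<tau> * (2 * q' * T * M + 4 * q' * (q' - 1) * k\<^sup>2 * R) \<ge> \<tau> * - (2 * q * T)"
        using * \<tau> by (intro mult_left_mono) auto
      moreover have "\<tau> * (2 * q * T) \<le> 1 * (2 * q * T)" using \<tau> q T by (intro mult_right_mono) auto
      ultimately show ?thesis by linarith
    qed
    have "elliptic_op n (bxx z) (bxy z) (byy z) = (1 - M) * (bxx z + byy z) + (bxx z * m1\<^sup>2 + 2 * bxy z * m1 * m2 + byy z * m2\<^sup>2)"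
      unfolding elliptic_op_split M m1_def m2_def by simp
    also have "\<dots> = S * ((1 - M) * (l * (4 * q\<^sup>2 - 4 * q) * R\<^sup>2 + 4 * \<tau> * q'\<^sup>2 * T)
        + (l * (- 2 * q * R\<^sup>2 * M + 4 * q * (q + 1) * k\<^sup>2) - 4 * q * g * k * R\<^sup>2
           + \<tau> * (2 * q' * T * M + 4 * q' * (q' - 1) * k\<^sup>2 * R)))"
      unfolding lap quad T_def by algebra
    also have "\<dots> \<ge> 0"
      using S 1 2 3 4 mult_pos_pos[OF q(1) T] by (intro mult_nonneg_nonneg) linarith+
    finally show ?thesis .
  qed
  then show ?thesis using C2 by blast
qed

text \<open>
  The closed cone in which the corner barrier is nonnegative fits into the sector, up to its vertex.
\<close>

lemma wide_sector_contains_cone: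
  assumes d: "d = cis (\<alpha> + \<delta>/2)" and \<delta>: "pi < \<delta>" "\<delta> \<le> 2 * pi"
    and \<tau>: "\<tau> < - cos (\<delta>/2)" and z: "0 < norm (z - p)" "norm (z - p) < \<epsilon>"
    and cone: "Re d * Re (z - p) + Im d * Im (z - p) + \<tau> * norm (z - p) \<ge> 0"
  shows "z \<in> open_sector p \<epsilon> \<alpha> \<delta>"
proof -
  define r where "r = norm (z - p)"
  define \<phi> where "\<phi> = Arg ((z - p) * cnj d)"
  have nd: "norm d = 1" by (simp add: d)
  have dd: "d * cnj d = 1" using nd by (simp add: complex_norm_square[symmetric])
  have "norm ((z - p) * cnj d) = r" by (simp add: norm_mult nd r_def)
  then have zd: "(z - p) * cnj d = of_real r * cis \<phi>"
    unfolding \<phi>_def by (metis cis_Arg_unique cis_conv_exp rcis_cmod_Arg rcis_def)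
  have \<phi>: "- pi < \<phi>" "\<phi> \<le> pi" using Arg_bounded[of "(z - p) * cnj d"] by (auto simp: \<phi>_def)
  have "Re d * Re (z - p) + Im d * Im (z - p) = Re ((z - p) * cnj d)" by simp
  also have "\<dots> = r * cos \<phi>" by (simp add: zd)
  finally have "r * (cos \<phi> + \<tau>) \<ge> 0" using cone by (simp add: r_def algebra_simps)
  then have "cos \<phi> + \<tau> \<ge> 0" using z by (simp add: r_def zero_le_mult_iff)
  then have "cos (\<delta>/2) < cos \<bar>\<phi>\<bar>" using \<tau> by (simp add: abs_if)
  then have "\<bar>\<phi>\<bar> < \<delta>/2"
    using \<phi> \<delta> cos_monotone_0_pi_le[of "\<delta>/2" "\<bar>\<phi>\<bar>"] by (force simp: not_le[symmetric])
  then have "\<alpha> < \<alpha> + \<delta>/2 + \<phi>" "\<alpha> + \<delta>/2 + \<phi> < \<alpha> + \<delta>" by auto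
  moreover have "z = p + of_real r * cis (\<alpha> + \<delta>/2 + \<phi>)"
  proof -
    have "z - p = ((z - p) * cnj d) * d" using dd by (simp add: mult.assoc mult.commute)
    also have "\<dots> = of_real r * cis \<phi> * d" by (simp only: zd)
    also have "\<dots> = of_real r * cis (\<alpha> + \<delta>/2 + \<phi>)" unfolding d by (simp add: mult.assoc cis_mult add.commute)
    finally show ?thesis by (simp add: algebra_simps)
  qed
  ultimately show ?thesis unfolding open_sector_def mem_Collect_eq using z r_def
    by (intro exI[of _ r] exI[of _ "\<alpha> + \<delta>/2 + \<phi>"] conjI) simp_all
qed

text \<open>
  Comparison with the barrier gives $f\ge c\,r^{1-2q}$ along the axis of the sector, whereas $f\le Gr$ when the gradient is
  bounded and $f$ tends to $0$ at the vertex. For small $r$ these contradict each other.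
\<close>

lemma unbounded_gradient_at_corner:
  assumes \<mu>: "0 \<le> \<mu>" "\<mu> < 1" and "open D"
    and f: "C2_on D f fx fy fxx fxy fyy"
    and op: "\<And>z. z \<in> D \<Longrightarrow> \<exists>n. (norm n)\<^sup>2 \<le> \<mu> \<and> elliptic_op n (fxx z) (fxy z) (fyy z) \<le> 0"
    and sector: "open_sector p \<epsilon> \<alpha> \<delta> \<subseteq> D" "\<epsilon> > 0" "pi < \<delta>" "\<delta> \<le> 2 * pi"
    and pos: "\<And>z. z \<in> open_sector p \<epsilon> \<alpha> \<delta> \<Longrightarrow> f z > 0"
    and grad: "\<And>z. z \<in> open_sector p \<epsilon> \<alpha> \<delta> \<Longrightarrow> \<bar>fx z\<bar> + \<bar>fy z\<bar> \<le> G"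
    and lim: "(f \<longlongrightarrow> 0) (at p within D)" and "p \<notin> D"
  shows False
proof -
  define d where "d = cis (\<alpha> + \<delta>/2)"
  have nd: "norm d = 1" "(Re d)\<^sup>2 + (Im d)\<^sup>2 = 1" by (auto simp: d_def)
  have "cos (\<delta>/2) < cos (pi/2)" using sector by (intro cos_monotone_0_pi) auto
  then have cd: "cos (\<delta>/2) < 0" by simp
  \<comment> \<open>half of the largest value for which the cone of the barrier fits into the sector\<close>
  define \<tau> where "\<tau> = - cos (\<delta>/2) / 2"
  have \<tau>: "0 < \<tau>" "\<tau> \<le> 1" "\<tau> < - cos (\<delta>/2)"
    using cd cos_ge_minus_one[of "\<delta>/2"] unfolding \<tau>_def by linarith+
  define q where "q = (1 - \<mu>) * \<tau> / 100"
  have q: "0 < q" "q \<le> (1 - \<mu>) * \<tau> / 100" using \<mu> \<tau> by (auto simp: q_def)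
  have "(1 - \<mu>) * \<tau> \<le> 1 * 1" using \<mu> \<tau> by (intro mult_mono) auto
  then have q2: "q < 1/2" unfolding q_def by linarith
  define L where "L z = Re d * Re (z - p) + Im d * Im (z - p)" for z
  define r where "r z = norm (z - p)" for z
  define b where "b = (\<lambda>z. (Re d * Re (z - p) + Im d * Im (z - p)) * ((norm (z - p))\<^sup>2) powr (- q) + \<tau> * ((norm (z - p))\<^sup>2) powr (1/2 - q))"
  obtain bx by' bxx bxy byy where b: "C2_on (- {p}) b bx by' bxx bxy byy"
    and b_op: "\<And>z n. z \<noteq> p \<Longrightarrow> (norm n)\<^sup>2 \<le> \<mu> \<Longrightarrow> elliptic_op n (bxx z) (bxy z) (byy z) \<ge> 0"
    using corner_barrier[OF nd(1) \<tau>(1,2) \<mu> q, of p] unfolding b_def by force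
  have b_eq: "b z = (L z + \<tau> * r z) * (r z) powr (- 2 * q)" if "z \<noteq> p" for z
  proof -
    have "r z > 0" using that by (simp add: r_def)
    then have "(r z)\<^sup>2 powr (- q) = r z powr (- 2 * q)" "(r z)\<^sup>2 powr (1/2 - q) = r z * r z powr (- 2 * q)"
      by (simp_all add: powr_powr powr_mult_base flip: powr_numeral)
    then show ?thesis by (simp add: b_def L_def r_def algebra_simps)
  qed
  have Lr: "\<bar>L z\<bar> \<le> r z" for z
  proof -
    have "(L z)\<^sup>2 + (Re d * Im (z - p) - Im d * Re (z - p))\<^sup>2 = ((Re d)\<^sup>2 + (Im d)\<^sup>2) * (r z)\<^sup>2"
      unfolding L_def r_def cmod_power2 by algebra
    then have "(L z)\<^sup>2 \<le> (r z)\<^sup>2" unfolding nd using zero_le_power2[of "Re d * Im (z - p) - Im d * Re (z - p)"] by linarith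
    then show ?thesis by (simp add: abs_le_square_iff[symmetric] r_def)
  qed
  have b_le: "b z \<le> 2 * r z powr (1 - 2 * q)" if "z \<noteq> p" for z
  proof -
    have "r z > 0" using that by (simp add: r_def)
    have "\<tau> * r z \<le> 1 * r z" using \<tau> \<open>r z > 0\<close> by (intro mult_right_mono) auto
    then have "L z + \<tau> * r z \<le> 2 * r z" using Lr[of z] by linarith
    then have "b z \<le> 2 * r z * r z powr (- 2 * q)" unfolding b_eq[OF that] by (intro mult_right_mono) auto
    then show ?thesis using \<open>r z > 0\<close> by (simp add: powr_mult_base mult.assoc)
  qed
  define e where "e = \<epsilon> / 2"
  have e: "0 < e" "e < \<epsilon>" using sector by (auto simp: e_def)
  have in_sector: "z \<in> open_sector p \<epsilon> \<alpha> \<delta>" if "0 < r z" "r z \<le> e" "L z + \<tau> * r z \<ge> 0" for z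
    using wide_sector_contains_cone[OF d_def sector(3,4) \<tau>(3)] that e by (auto simp: r_def L_def)
  define A where "A = {z. r z = e \<and> L z + \<tau> * r z \<ge> 0}"
  have "compact A"
    unfolding compact_eq_bounded_closed
  proof
    show "bounded A" unfolding A_def r_def
      by (rule bounded_subset[of "cball p e"]) (auto simp: dist_norm norm_minus_commute)
    show "closed A" unfolding A_def r_def L_def
      by (intro closed_Collect_conj closed_Collect_le closed_Collect_eq continuous_intros)
  qed
  moreover have "p + of_real e * d \<in> A"
  proof -
    have "L (p + of_real e * d) = e * ((Re d)\<^sup>2 + (Im d)\<^sup>2)" by (simp add: L_def power2_eq_square algebra_simps)
    then show ?thesis using e \<tau> nd by (simp add: A_def r_def norm_mult)
  qed
  moreover have "continuous_on A f"
    using in_sector sector(1) e C1_onD(4)[of D f fx fy] f unfolding C2_on_def A_def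
    by (auto intro!: continuous_on_subset[of D f])
  ultimately obtain a where a: "a \<in> A" "\<And>z. z \<in> A \<Longrightarrow> f a \<le> f z"
    using continuous_attains_inf[of A f] by blast
  define m where "m = f a"
  have m: "m > 0" using a(1) in_sector[of a] e pos by (auto simp: m_def A_def)
  define c where "c = m / (2 * e powr (1 - 2 * q))"
  have c: "c > 0" using m e by (simp add: c_def)
  define U where "U = {z. 0 < r z \<and> r z < e \<and> L z + \<tau> * r z > 0}"
  have U: "open U" "bounded U" "U \<subseteq> - {p}" "U \<subseteq> open_sector p \<epsilon> \<alpha> \<delta>"
  proof -
    show "open U" unfolding U_def r_def L_def
      by (intro open_Collect_conj open_Collect_less continuous_intros)
    show "bounded U" unfolding U_def r_def
      by (rule bounded_subset[of "cball p e"]) (auto simp: dist_norm norm_minus_commute)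
    show "U \<subseteq> - {p}" by (auto simp: U_def r_def)
    show "U \<subseteq> open_sector p \<epsilon> \<alpha> \<delta>" using in_sector by (force simp: U_def)
  qed
  define w where "w z = f z + (- c) * b z" for z
  have w: "C2_on U w (\<lambda>z. fx z + (- c) * bx z) (\<lambda>z. fy z + (- c) * by' z)
     (\<lambda>z. fxx z + (- c) * bxx z) (\<lambda>z. fxy z + (- c) * bxy z) (\<lambda>z. fyy z + (- c) * byy z)"
    unfolding w_def
    using U sector(1) by (intro C2_on_add C2_on_cmult C2_on_subset[OF f] C2_on_subset[OF b]) auto
  have w_ge: "w z0 \<ge> 0" if z0: "z0 \<in> U" for z0
  proof (rule weak_max_principle[OF U(1,2) \<mu>(2) w _ _ z0])
    fix K assume "K \<subseteq> U"
    have "\<exists>n. (norm n)\<^sup>2 \<le> \<mu> \<and> elliptic_op n (fxx z + - c * bxx z) (fxy z + - c * bxy z) (fyy z + - c * byy z) \<le> 0" if "z \<in> K" for z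
    proof -
      have z: "z \<noteq> p" "z \<in> D" using that \<open>K \<subseteq> U\<close> U sector(1) by auto
      obtain n where n: "(norm n)\<^sup>2 \<le> \<mu>" "elliptic_op n (fxx z) (fxy z) (fyy z) \<le> 0" using op[OF z(2)] by blast
      have "elliptic_op n (fxx z + - c * bxx z) (fxy z + - c * bxy z) (fyy z + - c * byy z)
        = elliptic_op n (fxx z) (fxy z) (fyy z) - c * elliptic_op n (bxx z) (bxy z) (byy z)"
        by (simp add: elliptic_op_def algebra_simps)
      moreover have "c * elliptic_op n (bxx z) (bxy z) (byy z) \<ge> 0"
        using b_op[OF z(1) n(1)] c by simp
      ultimately have "elliptic_op n (fxx z + - c * bxx z) (fxy z + - c * bxy z) (fyy z + - c * byy z) \<le> 0"
        using n(2) by linarith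
      then show ?thesis using n(1) by blast
    qed
    then show "\<exists>C. \<forall>z\<in>K. \<exists>n. (norm n)\<^sup>2 \<le> \<mu> \<and> elliptic_op n (fxx z + - c * bxx z) (fxy z + - c * bxy z) (fyy z + - c * byy z)
       \<le> C * (\<bar>fx z + - c * bx z\<bar> + \<bar>fy z + - c * by' z\<bar>)"
      by (intro exI[of _ 0]) simp
  next
    fix \<eta> :: real and v assume v: "v \<in> frontier U" and \<eta>: "\<eta> > 0"
    have "closure U \<subseteq> {z. r z \<le> e \<and> L z + \<tau> * r z \<ge> 0}"
      unfolding U_def r_def L_def
      by (rule closure_minimal) (auto intro!: closed_Collect_conj closed_Collect_le continuous_intros)
    then have v': "r v \<le> e" "L v + \<tau> * r v \<ge> 0" and vU: "v \<notin> U"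
      using v U(1) by (auto simp: frontier_def interior_open)
    show "\<forall>\<^sub>F z in at v within U. w z \<ge> - \<eta>"
    proof (cases "v = p")
      case True
      have "((\<lambda>z. r z powr (1 - 2 * q)) \<longlongrightarrow> (norm (p - p)) powr (1 - 2 * q)) (at p within U)"
        unfolding r_def using q2 by (intro tendsto_powr' tendsto_intros) auto
      then have "((\<lambda>z. c * (2 * r z powr (1 - 2 * q))) \<longlongrightarrow> c * (2 * 0)) (at p within U)"
        by (intro tendsto_mult tendsto_const) simp
      then have "\<forall>\<^sub>F z in at p within U. c * (2 * r z powr (1 - 2 * q)) < \<eta>"
        using \<eta> by (intro order_tendstoD(2)) auto
      moreover have "\<forall>\<^sub>F z in at p within U. z \<in> U" by (auto simp: eventually_at_filter)
      ultimately have "\<forall>\<^sub>F z in at p within U. w z \<ge> - \<eta>"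
      proof eventually_elim
        case (elim z)
        then have "f z > 0" "z \<noteq> p" using U pos by auto
        moreover have "c * b z \<le> c * (2 * r z powr (1 - 2 * q))"
          using b_le[OF \<open>z \<noteq> p\<close>] c by (intro mult_left_mono) auto
        ultimately show ?case using elim unfolding w_def by linarith
      qed
      then show ?thesis using True by simp
    next
      case False
      then have rv: "0 < r v" by (simp add: r_def)
      then have vs: "v \<in> open_sector p \<epsilon> \<alpha> \<delta>" using in_sector v' by blast
      have "w v \<ge> 0"
      proof (cases "L v + \<tau> * r v = 0")
        case True
        then show ?thesis using pos[OF vs] b_eq[OF False] by (simp add: w_def)
      next
        case nz: False
        then have re: "r v = e" using vU v' rv by (auto simp: U_def)
        then have "f v \<ge> m" using a(2)[of v] v' by (simp add: m_def A_def)
        moreover have "c * b v \<le> c * (2 * r v powr (1 - 2 * q))"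
          using b_le[OF False] c by (intro mult_left_mono) auto
        moreover have "c * (2 * r v powr (1 - 2 * q)) = m" using e by (simp add: c_def re)
        ultimately show ?thesis unfolding w_def by linarith
      qed
      moreover have "continuous (at v) w"
        unfolding w_def
        using f b vs sector(1) False
        by (intro continuous_intros C1_on_continuous_at[of D f fx fy] C1_on_continuous_at[of "- {p}" b bx by'])
          (auto simp: C2_on_def)
      ultimately show ?thesis using eventually_ge_neg_within \<eta> by blast
    qed
  qed
  define \<gamma> where "\<gamma> t = p + of_real t * d" for t
  have \<gamma>: "L (\<gamma> t) = t" "r (\<gamma> t) = \<bar>t\<bar>" for t
  proof -
    have "L (\<gamma> t) = t * ((Re d)\<^sup>2 + (Im d)\<^sup>2)" by (simp add: L_def \<gamma>_def power2_eq_square algebra_simps)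
    then show "L (\<gamma> t) = t" by (simp add: nd)
    show "r (\<gamma> t) = \<bar>t\<bar>" by (simp add: r_def \<gamma>_def norm_mult nd)
  qed
  have \<gamma>U: "\<gamma> t \<in> U" if "0 < t" "t < e" for t
    using that \<tau> by (simp add: U_def \<gamma> add_pos_pos)
  have lower: "f (\<gamma> t) \<ge> c * (t * t powr (- 2 * q))" if t: "0 < t" "t < e" for t
  proof -
    have "\<gamma> t \<noteq> p" using \<gamma>(2)[of t] t by (auto simp: r_def)
    then have "b (\<gamma> t) = (t + \<tau> * t) * t powr (- 2 * q)" using b_eq[of "\<gamma> t"] t by (simp add: \<gamma>)
    moreover have "t * t powr (- 2 * q) \<le> (t + \<tau> * t) * t powr (- 2 * q)"
      using t \<tau> by (intro mult_right_mono) auto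
    ultimately have "c * (t * t powr (- 2 * q)) \<le> c * b (\<gamma> t)" using c by simp
    then show ?thesis using w_ge[OF \<gamma>U[OF t]] unfolding w_def by linarith
  qed
  have deriv: "((\<lambda>t. f (\<gamma> t)) has_real_derivative (fx (\<gamma> t) * Re d + fy (\<gamma> t) * Im d)) (at t)" if "0 < t" "t < e" for t
  proof (rule has_gradient_along)
    show "has_gradient f (fx (\<gamma> t)) (fy (\<gamma> t)) (\<gamma> t)"
      using \<gamma>U[OF that] U sector(1) f by (intro C1_onD(1)[of D]) (auto simp: C2_on_def)
    show "(\<gamma> has_vector_derivative d) (at t)" unfolding \<gamma>_def by (auto intro!: derivative_eq_intros)
  qed
  have slope: "\<bar>fx (\<gamma> t) * Re d + fy (\<gamma> t) * Im d\<bar> \<le> G" if "0 < t" "t < e" for t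
  proof -
    have "\<bar>Re d\<bar> \<le> 1" "\<bar>Im d\<bar> \<le> 1" using abs_Re_le_cmod[of d] abs_Im_le_cmod[of d] nd by auto
    then have "\<bar>fx (\<gamma> t)\<bar> * \<bar>Re d\<bar> \<le> \<bar>fx (\<gamma> t)\<bar> * 1" "\<bar>fy (\<gamma> t)\<bar> * \<bar>Im d\<bar> \<le> \<bar>fy (\<gamma> t)\<bar> * 1"
      by (intro mult_left_mono; simp)+
    then show ?thesis using grad[of "\<gamma> t"] \<gamma>U[OF that] U
        abs_triangle_ineq[of "fx (\<gamma> t) * Re d" "fy (\<gamma> t) * Im d"] by (force simp: abs_mult)
  qed
  have upper: "f (\<gamma> t) \<le> G * t" if t: "0 < t" "t < e" for t
  proof (rule tendsto_lowerbound)
    have "filterlim \<gamma> (at p within D) (at_right 0)"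
      unfolding filterlim_at
    proof
      have "(\<gamma> \<longlongrightarrow> p + of_real 0 * d) (at_right 0)" unfolding \<gamma>_def by (intro tendsto_intros)
      then show "(\<gamma> \<longlongrightarrow> p) (at_right 0)" by simp
      have "\<forall>\<^sub>F s in at_right 0. 0 < s \<and> s < e"
        using e(1) by (simp add: eventually_at_right_less eventually_conj_iff eventually_at_right_field) (auto intro!: exI[of _ e])
      then show "\<forall>\<^sub>F s in at_right 0. \<gamma> s \<in> D \<and> \<gamma> s \<noteq> p"
        by eventually_elim (use \<gamma>U U sector(1) in blast)
    qed
    then have "((\<lambda>s. f (\<gamma> s)) \<longlongrightarrow> 0) (at_right 0)" using lim filterlim_compose by blast
    then show "((\<lambda>s. G * (t - s) + f (\<gamma> s)) \<longlongrightarrow> G * t) (at_right 0)"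
      by (auto intro!: tendsto_eq_intros)
    have "\<forall>\<^sub>F s in at_right 0. 0 < s \<and> s < t"
      using t by (simp add: eventually_at_right_less eventually_conj_iff eventually_at_right_field) (auto intro!: exI[of _ t])
    then show "\<forall>\<^sub>F s in at_right 0. f (\<gamma> t) \<le> G * (t - s) + f (\<gamma> s)"
    proof eventually_elim
      case (elim s)
      have "\<exists>x>s. x < t \<and> f (\<gamma> t) - f (\<gamma> s) = (t - s) * (fx (\<gamma> x) * Re d + fy (\<gamma> x) * Im d)"
        using elim t by (intro MVT2 deriv) auto
      then obtain x where x: "s < x" "x < t" "f (\<gamma> t) - f (\<gamma> s) = (t - s) * (fx (\<gamma> x) * Re d + fy (\<gamma> x) * Im d)"
        by blast
      have "(t - s) * (fx (\<gamma> x) * Re d + fy (\<gamma> x) * Im d) \<le> (t - s) * G"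
        using slope[of x] x elim t by (intro mult_left_mono) auto
      then show ?case using x by (simp add: algebra_simps)
    qed
  qed auto
  have "((\<lambda>t. G * t powr (2 * q)) \<longlongrightarrow> G * 0 powr (2 * q)) (at_right 0)"
    using q by (intro tendsto_intros tendsto_powr' tendsto_ident_at) (auto simp: eventually_at_filter)
  then have "\<forall>\<^sub>F t in at_right 0. G * t powr (2 * q) < c"
    using c by (intro order_tendstoD(2)) auto
  moreover have "\<forall>\<^sub>F s in at_right 0. 0 < s \<and> s < e"
    using e(1) by (simp add: eventually_at_right_less eventually_conj_iff eventually_at_right_field) (auto intro!: exI[of _ e])
  ultimately have "\<forall>\<^sub>F t in at_right (0::real). False"
  proof eventually_elim
    case (elim t)
    have "c * (t * t powr (- 2 * q)) \<le> G * t" using lower[of t] upper[of t] elim by linarith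
    then have "c * t powr (- 2 * q) \<le> G" using elim by (simp add: mult.left_commute)
    then have "c * t powr (- 2 * q) * t powr (2 * q) \<le> G * t powr (2 * q)" by (intro mult_right_mono) auto
    then have "c \<le> G * t powr (2 * q)" using elim by (simp add: mult.assoc flip: powr_add)
    then show False using elim by simp
  qed
  then show False by simp
qed

section \<open>Wirtinger inequalities on an interval and on the circle\<close>

text \<open>
  For every $k<\pi/(b-a)$ the function $T(t)=\tan(k(t-\frac{a+b}2))$ is smooth on the whole closed interval, and
  $f'^2-k^2f^2=(f'+kTf)^2-(kTf^2)'$. Then $k$ tends to $\pi/(b-a)$.
\<close>

lemma wirtinger_inequality:
  fixes f f' :: "real \<Rightarrow> real"
  assumes "a < b" and f: "\<And>t. t \<in> {a..b} \<Longrightarrow> (f has_real_derivative f' t) (at t)"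
    and f': "continuous_on {a..b} f'" and zero: "f a = 0" "f b = 0"
  shows "integral {a..b} (\<lambda>t. (f t)\<^sup>2) \<le> ((b - a) / pi)\<^sup>2 * integral {a..b} (\<lambda>t. (f' t)\<^sup>2)"
proof -
  have fc: "continuous_on {a..b} f"
    using f by (meson DERIV_isCont continuous_at_imp_continuous_on)
  define X where "X = integral {a..b} (\<lambda>t. (f t)\<^sup>2)"
  define Y where "Y = integral {a..b} (\<lambda>t. (f' t)\<^sup>2)"
  have *: "c\<^sup>2 * ((pi / (b - a))\<^sup>2 * X) \<le> Y" if c: "0 < c" "c < 1" for c
  proof -
    define k where "k = pi / (b - a) * c"
    have k: "k > 0" using c \<open>a < b\<close> by (simp add: k_def)
    define m where "m = (a + b) / 2"
    have cos: "cos (k * (t - m)) > 0" if "t \<in> {a..b}" for t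
    proof -
      have "\<bar>t - m\<bar> \<le> (b - a) / 2" using that by (auto simp: m_def abs_le_iff field_simps)
      then have "k * \<bar>t - m\<bar> \<le> k * ((b - a) / 2)" using k by (intro mult_left_mono) auto
      also have "\<dots> = pi / 2 * c" using \<open>a < b\<close> by (simp add: k_def)
      also have "\<dots> < pi / 2" using c by simp
      finally have "\<bar>k * (t - m)\<bar> < pi / 2" using k by (simp add: abs_mult)
      then show ?thesis by (intro cos_gt_zero_pi) auto
    qed
    define T where "T t = tan (k * (t - m))" for t
    have T: "(T has_real_derivative k * (1 + (T t)\<^sup>2)) (at t)" if "t \<in> {a..b}" for t
      unfolding T_def using cos[OF that]
      by (auto intro!: derivative_eq_intros simp: tan_sec power_inverse)
    have Tc: "continuous_on {a..b} T" using T by (meson DERIV_isCont continuous_at_imp_continuous_on)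
    define G where "G t = k * T t * (f t)\<^sup>2" for t
    define G' where "G' t = k\<^sup>2 * (1 + (T t)\<^sup>2) * (f t)\<^sup>2 + 2 * k * T t * f t * f' t" for t
    have "(G has_real_derivative G' t) (at t)" if "t \<in> {a..b}" for t
      unfolding G_def G'_def using T[OF that] f[OF that]
      by (auto intro!: derivative_eq_intros simp: power2_eq_square algebra_simps)
    then have "(G' has_integral G b - G a) {a..b}"
      using \<open>a < b\<close> by (intro fundamental_theorem_of_calculus)
        (auto simp: has_real_derivative_iff_has_vector_derivative[symmetric] intro: DERIV_subset has_field_derivative_at_within)
    then have G': "(G' has_integral 0) {a..b}" using zero by (simp add: G_def)
    have "((\<lambda>t. (f' t)\<^sup>2 - k\<^sup>2 * (f t)\<^sup>2 + G' t) has_integral (Y - k\<^sup>2 * X + 0)) {a..b}"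
      unfolding X_def Y_def
      by (intro has_integral_add has_integral_diff has_integral_mult_right G' integrable_integral
           integrable_continuous_interval continuous_intros fc f')
    moreover have "(f' t)\<^sup>2 - k\<^sup>2 * (f t)\<^sup>2 + G' t = (f' t + k * T t * f t)\<^sup>2" for t
      unfolding G'_def by algebra
    ultimately have "((\<lambda>t. (f' t + k * T t * f t)\<^sup>2) has_integral (Y - k\<^sup>2 * X + 0)) {a..b}"
      by (simp only:)
    then have "Y - k\<^sup>2 * X + 0 \<ge> 0"
      by (rule has_integral_nonneg) (rule zero_le_power2)
    moreover have "k\<^sup>2 * X = c\<^sup>2 * ((pi / (b - a))\<^sup>2 * X)"
      unfolding k_def power_mult_distrib by (simp only: mult_ac)
    ultimately show ?thesis by linarith
  qed
  have "(pi / (b - a))\<^sup>2 * X \<le> Y"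
  proof (rule field_le_mult_one_interval)
    fix z :: real assume "0 < z" "z < 1"
    then have "0 < sqrt z" "sqrt z < 1" "(sqrt z)\<^sup>2 = z" by auto
    then show "z * ((pi / (b - a))\<^sup>2 * X) \<le> Y" using *[of "sqrt z"] by metis
  qed
  then have "((b - a) / pi)\<^sup>2 * ((pi / (b - a))\<^sup>2 * X) \<le> ((b - a) / pi)\<^sup>2 * Y"
    by (intro mult_left_mono) auto
  moreover have "((b - a) / pi)\<^sup>2 * (pi / (b - a))\<^sup>2 = 1"
    using \<open>a < b\<close> by (simp add: power_mult_distrib[symmetric])
  ultimately show ?thesis by (simp add: X_def Y_def mult.assoc[symmetric])
qed

lemma integral_period:
  fixes f :: "real \<Rightarrow> real"
  assumes f: "continuous_on UNIV f" and per: "\<And>t. f (t + 2 * pi) = f t" and a: "0 \<le> a" "a \<le> 2 * pi"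
  shows "integral {a..a + 2 * pi} f = integral {0..2 * pi} f"
proof -
  have i: "f integrable_on {x..y}" for x y
    using f by (intro integrable_continuous_interval) (auto intro: continuous_on_subset)
  have "integral {a..a + 2 * pi} f = integral {a..2 * pi} f + integral {2 * pi..a + 2 * pi} f"
    by (rule Henstock_Kurzweil_Integration.integral_combine[symmetric]) (use a i in auto)
  also have "integral {2 * pi..a + 2 * pi} f = integral {0..a} f"
    using integral_shift_Icc_real[of 0 a f "2 * pi"] per by (simp add: o_def add.commute)
  also have "integral {a..2 * pi} f + integral {0..a} f = integral {0..2 * pi} f"
    using a i Henstock_Kurzweil_Integration.integral_combine[of 0 a "2 * pi" f] by simp
  finally show ?thesis .
qed

text \<open>
  Both cases reduce to the inequality with boundary values $0$. A zero cuts the circle into one interval of length $2\pi$.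
  Without a zero, the intermediate value theorem provides two antipodal points with a common
  value \<open>m\<close>, and \<open>f - m\<close> vanishes at the ends of two intervals of length $\pi$; the sharp constant $1$ results.
\<close>

lemma wirtinger_periodic:
  fixes f f' :: "real \<Rightarrow> real"
  assumes f: "\<And>t. (f has_real_derivative f' t) (at t)" and f': "continuous_on UNIV f'"
    and per: "\<And>t. f (t + 2 * pi) = f t" "\<And>t. f' (t + 2 * pi) = f' t"
  shows wirtinger_periodic_zero: "\<theta> \<in> {0..2 * pi} \<Longrightarrow> f \<theta> = 0 \<Longrightarrow>
        integral {0..2 * pi} (\<lambda>t. (f t)\<^sup>2) \<le> 4 * integral {0..2 * pi} (\<lambda>t. (f' t)\<^sup>2)"
    and wirtinger_periodic_mean:
        "\<exists>m. integral {0..2 * pi} (\<lambda>t. (f t - m)\<^sup>2) \<le> integral {0..2 * pi} (\<lambda>t. (f' t)\<^sup>2)"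
proof -
  have fc: "continuous_on UNIV f" using f by (meson DERIV_isCont continuous_at_imp_continuous_on)
  have f's: "continuous_on S f'" for S using f' by (auto intro: continuous_on_subset)
  { assume \<theta>: "\<theta> \<in> {0..2 * pi}" "f \<theta> = 0"
    have "integral {\<theta>..\<theta> + 2 * pi} (\<lambda>t. (f t)\<^sup>2) \<le> ((\<theta> + 2 * pi - \<theta>) / pi)\<^sup>2 * integral {\<theta>..\<theta> + 2 * pi} (\<lambda>t. (f' t)\<^sup>2)"
      by (rule wirtinger_inequality[OF _ f f's]) (use per \<theta> in auto)
    also have "integral {\<theta>..\<theta> + 2 * pi} (\<lambda>t. (f t)\<^sup>2) = integral {0..2 * pi} (\<lambda>t. (f t)\<^sup>2)"
      by (rule integral_period) (use per \<theta> fc in \<open>auto intro!: continuous_intros\<close>)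
    also have "integral {\<theta>..\<theta> + 2 * pi} (\<lambda>t. (f' t)\<^sup>2) = integral {0..2 * pi} (\<lambda>t. (f' t)\<^sup>2)"
      by (rule integral_period) (use per \<theta> f' in \<open>auto intro!: continuous_intros\<close>)
    finally show "integral {0..2 * pi} (\<lambda>t. (f t)\<^sup>2) \<le> 4 * integral {0..2 * pi} (\<lambda>t. (f' t)\<^sup>2)"
      by simp }
  define g where "g t = f t - f (t + pi)" for t
  have gc: "continuous_on UNIV g" unfolding g_def
    by (intro continuous_intros continuous_on_compose2[OF fc]) auto
  have gpi: "g pi = - g 0" using per(1)[of 0] by (simp add: g_def)
  obtain \<theta> where \<theta>: "0 \<le> \<theta>" "\<theta> \<le> pi" "g \<theta> = 0"
  proof (cases "g 0 \<le> 0")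
    case True
    then show ?thesis using IVT'[of g 0 0 pi] gpi gc that by (auto intro: continuous_on_subset)
  next
    case False
    then show ?thesis using IVT2'[of g pi 0 0] gpi gc that by (auto intro: continuous_on_subset)
  qed
  define m where "m = f \<theta>"
  have m: "f \<theta> - m = 0" "f (\<theta> + pi) - m = 0" "f (\<theta> + pi + pi) - m = 0"
  proof -
    show "f \<theta> - m = 0" "f (\<theta> + pi) - m = 0" using \<theta>(3) by (simp_all add: m_def g_def)
    have "\<theta> + pi + pi = \<theta> + 2 * pi" by simp
    then show "f (\<theta> + pi + pi) - m = 0" using per(1)[of \<theta>] by (simp only: m_def)
  qed
  have fm: "((\<lambda>t. f t - m) has_real_derivative f' t) (at t)" for t
    using f[of t] by (auto intro!: derivative_eq_intros)
  have eq: "\<theta> + pi + pi = \<theta> + 2 * pi" by simp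
  have i1: "(\<lambda>t. (f t - m)\<^sup>2) integrable_on {x..y}" for x y
    by (intro integrable_continuous_interval continuous_intros continuous_on_subset[OF fc]) auto
  have i2: "(\<lambda>t. (f' t)\<^sup>2) integrable_on {x..y}" for x y
    by (intro integrable_continuous_interval continuous_intros f's)
  have "integral {0..2 * pi} (\<lambda>t. (f t - m)\<^sup>2) = integral {\<theta>..\<theta> + 2 * pi} (\<lambda>t. (f t - m)\<^sup>2)"
    by (rule integral_period[symmetric]) (use per \<theta> fc in \<open>auto intro!: continuous_intros\<close>)
  also have "\<dots> = integral {\<theta>..\<theta> + pi} (\<lambda>t. (f t - m)\<^sup>2) + integral {\<theta> + pi..\<theta> + pi + pi} (\<lambda>t. (f t - m)\<^sup>2)"
    using Henstock_Kurzweil_Integration.integral_combine[of \<theta> "\<theta> + pi" "\<theta> + pi + pi" "\<lambda>t. (f t - m)\<^sup>2"] i1 unfolding eq by simp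
  also have "\<dots> \<le> integral {\<theta>..\<theta> + pi} (\<lambda>t. (f' t)\<^sup>2) + integral {\<theta> + pi..\<theta> + pi + pi} (\<lambda>t. (f' t)\<^sup>2)"
    using wirtinger_inequality[of \<theta> "\<theta> + pi" "\<lambda>t. f t - m" f', OF _ fm f's]
      wirtinger_inequality[of "\<theta> + pi" "\<theta> + pi + pi" "\<lambda>t. f t - m" f', OF _ fm f's] m
    by (intro add_mono) simp_all
  also have "\<dots> = integral {\<theta>..\<theta> + 2 * pi} (\<lambda>t. (f' t)\<^sup>2)"
    using Henstock_Kurzweil_Integration.integral_combine[of \<theta> "\<theta> + pi" "\<theta> + pi + pi" "\<lambda>t. (f' t)\<^sup>2"] i2 unfolding eq by simp
  also have "\<dots> = integral {0..2 * pi} (\<lambda>t. (f' t)\<^sup>2)"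
    by (rule integral_period) (use per \<theta> f' in \<open>auto intro!: continuous_intros\<close>)
  finally show "\<exists>m. integral {0..2 * pi} (\<lambda>t. (f t - m)\<^sup>2) \<le> integral {0..2 * pi} (\<lambda>t. (f' t)\<^sup>2)" by blast
qed

lemma abs_le_of_zero_and_energy:
  fixes f f' :: "real \<Rightarrow> real"
  assumes f: "\<And>t. (f has_real_derivative f' t) (at t)" and f': "continuous_on UNIV f'"
    and zero: "\<theta> \<in> {0..2 * pi}" "f \<theta> = 0" and t: "t > 0" "integral {0..2 * pi} (\<lambda>t. (f' t)\<^sup>2) \<le> t\<^sup>2"
    and x: "x \<in> {0..2 * pi}"
  shows "\<bar>f x\<bar> \<le> 4 * t"
proof -
  define l u where "l = min \<theta> x" and "u = max \<theta> x"
  have lu: "0 \<le> l" "l \<le> u" "u \<le> 2 * pi" using zero x by (auto simp: l_def u_def)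
  have f's: "continuous_on S f'" for S using f' by (auto intro: continuous_on_subset)
  have "(f' has_integral f u - f l) {l..u}"
    using lu f by (intro fundamental_theorem_of_calculus)
      (auto simp: has_real_derivative_iff_has_vector_derivative[symmetric] intro: has_field_derivative_at_within)
  then have "\<bar>f u - f l\<bar> = \<bar>integral {l..u} f'\<bar>" by (simp add: integral_unique)
  also have "\<dots> \<le> integral {l..u} (\<lambda>s. (t\<^sup>2 + (f' s)\<^sup>2) / (2 * t))"
    unfolding real_norm_def[symmetric]
  proof (rule integral_norm_bound_integral)
    fix s
    have "0 \<le> (t - \<bar>f' s\<bar>)\<^sup>2" by simp
    then have "2 * t * \<bar>f' s\<bar> \<le> t\<^sup>2 + (f' s)\<^sup>2" by (simp add: power2_diff)
    then show "norm (f' s) \<le> (t\<^sup>2 + (f' s)\<^sup>2) / (2 * t)" using t by (simp add: field_simps)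
  qed (intro integrable_continuous_interval continuous_intros f's; use t in simp)+
  also have "\<dots> \<le> integral {0..2 * pi} (\<lambda>s. (t\<^sup>2 + (f' s)\<^sup>2) / (2 * t))"
    using lu t by (intro integral_subset_le) (auto intro!: integrable_continuous_interval continuous_intros f's)
  also have "\<dots> = (2 * pi * t\<^sup>2 + integral {0..2 * pi} (\<lambda>s. (f' s)\<^sup>2)) / (2 * t)"
    by (simp add: integral_divide integral_add integrable_continuous_interval f's continuous_intros)
  also have "\<dots> \<le> (2 * pi * t\<^sup>2 + t\<^sup>2) / (2 * t)" using t by (intro divide_right_mono add_left_mono) auto
  also have "\<dots> = (pi + 1/2) * t" using t by (simp add: power2_eq_square field_simps)
  also have "\<dots> \<le> 4 * t" using t pi_less_4 pi_approx by (intro mult_right_mono) auto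
  finally have "\<bar>f u - f l\<bar> \<le> 4 * t" .
  then show ?thesis using zero by (auto simp: l_def u_def min_def max_def split: if_splits)
qed

section \<open>Calculus on a family of ellipses\<close>

text \<open>
  Log-polar coordinates after the Prandtl-Glauert transformation $(x,y)\mapsto(x,\beta y)$: the
  ellipse with parameter \<open>s\<close> is $x^2+\beta^2y^2=e^{2s}$.
\<close>

definition ell :: "real \<Rightarrow> real \<Rightarrow> real \<Rightarrow> complex" where
  "ell \<beta> s \<theta> = Complex (exp s * cos \<theta>) (exp s * sin \<theta> / \<beta>)"

lemma ell_simps [simp]: "Re (ell \<beta> s \<theta>) = exp s * cos \<theta>" "Im (ell \<beta> s \<theta>) = exp s * sin \<theta> / \<beta>"
  by (simp_all add: ell_def)

lemma ell_periodic [simp]: "ell \<beta> s (\<theta> + 2 * pi) = ell \<beta> s \<theta>"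
  by (simp add: ell_def)

lemma ell_derivs:
  assumes "\<beta> \<noteq> 0"
  shows "((\<lambda>s. ell \<beta> s \<theta>) has_vector_derivative ell \<beta> s \<theta>) (at s)"
  "((\<lambda>\<theta>. ell \<beta> s \<theta>) has_vector_derivative Complex (- exp s * sin \<theta>) (exp s * cos \<theta> / \<beta>)) (at \<theta>)"
proof -
  have e: "ell \<beta> s \<theta> = of_real (exp s * cos \<theta>) + \<i> * of_real (exp s * sin \<theta> / \<beta>)" for s \<theta>
    by (simp add: complex_eq_iff)
  have 1: "((\<lambda>s. of_real (f s) + \<i> * of_real (g s)) has_vector_derivative Complex f' g') (at x)"
    if "(f has_real_derivative f') (at x)" "(g has_real_derivative g') (at x)" for f g f' g' x
  proof -
    have "((\<lambda>s. of_real (f s) + \<i> * of_real (g s)) has_vector_derivative of_real f' + \<i> * of_real g') (at x)"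
      using that by (auto intro!: derivative_intros has_vector_derivative_of_real
        simp: has_real_derivative_iff_has_vector_derivative)
    then show ?thesis by (simp add: complex_eq_iff[of "Complex f' g'"] Complex_eq)
  qed
  show "((\<lambda>s. ell \<beta> s \<theta>) has_vector_derivative ell \<beta> s \<theta>) (at s)"
    unfolding e[abs_def] ell_def[of \<beta> s \<theta>, symmetric]
    using assms by (subst e[symmetric], subst ell_def, intro 1) (auto intro!: derivative_eq_intros)
  show "((\<lambda>\<theta>. ell \<beta> s \<theta>) has_vector_derivative Complex (- exp s * sin \<theta>) (exp s * cos \<theta> / \<beta>)) (at \<theta>)"
    unfolding e[abs_def] using assms by (intro 1) (auto intro!: derivative_eq_intros)
qed

lemma leibniz_circle:
  fixes g g' :: "real \<Rightarrow> real \<Rightarrow> real"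
  assumes "\<And>s \<theta>. s > s0 \<Longrightarrow> ((\<lambda>s. g s \<theta>) has_real_derivative g' s \<theta>) (at s)"
    and "continuous_on ({s0<..} \<times> UNIV) (\<lambda>(s, \<theta>). g' s \<theta>)"
    and "\<And>s. s > s0 \<Longrightarrow> continuous_on UNIV (g s)" and "s > s0"
  shows "((\<lambda>s. integral {0..2 * pi} (g s)) has_real_derivative integral {0..2 * pi} (g' s)) (at s)"
proof -
  have "((\<lambda>s. integral (cbox 0 (2 * pi)) (g s)) has_real_derivative integral (cbox 0 (2 * pi)) (g' s)) (at s within {s0<..})"
  proof (rule leibniz_rule_field_derivative)
    fix s assume "s \<in> {s0<..}"
    then show "g s integrable_on cbox 0 (2 * pi)"
      using assms(3)[of s] by (auto intro: integrable_continuous_interval continuous_on_subset)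
  qed (use assms in \<open>auto intro: has_field_derivative_at_within continuous_on_subset\<close>)
  then show ?thesis using \<open>s > s0\<close> at_within_open[of s "{s0<..}"] by simp
qed

locale ellipse_field =
  fixes \<Omega> :: "complex set" and \<beta> s0 :: real
  assumes \<beta>: "\<beta> > 0" and ell_in: "\<And>s \<theta>. s > s0 \<Longrightarrow> ell \<beta> s \<theta> \<in> \<Omega>"
begin

lemma ell_continuous_on: "continuous_on S (\<lambda>x. ell \<beta> (fst x) (snd x))"
proof -
  have "(\<lambda>x. ell \<beta> (fst x) (snd x)) = (\<lambda>x. of_real (exp (fst x) * cos (snd x)) + \<i> * of_real (exp (fst x) * sin (snd x) / \<beta>))"
    by (auto simp: complex_eq_iff)
  moreover have "continuous_on S \<dots>" using \<beta> by (auto intro!: continuous_intros)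
  ultimately show ?thesis by (simp only:)
qed

lemma continuous_on_ellipses: "continuous_on \<Omega> h \<Longrightarrow> continuous_on ({s0<..} \<times> UNIV) (\<lambda>x. h (ell \<beta> (fst x) (snd x)))"
  by (rule continuous_on_compose2[of \<Omega> h]) (auto intro: ell_in ell_continuous_on)

lemma continuous_on_ellipse: "continuous_on \<Omega> h \<Longrightarrow> s > s0 \<Longrightarrow> continuous_on T (\<lambda>\<theta>. h (ell \<beta> s \<theta>))"
  using continuous_on_compose2[OF continuous_on_ellipses, of h T "\<lambda>\<theta>. (s, \<theta>)"] by (auto simp: continuous_on_Pair)

lemma deriv_s: "C1_on \<Omega> f fx fy \<Longrightarrow> s > s0 \<Longrightarrow>
   ((\<lambda>s. f (ell \<beta> s \<theta>)) has_real_derivative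
     (exp s * (fx (ell \<beta> s \<theta>) * cos \<theta> + fy (ell \<beta> s \<theta>) / \<beta> * sin \<theta>))) (at s)"
  using has_gradient_along[OF C1_onD(1)[of \<Omega> f fx fy "ell \<beta> s \<theta>"] ell_derivs(1)] ell_in[of s \<theta>] \<beta>
  by (simp add: algebra_simps)

lemma deriv_\<theta>: "C1_on \<Omega> f fx fy \<Longrightarrow> s > s0 \<Longrightarrow>
   ((\<lambda>\<theta>. f (ell \<beta> s \<theta>)) has_real_derivative
     (exp s * (- fx (ell \<beta> s \<theta>) * sin \<theta> + fy (ell \<beta> s \<theta>) / \<beta> * cos \<theta>))) (at \<theta>)"
  using has_gradient_along[OF C1_onD(1)[of \<Omega> f fx fy "ell \<beta> s \<theta>"] ell_derivs(2)] ell_in[of s \<theta>] \<beta>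
  by (simp add: algebra_simps)

text \<open>
  Green's theorem for the 1-form $f(a\,dx+b\,dy)$, in differentiated form: the derivative in $s$ of its integral over the ellipse.
  Because $a\,dx+b\,dy$ is closed, the $s$-derivative of its $\theta$-component is the $\theta$-derivative of its
  $s$-component, which is integrated by parts over the period.
\<close>

lemma green_identity:
  assumes f: "C1_on \<Omega> f fx fy" and a: "C1_on \<Omega> a ax ay" and b: "C1_on \<Omega> b bx by'"
    and closed: "\<And>z. z \<in> \<Omega> \<Longrightarrow> ay z = bx z" and s: "s > s0"
  shows "((\<lambda>s. integral {0..2 * pi} (\<lambda>\<theta>. f (ell \<beta> s \<theta>) * (exp s * (- a (ell \<beta> s \<theta>) * sin \<theta> + b (ell \<beta> s \<theta>) / \<beta> * cos \<theta>))))
     has_real_derivative integral {0..2 * pi} (\<lambda>\<theta>. exp (2 * s) * (fx (ell \<beta> s \<theta>) * (b (ell \<beta> s \<theta>) / \<beta>) - fy (ell \<beta> s \<theta>) / \<beta> * a (ell \<beta> s \<theta>)))) (at s)"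
proof -
  define E where "E = ell \<beta>"
  note cf = C1_onD(2-4)[OF f] C1_onD(2-4)[OF a] C1_onD(2-4)[OF b]
  note [continuous_intros] = cf[THEN continuous_on_ellipses]
  define Q where "Q s \<theta> = exp s * (- a (E s \<theta>) * sin \<theta> + b (E s \<theta>) / \<beta> * cos \<theta>)" for s \<theta>
  define P where "P s \<theta> = exp s * (a (E s \<theta>) * cos \<theta> + b (E s \<theta>) / \<beta> * sin \<theta>)" for s \<theta>
  define fs where "fs s \<theta> = exp s * (fx (E s \<theta>) * cos \<theta> + fy (E s \<theta>) / \<beta> * sin \<theta>)" for s \<theta>
  define ft where "ft s \<theta> = exp s * (- fx (E s \<theta>) * sin \<theta> + fy (E s \<theta>) / \<beta> * cos \<theta>)" for s \<theta>
  define Qs where "Qs s \<theta> = Q s \<theta> + exp s * (- (exp s * (ax (E s \<theta>) * cos \<theta> + ay (E s \<theta>) / \<beta> * sin \<theta>)) * sin \<theta>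
      + (exp s * (bx (E s \<theta>) * cos \<theta> + by' (E s \<theta>) / \<beta> * sin \<theta>)) / \<beta> * cos \<theta>)" for s \<theta>
  define G where "G s \<theta> = f (E s \<theta>) * Q s \<theta>" for s \<theta>
  define G' where "G' s \<theta> = fs s \<theta> * Q s \<theta> + f (E s \<theta>) * Qs s \<theta>" for s \<theta>
  define J where "J s \<theta> = exp (2 * s) * (fx (E s \<theta>) * (b (E s \<theta>) / \<beta>) - fy (E s \<theta>) / \<beta> * a (E s \<theta>))" for s \<theta>
  have Q: "((\<lambda>s. Q s \<theta>) has_real_derivative Qs s \<theta>) (at s)" if "s > s0" for s \<theta>
    unfolding Q_def Qs_def E_def using deriv_s[OF a that, of \<theta>] deriv_s[OF b that, of \<theta>] \<beta>
    by (auto intro!: derivative_eq_intros simp: field_simps)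
  have G: "((\<lambda>s. G s \<theta>) has_real_derivative G' s \<theta>) (at s)" if "s > s0" for s \<theta>
    unfolding G_def G'_def fs_def using Q[OF that] deriv_s[OF f that, of \<theta>] unfolding E_def
    by (auto intro!: derivative_eq_intros)
  have cG': "continuous_on ({s0<..} \<times> UNIV) (\<lambda>(s, \<theta>). G' s \<theta>)"
    unfolding G'_def fs_def Qs_def Q_def E_def split_beta using \<beta>
    by (auto intro!: continuous_intros)
  have cG: "continuous_on UNIV (G s)" if "s > s0" for s
    unfolding G_def Q_def E_def using \<beta> that by (auto intro!: continuous_intros continuous_on_ellipse cf)
  have "((\<lambda>s. integral {0..2 * pi} (G s)) has_real_derivative integral {0..2 * pi} (G' s)) (at s)"
    by (rule leibniz_circle[OF G cG' cG s])
  moreover have "integral {0..2 * pi} (G' s) = integral {0..2 * pi} (J s)"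
  proof -
    have P: "((\<lambda>\<theta>. P s \<theta>) has_real_derivative Qs s \<theta>) (at \<theta>)" for \<theta>
    proof -
      have "((\<lambda>\<theta>. P s \<theta>) has_real_derivative exp s * ((exp s * (- ax (E s \<theta>) * sin \<theta> + ay (E s \<theta>) / \<beta> * cos \<theta>)) * cos \<theta>
          - a (E s \<theta>) * sin \<theta> + (exp s * (- bx (E s \<theta>) * sin \<theta> + by' (E s \<theta>) / \<beta> * cos \<theta>)) / \<beta> * sin \<theta> + b (E s \<theta>) / \<beta> * cos \<theta>)) (at \<theta>)"
        unfolding P_def E_def using deriv_\<theta>[OF a s, of \<theta>] deriv_\<theta>[OF b s, of \<theta>] \<beta>
        by (auto intro!: derivative_eq_intros simp: field_simps)
      moreover have "exp s * ((exp s * (- ax (E s \<theta>) * sin \<theta> + ay (E s \<theta>) / \<beta> * cos \<theta>)) * cos \<theta>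
          - a (E s \<theta>) * sin \<theta> + (exp s * (- bx (E s \<theta>) * sin \<theta> + by' (E s \<theta>) / \<beta> * cos \<theta>)) / \<beta> * sin \<theta> + b (E s \<theta>) / \<beta> * cos \<theta>)
          = Qs s \<theta>"
      proof -
        have "ay (E s \<theta>) = bx (E s \<theta>)" using closed ell_in s by (simp add: E_def)
        then show ?thesis unfolding Qs_def Q_def divide_inverse by (simp add: algebra_simps)
      qed
      ultimately show ?thesis by simp
    qed
    have fP: "((\<lambda>\<theta>. f (E s \<theta>) * P s \<theta>) has_real_derivative (ft s \<theta> * P s \<theta> + f (E s \<theta>) * Qs s \<theta>)) (at \<theta>)" for \<theta>
      using P deriv_\<theta>[OF f s, of \<theta>] unfolding E_def ft_def by (auto intro!: derivative_eq_intros)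
    then have "((\<lambda>\<theta>. ft s \<theta> * P s \<theta> + f (E s \<theta>) * Qs s \<theta>) has_integral f (E s (2 * pi)) * P s (2 * pi) - f (E s 0) * P s 0) {0..2 * pi}"
      by (intro fundamental_theorem_of_calculus)
       (auto simp: has_real_derivative_iff_has_vector_derivative[symmetric] intro: has_field_derivative_at_within)
    moreover have "E s (2 * pi) = E s 0" using ell_periodic[of \<beta> s 0] by (simp add: E_def)
    ultimately have 0: "((\<lambda>\<theta>. ft s \<theta> * P s \<theta> + f (E s \<theta>) * Qs s \<theta>) has_integral 0) {0..2 * pi}"
      by (simp add: P_def)
    have "((G' s) has_integral integral {0..2 * pi} (G' s)) {0..2 * pi}"
    proof (intro integrable_integral integrable_continuous_interval)
      show "continuous_on {0..2 * pi} (G' s)"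
        unfolding G'_def fs_def Qs_def Q_def E_def using \<beta> s by (auto intro!: continuous_intros continuous_on_ellipse cf)
    qed
    from has_integral_diff[OF this 0]
    have "((\<lambda>\<theta>. fs s \<theta> * Q s \<theta> - ft s \<theta> * P s \<theta>) has_integral integral {0..2 * pi} (G' s)) {0..2 * pi}"
      by (simp add: G'_def)
    moreover have "fs s \<theta> * Q s \<theta> - ft s \<theta> * P s \<theta> = J s \<theta>" for \<theta>
    proof -
      have sc: "sin \<theta> ^ 2 + cos \<theta> ^ 2 = 1" by simp
      have "fs s \<theta> * Q s \<theta> - ft s \<theta> * P s \<theta> = (exp s)\<^sup>2 * (fx (E s \<theta>) * (b (E s \<theta>) / \<beta>) - fy (E s \<theta>) / \<beta> * a (E s \<theta>))"
        unfolding fs_def ft_def Q_def P_def using sc by algebra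
      then show ?thesis by (simp add: J_def exp_double)
    qed
    ultimately show ?thesis by (simp add: integral_unique)
  qed
  ultimately show ?thesis unfolding G_def[abs_def] Q_def J_def[abs_def] E_def by simp
qed

end

abbreviation circ :: "(real \<Rightarrow> real) \<Rightarrow> real" where "circ g \<equiv> integral {0..2 * pi} g"

lemma circ_le:
  assumes "continuous_on {0..2 * pi} g" "continuous_on {0..2 * pi} h" "\<And>t. g t \<le> h t"
  shows "circ g \<le> circ h"
  using assms by (intro integral_le integrable_continuous_interval) auto

lemma circ_linear:
  assumes "continuous_on {0..2 * pi} g" "continuous_on {0..2 * pi} h"
  shows "circ (\<lambda>t. c * g t + d * h t) = c * circ g + d * circ h"
proof -
  have "((\<lambda>t. c * g t + d * h t) has_integral (c * circ g + d * circ h)) {0..2 * pi}"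
    by (intro has_integral_add has_integral_mult_right integrable_integral integrable_continuous_interval assms)
  then show ?thesis by (rule integral_unique)
qed

section \<open>Asymptotically conformal pairs\<close>

lemma abs_circ_mult_le:
  assumes u: "continuous_on {0..2 * pi} u" and q: "continuous_on {0..2 * pi} q" and "N > 0"
  shows "\<bar>circ (\<lambda>t. u t * q t)\<bar> \<le> (1 / (2 * N)) * circ (\<lambda>t. (u t)\<^sup>2) + (N / 2) * circ (\<lambda>t. (q t)\<^sup>2)"
proof -
  have "\<bar>u t * q t\<bar> \<le> (1 / (2 * N)) * (u t)\<^sup>2 + (N / 2) * (q t)\<^sup>2" for t
  proof -
    have "0 \<le> (\<bar>u t\<bar> - N * \<bar>q t\<bar>)\<^sup>2" by simp
    then have "2 * N * \<bar>u t * q t\<bar> \<le> (u t)\<^sup>2 + N\<^sup>2 * (q t)\<^sup>2"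
      by (simp add: power2_diff power_mult_distrib abs_mult mult_ac)
    then show ?thesis using \<open>N > 0\<close> by (simp add: field_simps power2_eq_square)
  qed
  then have "norm (circ (\<lambda>t. u t * q t)) \<le> circ (\<lambda>t. (1 / (2 * N)) * (u t)\<^sup>2 + (N / 2) * (q t)\<^sup>2)"
    by (intro integral_norm_bound_integral integrable_continuous_interval continuous_intros u q) auto
  also have "\<dots> = (1 / (2 * N)) * circ (\<lambda>t. (u t)\<^sup>2) + (N / 2) * circ (\<lambda>t. (q t)\<^sup>2)"
    by (intro circ_linear continuous_intros u q)
  finally show ?thesis by simp
qed

text \<open>
  Here $(X,Y)$ is the gradient of a function and $(U,V)$ a 1-form. For a conformal pair $V=X$ and $U=-Y$, and all three
  expressions equal $X^2+Y^2$. The last two concern the components along a unit vector and orthogonal to it.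
\<close>

lemma near_conformal_pointwise:
  fixes X Y U V \<epsilon> c s :: real
  assumes near: "(V - X)\<^sup>2 + (U + Y)\<^sup>2 \<le> \<epsilon>\<^sup>2 * (X\<^sup>2 + Y\<^sup>2)" and "\<epsilon> > 0" and cs: "s\<^sup>2 + c\<^sup>2 = 1"
  shows "X * V - Y * U \<ge> (1 - \<epsilon>) * (X\<^sup>2 + Y\<^sup>2)"
    and "(- X * s + Y * c)\<^sup>2 + (- U * s + V * c)\<^sup>2 \<le> (1 + \<epsilon>)\<^sup>2 * (X\<^sup>2 + Y\<^sup>2)"
    and "(X * c + Y * s)\<^sup>2 + (U * c + V * s)\<^sup>2 \<le> (1 + \<epsilon>)\<^sup>2 * (X\<^sup>2 + Y\<^sup>2)"
proof -
  define D where "D = X\<^sup>2 + Y\<^sup>2"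
  define p r where "p = V - X" and "r = U + Y"
  have pr: "p\<^sup>2 + r\<^sup>2 \<le> \<epsilon>\<^sup>2 * D" using near by (simp add: p_def r_def D_def)
  have VU: "V = X + p" "U = r - Y" by (simp_all add: p_def r_def)
  have "2 * \<epsilon> * (Y * r - X * p) \<le> \<epsilon>\<^sup>2 * D + (p\<^sup>2 + r\<^sup>2)"
  proof -
    have "0 \<le> (\<epsilon> * X + p)\<^sup>2 + (\<epsilon> * Y - r)\<^sup>2" by simp
    also have "\<dots> = \<epsilon>\<^sup>2 * D + (p\<^sup>2 + r\<^sup>2) - 2 * \<epsilon> * (Y * r - X * p)" unfolding D_def by algebra
    finally show ?thesis by simp
  qed
  also have "\<dots> \<le> 2 * \<epsilon> * (\<epsilon> * D)" using pr by (simp add: power2_eq_square mult_ac)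
  finally have "Y * r - X * p \<le> \<epsilon> * D" using \<open>\<epsilon> > 0\<close> by simp
  moreover have "X * V - Y * U = D + X * p - Y * r" unfolding VU D_def by algebra
  ultimately show "X * V - Y * U \<ge> (1 - \<epsilon>) * (X\<^sup>2 + Y\<^sup>2)" unfolding D_def[symmetric] by (simp add: algebra_simps)
  \<comment> \<open>the triangle inequality for the vectors \<open>(u, w)\<close> and \<open>(0, e)\<close>\<close>
  have key: "u\<^sup>2 + (w + e)\<^sup>2 \<le> (1 + \<epsilon>)\<^sup>2 * D" if uw: "u\<^sup>2 + w\<^sup>2 = D" and e: "e\<^sup>2 \<le> \<epsilon>\<^sup>2 * D" for u w e
  proof -
    have "0 \<le> (\<epsilon> * w - e)\<^sup>2" by simp
    then have "\<epsilon> * (2 * w * e) \<le> \<epsilon>\<^sup>2 * w\<^sup>2 + e\<^sup>2" by (simp add: power2_diff power_mult_distrib mult_ac)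
    also have "\<dots> \<le> \<epsilon>\<^sup>2 * D + \<epsilon>\<^sup>2 * D"
      using e uw zero_le_power2[of u] by (intro add_mono mult_left_mono) (auto simp del: zero_le_power2)
    finally have "\<epsilon> * (2 * w * e) \<le> \<epsilon> * (2 * \<epsilon> * D)" by (simp add: power2_eq_square)
    then have "2 * w * e \<le> 2 * \<epsilon> * D" using \<open>\<epsilon> > 0\<close> by (simp only: mult_le_cancel_left_pos)
    then have "u\<^sup>2 + w\<^sup>2 + 2 * w * e + e\<^sup>2 \<le> D + 2 * \<epsilon> * D + \<epsilon>\<^sup>2 * D" using uw e by linarith
    then show ?thesis by (simp add: power2_sum algebra_simps)
  qed
  have rot: "(p * c - r * s)\<^sup>2 \<le> \<epsilon>\<^sup>2 * D" "(r * c + p * s)\<^sup>2 \<le> \<epsilon>\<^sup>2 * D"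
  proof -
    have "(p * c - r * s)\<^sup>2 + (r * c + p * s)\<^sup>2 = p\<^sup>2 + r\<^sup>2" using cs by algebra
    then show "(p * c - r * s)\<^sup>2 \<le> \<epsilon>\<^sup>2 * D" "(r * c + p * s)\<^sup>2 \<le> \<epsilon>\<^sup>2 * D"
      using pr zero_le_power2[of "p * c - r * s"] zero_le_power2[of "r * c + p * s"] by linarith+
  qed
  have "(- X * s + Y * c)\<^sup>2 + (X * c + Y * s)\<^sup>2 = D" unfolding D_def using cs by algebra
  from key[OF this rot(1)] show "(- X * s + Y * c)\<^sup>2 + (- U * s + V * c)\<^sup>2 \<le> (1 + \<epsilon>)\<^sup>2 * (X\<^sup>2 + Y\<^sup>2)"
    unfolding D_def VU by (simp add: algebra_simps)
  have "(X * c + Y * s)\<^sup>2 + (X * s - Y * c)\<^sup>2 = D" unfolding D_def using cs by algebra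
  from key[OF this rot(2)] show "(X * c + Y * s)\<^sup>2 + (U * c + V * s)\<^sup>2 \<le> (1 + \<epsilon>)\<^sup>2 * (X\<^sup>2 + Y\<^sup>2)"
    unfolding D_def VU by (simp add: algebra_simps)
qed

text \<open>
  A function \<open>f\<close> and a closed 1-form $a\,dx+b\,dy$ which, in the coordinates $(x,\beta y)$, satisfy the Cauchy-Riemann
  equations up to a relative error of $1/20$. The form may have a circulation around the body.
\<close>

locale near_conformal = ellipse_field +
  fixes f fx fy a ax ay b bx by' :: "complex \<Rightarrow> real"
  assumes f: "C1_on \<Omega> f fx fy" and a: "C1_on \<Omega> a ax ay" and b: "C1_on \<Omega> b bx by'"
    and closed: "\<And>z. z \<in> \<Omega> \<Longrightarrow> ay z = bx z"
    and near: "\<And>s \<theta>. s > s0 \<Longrightarrow>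
      (b (ell \<beta> s \<theta>) / \<beta> - fx (ell \<beta> s \<theta>))\<^sup>2 + (a (ell \<beta> s \<theta>) + fy (ell \<beta> s \<theta>) / \<beta>)\<^sup>2
       \<le> (1/20)\<^sup>2 * ((fx (ell \<beta> s \<theta>))\<^sup>2 + (fy (ell \<beta> s \<theta>) / \<beta>)\<^sup>2)"
begin

definition "F s \<theta> = f (ell \<beta> s \<theta>)"
definition "Fs s \<theta> = exp s * (fx (ell \<beta> s \<theta>) * cos \<theta> + fy (ell \<beta> s \<theta>) / \<beta> * sin \<theta>)"
definition "Ft s \<theta> = exp s * (- fx (ell \<beta> s \<theta>) * sin \<theta> + fy (ell \<beta> s \<theta>) / \<beta> * cos \<theta>)"
definition "P s \<theta> = exp s * (a (ell \<beta> s \<theta>) * cos \<theta> + b (ell \<beta> s \<theta>) / \<beta> * sin \<theta>)"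
definition "Q s \<theta> = exp s * (- a (ell \<beta> s \<theta>) * sin \<theta> + b (ell \<beta> s \<theta>) / \<beta> * cos \<theta>)"
definition "D s \<theta> = exp (2 * s) * ((fx (ell \<beta> s \<theta>))\<^sup>2 + (fy (ell \<beta> s \<theta>) / \<beta>)\<^sup>2)"
definition "J s \<theta> = exp (2 * s) * (fx (ell \<beta> s \<theta>) * (b (ell \<beta> s \<theta>) / \<beta>) - fy (ell \<beta> s \<theta>) / \<beta> * a (ell \<beta> s \<theta>))"
definition "flux s = circ (\<lambda>\<theta>. F s \<theta> * Q s \<theta>)"
definition "flux' s = circ (J s)"
definition "energy s = circ (D s)"

lemma continuous:
  assumes "s > s0"
  shows "continuous_on T (F s)" "continuous_on T (Fs s)" "continuous_on T (Ft s)"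
    "continuous_on T (P s)" "continuous_on T (Q s)" "continuous_on T (D s)" "continuous_on T (J s)"
  unfolding F_def[abs_def] Fs_def[abs_def] Ft_def[abs_def] P_def[abs_def] Q_def[abs_def] D_def[abs_def] J_def[abs_def]
  using \<beta> assms
  by (auto intro!: continuous_intros continuous_on_ellipse C1_onD(2-4)[OF f] C1_onD(2-4)[OF a] C1_onD(2-4)[OF b])

lemma F_deriv:
  assumes "s > s0"
  shows "((\<lambda>s. F s \<theta>) has_real_derivative Fs s \<theta>) (at s)" "(F s has_real_derivative Ft s \<theta>) (at \<theta>)"
  using deriv_s[OF f assms] deriv_\<theta>[OF f assms] by (simp_all add: F_def[abs_def] Fs_def Ft_def)

lemma flux_deriv: "s > s0 \<Longrightarrow> (flux has_real_derivative flux' s) (at s)"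
  unfolding flux_def[abs_def] flux'_def F_def Q_def J_def[abs_def]
  by (rule green_identity[OF f a b closed])

lemma near_conformal_densities:
  assumes "s > s0"
  shows "J s \<theta> \<ge> 19/20 * D s \<theta>" "(Ft s \<theta>)\<^sup>2 + (Q s \<theta>)\<^sup>2 \<le> (21/20)\<^sup>2 * D s \<theta>"
    "(Fs s \<theta>)\<^sup>2 + (P s \<theta>)\<^sup>2 \<le> (21/20)\<^sup>2 * D s \<theta>"
proof -
  note n = near_conformal_pointwise[OF near[OF assms, of \<theta>], of "sin \<theta>" "cos \<theta>"]
  have e: "exp (2 * s) = (exp s)\<^sup>2" "(exp s)\<^sup>2 > 0" by (simp_all add: exp_double)
  show "J s \<theta> \<ge> 19/20 * D s \<theta>"
    using mult_left_mono[OF n(1), of "(exp s)\<^sup>2"] unfolding J_def D_def e by (simp add: algebra_simps)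
  show "(Ft s \<theta>)\<^sup>2 + (Q s \<theta>)\<^sup>2 \<le> (21/20)\<^sup>2 * D s \<theta>"
    using mult_left_mono[OF n(2), of "(exp s)\<^sup>2"]
    unfolding Ft_def Q_def D_def e power_mult_distrib by (simp add: distrib_left mult.left_commute)
  show "(Fs s \<theta>)\<^sup>2 + (P s \<theta>)\<^sup>2 \<le> (21/20)\<^sup>2 * D s \<theta>"
    using mult_left_mono[OF n(3), of "(exp s)\<^sup>2"]
    unfolding Fs_def P_def D_def e power_mult_distrib by (simp add: distrib_left mult.left_commute)
qed

lemma flux'_ge: "s > s0 \<Longrightarrow> flux' s \<ge> 19/20 * energy s"
  using circ_le[of "\<lambda>\<theta>. 19/20 * D s \<theta>" "J s"] near_conformal_densities(1) continuous
  by (simp add: flux'_def energy_def continuous_intros)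

lemma energy_nonneg: "s > s0 \<Longrightarrow> energy s \<ge> 0"
  unfolding energy_def by (rule integral_nonneg) (auto intro!: integrable_continuous_interval continuous simp: D_def)

lemma tangential_energy_le:
  assumes "s > s0"
  shows "circ (\<lambda>\<theta>. (Ft s \<theta>)\<^sup>2) + circ (\<lambda>\<theta>. (Q s \<theta>)\<^sup>2) \<le> (21/20)\<^sup>2 * energy s"
proof -
  have "circ (\<lambda>\<theta>. (Ft s \<theta>)\<^sup>2) + circ (\<lambda>\<theta>. (Q s \<theta>)\<^sup>2) = circ (\<lambda>\<theta>. 1 * (Ft s \<theta>)\<^sup>2 + 1 * (Q s \<theta>)\<^sup>2)"
    by (subst circ_linear) (auto intro!: continuous_intros continuous assms)
  also have "\<dots> \<le> circ (\<lambda>\<theta>. (21/20)\<^sup>2 * D s \<theta>)"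
    using near_conformal_densities(2)[OF assms] by (intro circ_le) (auto intro!: continuous_intros continuous assms)
  finally show ?thesis by (simp add: energy_def)
qed

lemma normal_energy_le:
  assumes "s > s0"
  shows "circ (\<lambda>\<theta>. (Fs s \<theta>)\<^sup>2 + (P s \<theta>)\<^sup>2) \<le> (21/20)\<^sup>2 * energy s"
proof -
  have "circ (\<lambda>\<theta>. (Fs s \<theta>)\<^sup>2 + (P s \<theta>)\<^sup>2) \<le> circ (\<lambda>\<theta>. (21/20)\<^sup>2 * D s \<theta>)"
    using near_conformal_densities(3)[OF assms] by (intro circ_le) (auto intro!: continuous_intros continuous assms)
  then show ?thesis by (simp add: energy_def)
qed

lemma F_periodic: "F s (\<theta> + 2 * pi) = F s \<theta>" "Ft s (\<theta> + 2 * pi) = Ft s \<theta>"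
  by (simp_all add: F_def Ft_def)

lemma circ_sq_nonneg: "continuous_on {0..2 * pi} g \<Longrightarrow> 0 \<le> circ (\<lambda>\<theta>. (g \<theta>)\<^sup>2)"
  by (intro integral_nonneg integrable_continuous_interval continuous_intros) auto

text \<open>
  With the constant $4$ of Wirtinger's inequality, a conformal pair would satisfy \<open>\<bar>flux s\<bar> \<le> flux' s\<close>. The factor
  $4/5$ is what remains after the errors: $\frac45\cdot(\frac{21}{20})^2\le\frac{19}{20}$.
\<close>

lemma flux_le_if_zero:
  assumes s: "s > s0" and "\<theta> \<in> {0..2 * pi}" "F s \<theta> = 0"
  shows "\<bar>flux s\<bar> \<le> (21/20)\<^sup>2 * energy s" "4/5 * \<bar>flux s\<bar> \<le> flux' s"
proof -
  have "\<bar>flux s\<bar> \<le> (1 / (2 * 2)) * circ (\<lambda>t. (F s t)\<^sup>2) + (2 / 2) * circ (\<lambda>t. (Q s t)\<^sup>2)"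
    unfolding flux_def by (intro abs_circ_mult_le continuous s) auto
  also have "\<dots> \<le> circ (\<lambda>t. (Ft s t)\<^sup>2) + circ (\<lambda>t. (Q s t)\<^sup>2)"
    using wirtinger_periodic_zero[OF F_deriv(2)[OF s] continuous(3)[OF s] F_periodic assms(2,3)] by simp
  also have "\<dots> \<le> (21/20)\<^sup>2 * energy s" by (rule tangential_energy_le[OF s])
  finally show 1: "\<bar>flux s\<bar> \<le> (21/20)\<^sup>2 * energy s" .
  show "4/5 * \<bar>flux s\<bar> \<le> flux' s"
    using 1 flux'_ge[OF s] energy_nonneg[OF s] by (simp add: power2_eq_square)
qed

text \<open>
  When the form has no circulation, a constant can be subtracted from \<open>F\<close> in the flux, and Wirtinger's inequality with
  constant $1$ applies: a factor $2$ for a conformal pair, and $\frac{17}{10}$ because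
  $\frac{17}{10}\cdot\frac12(\frac{21}{20})^2\le\frac{19}{20}$.
\<close>

lemma flux_le_if_closed:
  assumes s: "s > s0" and Q0: "circ (Q s) = 0"
  shows "\<bar>flux s\<bar> \<le> 1/2 * (21/20)\<^sup>2 * energy s" "17/10 * \<bar>flux s\<bar> \<le> flux' s"
proof -
  obtain m where m: "circ (\<lambda>t. (F s t - m)\<^sup>2) \<le> circ (\<lambda>t. (Ft s t)\<^sup>2)"
    using wirtinger_periodic_mean[OF F_deriv(2)[OF s] continuous(3)[OF s] F_periodic] by blast
  have "circ (\<lambda>t. (F s t - m) * Q s t) = circ (\<lambda>t. 1 * (F s t * Q s t) + (- m) * Q s t)"
    by (simp add: algebra_simps)
  also have "\<dots> = 1 * circ (\<lambda>t. F s t * Q s t) + (- m) * circ (Q s)"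
    by (intro circ_linear continuous_intros continuous s)
  finally have "flux s = circ (\<lambda>t. (F s t - m) * Q s t)" using Q0 by (simp add: flux_def)
  then have "\<bar>flux s\<bar> \<le> (1 / (2 * 1)) * circ (\<lambda>t. (F s t - m)\<^sup>2) + (1 / 2) * circ (\<lambda>t. (Q s t)\<^sup>2)"
    by (simp only:) (intro abs_circ_mult_le continuous continuous_intros s; simp)
  also have "\<dots> \<le> 1/2 * (circ (\<lambda>t. (Ft s t)\<^sup>2) + circ (\<lambda>t. (Q s t)\<^sup>2))" using m by simp
  also have "\<dots> \<le> 1/2 * ((21/20)\<^sup>2 * energy s)" using tangential_energy_le[OF s] by simp
  finally show 1: "\<bar>flux s\<bar> \<le> 1/2 * (21/20)\<^sup>2 * energy s" by simp
  show "17/10 * \<bar>flux s\<bar> \<le> flux' s"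
    using 1 flux'_ge[OF s] energy_nonneg[OF s] by (simp add: power2_eq_square)
qed

end

lemma nondecreasing_if_deriv_nonneg:
  fixes g :: "real \<Rightarrow> real"
  assumes "\<And>s. s > s0 \<Longrightarrow> (g has_real_derivative g' s) (at s)" "\<And>s. s > s0 \<Longrightarrow> g' s \<ge> 0"
    and "s0 < s" "s \<le> t"
  shows "g s \<le> g t"
proof (rule DERIV_nonneg_imp_nondecreasing[OF \<open>s \<le> t\<close>])
  fix x assume "s \<le> x"
  then show "\<exists>y. (g has_real_derivative y) (at x) \<and> 0 \<le> y"
    using assms(1,2)[of x] \<open>s0 < s\<close> by auto
qed

text \<open>
  A positive value would make $-1/k-s/C$ nondecreasing, and $-1/k$ would reach $0$ in finite time.
\<close>

lemma riccati_blow_up: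
  fixes k k' :: "real \<Rightarrow> real"
  assumes k: "\<And>s. s > s0 \<Longrightarrow> (k has_real_derivative k' s) (at s)"
    and mono: "\<And>s. s > s0 \<Longrightarrow> k' s \<ge> 0"
    and quad: "\<And>s. s > s0 \<Longrightarrow> k s > 0 \<Longrightarrow> (k s)\<^sup>2 \<le> C * k' s" and "C > 0"
    and "s > s0"
  shows "k s \<le> 0"
proof (rule ccontr)
  assume "\<not> k s \<le> 0"
  then have ks: "k s > 0" by simp
  define t where "t = s + C / k s"
  have t: "s \<le> t" using ks \<open>C > 0\<close> by (simp add: t_def)
  have pos: "k x > 0" if "s \<le> x" for x
    using nondecreasing_if_deriv_nonneg[OF k mono \<open>s > s0\<close> that] ks by simp
  have "- 1 / k s - s / C \<le> - 1 / k t - t / C"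
  proof (rule DERIV_nonneg_imp_nondecreasing[OF t])
    fix x assume x: "s \<le> x"
    have "((\<lambda>x. - 1 / k x - x / C) has_real_derivative (k' x / (k x)\<^sup>2 - 1 / C)) (at x)"
      using k[of x] x \<open>s > s0\<close> pos[OF x] \<open>C > 0\<close>
      by (auto intro!: derivative_eq_intros simp: power2_eq_square)
    moreover have "k' x / (k x)\<^sup>2 - 1 / C \<ge> 0"
      using quad[of x] x \<open>s > s0\<close> pos[OF x] \<open>C > 0\<close> by (simp add: field_simps)
    ultimately show "\<exists>y. ((\<lambda>x. - 1 / k x - x / C) has_real_derivative y) (at x) \<and> 0 \<le> y" by blast
  qed
  moreover have "t / C = s / C + 1 / k s" using \<open>C > 0\<close> ks by (simp add: t_def field_simps)
  ultimately have "0 \<le> - 1 / k t" by simp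
  then show False using pos[OF t] by (simp add: field_simps)
qed

context near_conformal
begin

text \<open>
  For bounded \<open>F\<close> the flux is at most a constant times the square root of its own derivative, hence a Riccati inequality.
  This replaces an a priori bound for the Dirichlet integral near infinity.
\<close>

lemma flux_nonpos_if_bounded:
  assumes closed_form: "\<And>s. s > s0 \<Longrightarrow> circ (Q s) = 0"
    and bdd: "\<And>s \<theta>. s > s0 \<Longrightarrow> \<bar>F s \<theta>\<bar> \<le> M" and s: "s > s0"
  shows "flux s \<le> 0"
proof (rule riccati_blow_up[OF flux_deriv _ _ _ s])
  define M' where "M' = \<bar>M\<bar> + 1"
  have M': "M' > 0" by (simp add: M'_def)
  define C where "C = 12/5 * pi * M'\<^sup>2"
  show C: "C > 0" using M' by (simp add: C_def)
  fix s assume s: "s > s0"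
  show "flux' s \<ge> 0" using flux'_ge[OF s] energy_nonneg[OF s] by linarith
  assume pos: "flux s > 0"
  \<comment> \<open>chosen so that the first term of the estimate is half of the flux and can be absorbed\<close>
  define N where "N = 2 * pi * M'\<^sup>2 / flux s"
  have N: "N > 0" using pos M' by (simp add: N_def)
  have "flux s \<le> (1 / (2 * N)) * circ (\<lambda>t. (F s t)\<^sup>2) + (N / 2) * circ (\<lambda>t. (Q s t)\<^sup>2)"
    unfolding flux_def
    using abs_circ_mult_le[OF continuous(1)[OF s] continuous(5)[OF s] N] by linarith
  also have "\<dots> \<le> (1 / (2 * N)) * (2 * pi * M'\<^sup>2) + (N / 2) * (6/5 * flux' s)"
  proof (intro add_mono mult_left_mono)
    have "circ (\<lambda>t. (F s t)\<^sup>2) \<le> circ (\<lambda>t. M'\<^sup>2)"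
    proof (intro circ_le continuous_intros continuous s)
      fix t
      have "\<bar>F s t\<bar> \<le> M'" using bdd[OF s, of t] by (simp add: M'_def)
      then show "(F s t)\<^sup>2 \<le> M'\<^sup>2" using M' by (simp add: abs_le_square_iff[symmetric])
    qed
    then show "circ (\<lambda>t. (F s t)\<^sup>2) \<le> 2 * pi * M'\<^sup>2" by simp
    have "circ (\<lambda>t. (Q s t)\<^sup>2) \<le> (21/20)\<^sup>2 * energy s"
      using tangential_energy_le[OF s] circ_sq_nonneg[OF continuous(3)[OF s]] by linarith
    also have "\<dots> \<le> 6/5 * flux' s"
      using flux'_ge[OF s] energy_nonneg[OF s] by (simp add: power2_eq_square)
    finally show "circ (\<lambda>t. (Q s t)\<^sup>2) \<le> 6/5 * flux' s" .
  qed (use N in auto)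
  also have "(1 / (2 * N)) * (2 * pi * M'\<^sup>2) = flux s / 2"
    using pos M' by (simp add: N_def)
  also have "(N / 2) * (6/5 * flux' s) = C * flux' s / (2 * flux s)"
    using pos by (simp add: N_def C_def field_simps)
  finally have "flux s * flux s \<le> C * flux' s"
    using pos by (simp add: field_simps)
  then show "(flux s)\<^sup>2 \<le> C * flux' s" by (simp add: power2_eq_square)
qed

lemma flux_decay:
  assumes closed_form: "\<And>s. s > s0 \<Longrightarrow> circ (Q s) = 0"
    and bdd: "\<And>s \<theta>. s > s0 \<Longrightarrow> \<bar>F s \<theta>\<bar> \<le> M" and s: "s0 < s" "s \<le> t"
  shows "- flux t \<le> (exp (17/10 * s) * (- flux s)) * exp (- (17/10) * t)"
proof -
  have "exp (17/10 * s) * flux s \<le> exp (17/10 * t) * flux t"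
  proof (rule nondecreasing_if_deriv_nonneg[OF _ _ s])
    fix x assume x: "x > s0"
    show "((\<lambda>x. exp (17/10 * x) * flux x) has_real_derivative exp (17/10 * x) * (flux' x + 17/10 * flux x)) (at x)"
      using flux_deriv[OF x] by (auto intro!: derivative_eq_intros simp: algebra_simps)
    show "exp (17/10 * x) * (flux' x + 17/10 * flux x) \<ge> 0"
      using flux_le_if_closed(2)[OF x closed_form[OF x]] by (intro mult_nonneg_nonneg) auto
  qed
  then have le: "exp (- (17/10) * t) * (exp (17/10 * t) * - flux t) \<le> exp (- (17/10) * t) * (exp (17/10 * s) * - flux s)"
    by (intro mult_left_mono) auto
  have "- flux t = exp (- (17/10) * t) * (exp (17/10 * t) * - flux t)"
    unfolding mult.assoc[symmetric] exp_add[symmetric] by simp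
  also note le
  finally show ?thesis by (simp only: mult_ac)
qed

text \<open>
  Here the form is exact, with potential \<open>g\<close>. The flux is nonpositive and of order $e^{-17s/10}$,
  and its derivative controls the Dirichlet integrals. To pass to the mean square \<open>h\<close>, estimate
  $h'\ge-e^{-3s/10}h-\frac65e^{3s/10}I'$. The first coefficient is integrable, so the integrating factor \<open>m\<close> stays between
  positive bounds; the weight in the second costs $\frac3{10}$ of the exponent,
  which leaves $\frac{17}{10}-\frac3{10}=\frac75$. A suitable combination \<open>T\<close> of \<open>h\<close> and the flux is
  nondecreasing and at most \<open>h\<close>, which tends to $0$; hence it is nonpositive.
\<close>

lemma mean_square_decay:
  fixes g :: "complex \<Rightarrow> real"
  assumes g: "C1_on \<Omega> g a b"
    and bdd: "\<And>s \<theta>. s > s0 \<Longrightarrow> \<bar>F s \<theta>\<bar> \<le> M"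
  defines "h \<equiv> \<lambda>s. circ (\<lambda>\<theta>. (F s \<theta>)\<^sup>2 + (g (ell \<beta> s \<theta>))\<^sup>2)"
  assumes lim: "(h \<longlongrightarrow> 0) at_top" and s1: "s1 > s0"
  shows "\<exists>C. \<forall>s\<ge>s1. h s \<le> C * exp (- (7/5) * s)"
proof -
  define G where "G s \<theta> = g (ell \<beta> s \<theta>)" for s \<theta>
  have Gd: "((\<lambda>s. G s \<theta>) has_real_derivative P s \<theta>) (at s)" "(G s has_real_derivative Q s \<theta>) (at \<theta>)" if "s > s0" for s \<theta>
    using deriv_s[OF g that] deriv_\<theta>[OF g that] by (simp_all add: G_def[abs_def] P_def Q_def)
  have Gc: "continuous_on T (G s)" if "s > s0" for T s
    unfolding G_def[abs_def] by (intro continuous_on_ellipse C1_onD(4)[OF g] that)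
  have Q0: "circ (Q s) = 0" if "s > s0" for s
  proof -
    have "(Q s has_integral G s (2 * pi) - G s 0) {0..2 * pi}"
      using Gd(2)[OF that] by (intro fundamental_theorem_of_calculus)
       (auto simp: has_real_derivative_iff_has_vector_derivative[symmetric] intro: has_field_derivative_at_within)
    moreover have "G s (2 * pi) = G s 0" using ell_periodic[of \<beta> s 0] by (simp add: G_def)
    ultimately show ?thesis by (simp add: integral_unique)
  qed
  have nonpos: "flux s \<le> 0" if "s > s0" for s
    by (rule flux_nonpos_if_bounded[OF _ _ that]) (use Q0 bdd in auto)
  define C0 where "C0 = exp (17/10 * s1) * (- flux s1)"
  have C0: "C0 \<ge> 0" using nonpos[OF s1] by (simp add: C0_def mult_nonneg_nonpos)
  have decay: "- flux t \<le> C0 * exp (- (17/10) * t)" if "t \<ge> s1" for t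
    unfolding C0_def by (rule flux_decay[OF _ _ s1 that]) (use Q0 bdd in auto)
  define h' where "h' s = circ (\<lambda>\<theta>. 2 * F s \<theta> * Fs s \<theta> + 2 * G s \<theta> * P s \<theta>)" for s
  have hG: "h s = circ (\<lambda>\<theta>. (F s \<theta>)\<^sup>2 + (G s \<theta>)\<^sup>2)" for s by (simp add: h_def G_def)
  have h: "(h has_real_derivative h' s) (at s)" if s: "s > s0" for s
    unfolding hG[abs_def] h'_def
  proof (rule leibniz_circle[OF _ _ _ s])
    fix s \<theta> assume s: "s > s0"
    show "((\<lambda>s. (F s \<theta>)\<^sup>2 + (G s \<theta>)\<^sup>2) has_real_derivative 2 * F s \<theta> * Fs s \<theta> + 2 * G s \<theta> * P s \<theta>) (at s)"
      using F_deriv(1)[OF s, of \<theta>] Gd(1)[OF s, of \<theta>] by (auto intro!: derivative_eq_intros)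
    show "continuous_on UNIV (\<lambda>\<theta>. (F s \<theta>)\<^sup>2 + (G s \<theta>)\<^sup>2)"
      by (intro continuous_intros continuous Gc s)
  next
    show "continuous_on ({s0<..} \<times> UNIV) (\<lambda>(s, \<theta>). 2 * F s \<theta> * Fs s \<theta> + 2 * G s \<theta> * P s \<theta>)"
      unfolding F_def Fs_def G_def P_def split_beta using \<beta>
      by (auto intro!: continuous_intros continuous_on_ellipses C1_onD(2-4)[OF f] C1_onD(2-4)[OF g])
  qed
  have h'_ge: "h' s \<ge> - exp (- (3/10) * s) * h s - 6/5 * exp (3/10 * s) * flux' s" if s: "s > s0" for s
  proof -
    \<comment> \<open>the weight in Young's inequality for the products \<open>F * Fs\<close> and \<open>G * P\<close>\<close>
    define e where "e = exp (3/10 * s)"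
    have e: "e > 0" "exp (- (3/10) * s) = 1 / e" by (auto simp: e_def exp_minus field_simps)
    have pt: "2 * x * y \<ge> - ((1/e) * x\<^sup>2 + e * y\<^sup>2)" for x y :: real
    proof -
      have "0 \<le> (x + e * y)\<^sup>2 / e" using e by simp
      also have "\<dots> = (1/e) * x\<^sup>2 + e * y\<^sup>2 + 2 * x * y" using e by (simp add: power2_eq_square field_simps)
      finally show ?thesis by simp
    qed
    have "circ (\<lambda>\<theta>. (- (1/e)) * ((F s \<theta>)\<^sup>2 + (G s \<theta>)\<^sup>2) + (- e) * ((Fs s \<theta>)\<^sup>2 + (P s \<theta>)\<^sup>2)) \<le> h' s"
      unfolding h'_def
    proof (rule circ_le)
      fix \<theta>
      show "(- (1/e)) * ((F s \<theta>)\<^sup>2 + (G s \<theta>)\<^sup>2) + (- e) * ((Fs s \<theta>)\<^sup>2 + (P s \<theta>)\<^sup>2)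
         \<le> 2 * F s \<theta> * Fs s \<theta> + 2 * G s \<theta> * P s \<theta>"
        using pt[of "F s \<theta>" "Fs s \<theta>"] pt[of "G s \<theta>" "P s \<theta>"] by (simp add: algebra_simps)
    qed (intro continuous_intros continuous Gc s)+
    also have "circ (\<lambda>\<theta>. (- (1/e)) * ((F s \<theta>)\<^sup>2 + (G s \<theta>)\<^sup>2) + (- e) * ((Fs s \<theta>)\<^sup>2 + (P s \<theta>)\<^sup>2))
       = (- (1/e)) * h s + (- e) * circ (\<lambda>\<theta>. (Fs s \<theta>)\<^sup>2 + (P s \<theta>)\<^sup>2)"
      unfolding hG by (intro circ_linear continuous_intros continuous Gc s)
    finally have 1: "h' s \<ge> (- (1/e)) * h s + (- e) * circ (\<lambda>\<theta>. (Fs s \<theta>)\<^sup>2 + (P s \<theta>)\<^sup>2)" .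
    have "circ (\<lambda>\<theta>. (Fs s \<theta>)\<^sup>2 + (P s \<theta>)\<^sup>2) \<le> 6/5 * flux' s"
      using normal_energy_le[OF s] flux'_ge[OF s] energy_nonneg[OF s] by (simp add: power2_eq_square)
    then have "e * circ (\<lambda>\<theta>. (Fs s \<theta>)\<^sup>2 + (P s \<theta>)\<^sup>2) \<le> e * (6/5 * flux' s)" using e by simp
    then have "h' s \<ge> - (1/e) * h s - e * (6/5 * flux' s)" using 1 by linarith
    then show ?thesis unfolding e(2) e_def[symmetric] by (simp add: mult_ac)
  qed
  define m where "m s = exp (- (10/3) * exp (- (3/10) * s))" for s :: real
  have m: "0 < m s" "m s \<le> 1" for s by (auto simp: m_def)
  have hn: "h s \<ge> 0" if "s > s0" for s
    unfolding hG by (intro integral_nonneg integrable_continuous_interval continuous_intros continuous Gc that) auto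
  define T where "T s = m s * h s + 6/5 * (exp (3/10 * s) * flux s - C0 * exp (- (7/5) * s))" for s
  define T' where "T' s = m s * (h' s + exp (- (3/10) * s) * h s)
     + 6/5 * (exp (3/10 * s) * flux' s + 3/10 * exp (3/10 * s) * flux s + 7/5 * C0 * exp (- (7/5) * s))" for s
  have T: "(T has_real_derivative T' s) (at s)" if "s > s0" for s
    unfolding T_def T'_def m_def using h[OF that] flux_deriv[OF that]
    by (auto intro!: derivative_eq_intros simp: algebra_simps)
  have T'_nonneg: "T' s \<ge> 0" if s: "s \<ge> s1" for s
  proof -
    have s': "s > s0" using s s1 by simp
    have fl: "flux' s \<ge> 0" using flux'_ge[OF s'] energy_nonneg[OF s'] by linarith
    have "m s * (h' s + exp (- (3/10) * s) * h s) \<ge> m s * - (6/5 * exp (3/10 * s) * flux' s)"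
      using h'_ge[OF s'] m(1)[of s] by (intro mult_left_mono) auto
    moreover have "m s * (6/5 * exp (3/10 * s) * flux' s) \<le> 1 * (6/5 * exp (3/10 * s) * flux' s)"
      using m fl by (intro mult_right_mono) auto
    ultimately have 1: "m s * (h' s + exp (- (3/10) * s) * h s) \<ge> - (6/5 * exp (3/10 * s) * flux' s)" by linarith
    have "exp (3/10 * s) * (- flux s) \<le> exp (3/10 * s) * (C0 * exp (- (17/10) * s))"
      using decay[OF s] by (intro mult_left_mono) auto
    also have "\<dots> = C0 * exp (- (7/5) * s)"
      by (simp add: mult.left_commute[of _ C0] exp_add[symmetric])
    finally have 2: "exp (3/10 * s) * flux s \<ge> - (C0 * exp (- (7/5) * s))" by simp
    have "C0 * exp (- (7/5) * s) \<ge> 0" using C0 by simp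
    then show ?thesis using 1 2 unfolding T'_def by (simp add: algebra_simps)
  qed
  have T_le: "T s \<le> h t" if s: "s > s1" "s \<le> t" for s t
  proof -
    have t': "t > s0" using s s1 by simp
    have "T s \<le> T t"
      using T T'_nonneg s s1 by (intro nondecreasing_if_deriv_nonneg[of s1 T T' s t]) auto
    also have "T t \<le> h t"
    proof -
      have "m t * h t \<le> 1 * h t" using m hn[OF t'] by (intro mult_right_mono) auto
      moreover have "exp (3/10 * t) * flux t \<le> 0" using nonpos[OF t'] by (simp add: mult_nonneg_nonpos)
      moreover have "C0 * exp (- (7/5) * t) \<ge> 0" using C0 by simp
      ultimately have "6/5 * (exp (3/10 * t) * flux t - C0 * exp (- (7/5) * t)) \<le> 0"
        by (intro mult_nonneg_nonpos) auto
      then show ?thesis using \<open>m t * h t \<le> 1 * h t\<close> unfolding T_def by linarith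
    qed
    finally show ?thesis .
  qed
  have T_nonpos: "T s \<le> 0" if "s > s1" for s
  proof (rule tendsto_lowerbound[OF lim])
    show "\<forall>\<^sub>F t in at_top. T s \<le> h t"
      using eventually_ge_at_top[of s] by eventually_elim (use T_le[OF that] in auto)
  qed simp
  define C where "C = 12/5 * C0 / m s1"
  have "h s \<le> C * exp (- (7/5) * s)" if s: "s > s1" for s
  proof -
    have s': "s > s0" using s s1 by simp
    have "exp (3/10 * s) * (- flux s) \<le> exp (3/10 * s) * (C0 * exp (- (17/10) * s))"
      using decay[of s] s by (intro mult_left_mono) auto
    also have "\<dots> = C0 * exp (- (7/5) * s)"
      by (simp add: mult.left_commute[of _ C0] exp_add[symmetric])
    finally have "m s * h s \<le> 12/5 * C0 * exp (- (7/5) * s)"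
      using T_nonpos[OF s] unfolding T_def by (simp add: algebra_simps)
    moreover have "m s1 * h s \<le> m s * h s"
      using s hn[OF s'] by (intro mult_right_mono) (auto simp: m_def)
    ultimately have "m s1 * h s \<le> 12/5 * C0 * exp (- (7/5) * s)" by linarith
    then show ?thesis using m[of s1] by (simp add: C_def field_simps)
  qed
  moreover define C' where "C' = max C (h s1 / exp (- (7/5) * s1))"
  ultimately have "h s \<le> C' * exp (- (7/5) * s)" if "s \<ge> s1" for s
  proof (cases "s = s1")
    case True
    have "h s1 / exp (- (7/5) * s1) * exp (- (7/5) * s1) \<le> C' * exp (- (7/5) * s1)"
      unfolding C'_def by (intro mult_right_mono) auto
    then show ?thesis using True by simp
  next
    case False
    then have "h s \<le> C * exp (- (7/5) * s)" using \<open>\<And>s. s > s1 \<Longrightarrow> h s \<le> C * exp (- (7/5) * s)\<close> that by simp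
    also have "\<dots> \<le> C' * exp (- (7/5) * s)" unfolding C'_def by (intro mult_right_mono) auto
    finally show ?thesis .
  qed
  then show ?thesis by blast
qed

text \<open>
  The alternative between growth and decay: a positive flux would grow at least like $e^{4s/5}$, against the assumed
  bound. A nonpositive nondecreasing flux has arbitrarily small derivative at arbitrarily large $s$, and there the
  Dirichlet integral bounds \<open>F\<close>, which has a zero.
\<close>

lemma small_on_large_ellipses:
  assumes zero: "\<And>s. s > s0 \<Longrightarrow> \<exists>\<theta>\<in>{0..2 * pi}. F s \<theta> = 0"
    and growth: "\<And>s. s > s0 \<Longrightarrow> energy s \<le> C * exp (3/5 * s)" and "\<eta> > 0"
  shows "\<exists>s>S. \<forall>\<theta>\<in>{0..2 * pi}. \<bar>F s \<theta>\<bar> \<le> \<eta>"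
proof -
  have nonpos: "flux s1 \<le> 0" if s1: "s1 > s0" for s1
  proof (rule ccontr)
    assume "\<not> flux s1 \<le> 0"
    define c where "c = exp (- (4/5) * s1) * flux s1"
    have c: "c > 0" using \<open>\<not> flux s1 \<le> 0\<close> by (simp add: c_def)
    define C' where "C' = max C 0 * (21/20)\<^sup>2"
    have *: "c * exp (1/5 * s) \<le> C'" if s: "s \<ge> s1" for s
    proof -
      have s': "s > s0" using s s1 by simp
      have "c \<le> exp (- (4/5) * s) * flux s"
        unfolding c_def
      proof (rule nondecreasing_if_deriv_nonneg[OF _ _ s1 s])
        fix x assume x: "x > s0"
        show "((\<lambda>x. exp (- (4/5) * x) * flux x) has_real_derivative exp (- (4/5) * x) * (flux' x - 4/5 * flux x)) (at x)"
          using flux_deriv[OF x] by (auto intro!: derivative_eq_intros simp: algebra_simps)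
        obtain \<theta> where "\<theta> \<in> {0..2 * pi}" "F x \<theta> = 0" using zero[OF x] by blast
        from flux_le_if_zero(2)[OF x this]
        show "exp (- (4/5) * x) * (flux' x - 4/5 * flux x) \<ge> 0"
          by (intro mult_nonneg_nonneg) auto
      qed
      also have "flux s \<le> C' * exp (3/5 * s)"
      proof -
        obtain \<theta> where "\<theta> \<in> {0..2 * pi}" "F s \<theta> = 0" using zero[OF s'] by blast
        from flux_le_if_zero(1)[OF s' this] have "flux s \<le> (21/20)\<^sup>2 * energy s" by simp
        also have "\<dots> \<le> (21/20)\<^sup>2 * (C * exp (3/5 * s))" using growth[OF s'] by (intro mult_left_mono) auto
        also have "\<dots> \<le> (21/20)\<^sup>2 * (max C 0 * exp (3/5 * s))" by (intro mult_left_mono mult_right_mono) auto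
        finally show ?thesis by (simp add: C'_def mult_ac)
      qed
      finally have "c \<le> exp (- (4/5) * s) * (C' * exp (3/5 * s))" by simp
      also have "\<dots> = C' * exp (- (1/5) * s)"
        by (simp add: mult.left_commute[of _ C'] exp_add[symmetric])
      finally have "c * exp (1/5 * s) \<le> C' * exp (- (1/5) * s) * exp (1/5 * s)" by (intro mult_right_mono) auto
      also have "\<dots> = C'" by (simp add: mult.assoc exp_add[symmetric])
      finally show ?thesis .
    qed
    define s where "s = max s1 (5 * (C' / c))"
    have "5 * (C' / c) \<le> s" unfolding s_def by (rule max.cobounded2)
    then have "C' / c \<le> 1/5 * s" by linarith
    also have "\<dots> < exp (1/5 * s)" using exp_ge_add_one_self[of "1/5 * s"] by linarith
    finally have "C' < c * exp (1/5 * s)" using c by (simp add: field_simps)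
    then show False using *[of s] by (simp add: s_def)
  qed
  define t where "t = \<eta> / 4"
  have t: "t > 0" using \<open>\<eta> > 0\<close> by (simp add: t_def)
  define \<delta> where "\<delta> = t\<^sup>2 / 2"
  have \<delta>: "\<delta> > 0" using t by (simp add: \<delta>_def)
  define S' where "S' = max S s0"
  have "\<exists>s>S'. flux' s \<le> \<delta>"
  proof (rule ccontr)
    assume "\<not> (\<exists>s>S'. flux' s \<le> \<delta>)"
    then have big: "flux' s > \<delta>" if "s > S'" for s using that by force
    define u where "u = S' + 1"
    define v where "v = u + (1 - flux u) / \<delta>"
    have u: "u > s0" by (simp add: u_def S'_def)
    have uv: "u \<le> v" using nonpos[OF u] \<delta> by (simp add: v_def)
    have "flux u - \<delta> * u \<le> flux v - \<delta> * v"
    proof (rule nondecreasing_if_deriv_nonneg[of S' _ "\<lambda>x. flux' x - \<delta>" u v])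
      fix x assume x: "S' < x"
      then have "x > s0" by (simp add: S'_def)
      from flux_deriv[OF this] show "((\<lambda>x. flux x - \<delta> * x) has_real_derivative flux' x - \<delta>) (at x)"
        by (auto intro!: derivative_eq_intros)
      show "0 \<le> flux' x - \<delta>" using big[OF x] by simp
    qed (use uv in \<open>auto simp: u_def\<close>)
    moreover have "\<delta> * v = \<delta> * u + (1 - flux u)" using \<delta> by (simp add: v_def field_simps)
    ultimately have "flux v \<ge> 1" by linarith
    then show False using nonpos[of v] u uv by simp
  qed
  then obtain s where s: "s > S" "s > s0" "flux' s \<le> \<delta>" by (auto simp: S'_def)
  have "circ (\<lambda>\<theta>. (Ft s \<theta>)\<^sup>2) \<le> (21/20)\<^sup>2 * energy s"
    using tangential_energy_le[OF s(2)] circ_sq_nonneg[OF continuous(5)[OF s(2)]] by linarith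
  also have "\<dots> \<le> 6/5 * flux' s"
    using flux'_ge[OF s(2)] energy_nonneg[OF s(2)] by (simp add: power2_eq_square)
  also have "\<dots> \<le> t\<^sup>2" using s(3) zero_le_power2[of t] unfolding \<delta>_def by linarith
  finally have e: "circ (\<lambda>\<theta>. (Ft s \<theta>)\<^sup>2) \<le> t\<^sup>2" .
  obtain \<theta>0 where "\<theta>0 \<in> {0..2 * pi}" "F s \<theta>0 = 0" using zero[OF s(2)] by blast
  then have "\<bar>F s \<theta>\<bar> \<le> \<eta>" if "\<theta> \<in> {0..2 * pi}" for \<theta>
    using abs_le_of_zero_and_energy[OF F_deriv(2)[OF s(2)] continuous(3)[OF s(2)] _ _ t e that] by (simp add: t_def)
  then show ?thesis using s(1) by blast
qed

end

lemma C1_on_cong: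
  assumes "C1_on S f fx fy" "\<And>z. z \<in> S \<Longrightarrow> fx z = gx z" "\<And>z. z \<in> S \<Longrightarrow> fy z = gy z"
  shows "C1_on S f gx gy"
  using assms unfolding C1_on_def by (auto intro: continuous_on_eq)

section \<open>Flows with a subsonic density law\<close>

text \<open>
  The density is \<open>r q\<close> at the squared speed \<open>q\<close>, and \<open>1 / k q\<close> is the square of the speed of sound, so that
  \<open>q * k q\<close> is the square of the Mach number. Incompressible flow is \<open>r = 1\<close>, \<open>k = 0\<close>.
\<close>

locale density_law =
  fixes r k :: "real \<Rightarrow> real" and Qmax \<mu> L :: real
  assumes Qmax: "0 \<le> Qmax" and \<mu>: "0 \<le> \<mu>" "\<mu> < 1"
    and r_pos: "\<And>q. q \<in> {0..Qmax} \<Longrightarrow> r q > 0"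
    and r_deriv: "\<And>q. q \<in> {0..Qmax} \<Longrightarrow> (r has_real_derivative - (k q * r q / 2)) (at q)"
    and k_nonneg: "\<And>q. q \<in> {0..Qmax} \<Longrightarrow> k q \<ge> 0"
    and k_lip: "\<And>q q'. q \<in> {0..Qmax} \<Longrightarrow> q' \<in> {0..Qmax} \<Longrightarrow> \<bar>k q - k q'\<bar> \<le> L * \<bar>q - q'\<bar>"
    and subsonic: "\<And>q. q \<in> {0..Qmax} \<Longrightarrow> q * k q \<le> \<mu>"
begin

lemma k_continuous: "continuous_on {0..Qmax} k"
proof -
  have "\<bar>L\<bar>-lipschitz_on {0..Qmax} k"
  proof (rule lipschitz_onI)
    fix x y assume "x \<in> {0..Qmax}" "y \<in> {0..Qmax}"
    then have "\<bar>k x - k y\<bar> \<le> L * \<bar>x - y\<bar>" by (rule k_lip)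
    also have "\<dots> \<le> \<bar>L\<bar> * \<bar>x - y\<bar>" by (intro mult_right_mono) auto
    finally show "dist (k x) (k y) \<le> \<bar>L\<bar> * dist x y" by (simp add: dist_real_def)
  qed simp
  then show ?thesis by (rule lipschitz_on_continuous_on)
qed

lemma r_continuous: "continuous_on {0..Qmax} r"
  using r_deriv by (meson DERIV_isCont continuous_at_imp_continuous_on)

end

text \<open>
  The flow in the fluid domain and at infinity. The slip condition is a separate hypothesis of the comparison results below.
\<close>

locale planar_flow = density_law +
  fixes \<Omega> :: "complex set" and \<psi> :: "complex \<Rightarrow> real" and v :: "complex \<Rightarrow> complex" and u :: real
  assumes \<Omega>: "open \<Omega>" "bounded (- \<Omega>)"
    and smooth: "smooth_on \<Omega> \<psi>"
    and v_diff: "\<And>z. z \<in> \<Omega> \<Longrightarrow> v differentiable at z"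
    and momentum: "\<And>z. z \<in> \<Omega> \<Longrightarrow>
      of_real (r ((norm (v z))\<^sup>2)) * v z = Complex (partial_y \<psi> z) (- partial_x \<psi> z)"
    and irrotational: "\<And>z. z \<in> \<Omega> \<Longrightarrow> curl v z = 0"
    and speed: "\<And>z. z \<in> \<Omega> \<Longrightarrow> (norm (v z))\<^sup>2 \<le> Qmax"
    and v_lim: "(v \<longlongrightarrow> Complex u 0) at_infinity"
begin

abbreviation "q z \<equiv> (norm (v z))\<^sup>2"
abbreviation "v1 \<equiv> \<lambda>z. Re (v z)"
abbreviation "v2 \<equiv> \<lambda>z. Im (v z)"
abbreviation "\<psi>x \<equiv> partial_x \<psi>"
abbreviation "\<psi>y \<equiv> partial_y \<psi>"
abbreviation "\<psi>xx \<equiv> partial_x (partial_x \<psi>)"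
abbreviation "\<psi>xy \<equiv> partial_y (partial_x \<psi>)"
abbreviation "\<psi>yy \<equiv> partial_y (partial_y \<psi>)"

lemma q_in: "z \<in> \<Omega> \<Longrightarrow> q z \<in> {0..Qmax}"
  using speed by simp

lemma psi_C1: "C1_on \<Omega> \<psi> \<psi>x \<psi>y" "C1_on \<Omega> \<psi>x \<psi>xx \<psi>xy" "C1_on \<Omega> \<psi>y \<psi>xy \<psi>yy"
  "C1_on \<Omega> \<psi>xx (partial_x \<psi>xx) (partial_y \<psi>xx)" "C1_on \<Omega> \<psi>xy (partial_x \<psi>xy) (partial_y \<psi>xy)"
  "z \<in> \<Omega> \<Longrightarrow> partial_y \<psi>xx z = partial_x \<psi>xy z"
proof -
  have 3: "Ck_on (Suc (Suc (Suc 0))) \<Omega> \<psi>" using smooth unfolding smooth_on_def by blast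
  note 2 = Ck_on_Suc_partials[OF 3]
  note 1 = Ck_on_Suc_partials[OF 2(1)]
  show c: "C1_on \<Omega> \<psi> \<psi>x \<psi>y" "C1_on \<Omega> \<psi>x \<psi>xx \<psi>xy" by (rule Ck_on_C1_on[OF 3] Ck_on_C1_on[OF 2(1)])+
  have y: "C1_on \<Omega> \<psi>y (partial_x \<psi>y) \<psi>yy" by (rule Ck_on_C1_on[OF 2(2)])
  show "C1_on \<Omega> \<psi>y \<psi>xy \<psi>yy"
    using mixed_partials_commute[OF \<Omega>(1) c y] by (intro C1_on_cong[OF y]) auto
  show x: "C1_on \<Omega> \<psi>xx (partial_x \<psi>xx) (partial_y \<psi>xx)" "C1_on \<Omega> \<psi>xy (partial_x \<psi>xy) (partial_y \<psi>xy)"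
    by (rule Ck_on_C1_on[OF 1(1)] Ck_on_C1_on[OF 1(2)])+
  show "z \<in> \<Omega> \<Longrightarrow> partial_y \<psi>xx z = partial_x \<psi>xy z"
    using mixed_partials_commute[OF \<Omega>(1) c(2) x] by simp
qed

lemma psi_C2: "C2_on \<Omega> \<psi> \<psi>x \<psi>y \<psi>xx \<psi>xy \<psi>yy"
  unfolding C2_on_def using psi_C1 by blast

lemma momentum_components:
  assumes "z \<in> \<Omega>"
  shows "r (q z) * v1 z = \<psi>y z" "r (q z) * v2 z = - \<psi>x z"
  using momentum[OF assms] by (auto simp: complex_eq_iff)

lemma velocity_gradient:
  assumes "z \<in> \<Omega>"
  shows "has_gradient v1 (partial_x v1 z) (partial_y v1 z) z"
    "has_gradient v2 (partial_x v2 z) (partial_y v2 z) z"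
    "partial_x v2 z = partial_y v1 z"
proof -
  obtain v' where "(v has_derivative v') (at z)" using v_diff[OF assms] unfolding differentiable_def by blast
  then have "v1 differentiable at z" "v2 differentiable at z"
    unfolding differentiable_def by (auto intro: has_derivative_Re has_derivative_Im)
  then show "has_gradient v1 (partial_x v1 z) (partial_y v1 z) z" "has_gradient v2 (partial_x v2 z) (partial_y v2 z) z"
    by (simp_all add: differentiable_has_gradient)
  show "partial_x v2 z = partial_y v1 z" using irrotational[OF assms] by (simp add: curl_def)
qed

text \<open>
  Differentiating the momentum relation, where $dr=-\frac12kr\,d|v|^2$ and the curl-free Jacobian of \<open>v\<close> is
  symmetric with entries \<open>a\<close>, \<open>b\<close>, \<open>d\<close>.
\<close>

lemma momentum_gradient:
  assumes z: "z \<in> \<Omega>"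
  defines "a \<equiv> partial_x v1 z" and "b \<equiv> partial_y v1 z" and "d \<equiv> partial_y v2 z"
  shows "\<psi>xy z = r (q z) * (a - k (q z) * (v1 z * a + v2 z * b) * v1 z)"
    "\<psi>yy z = r (q z) * (b - k (q z) * (v1 z * b + v2 z * d) * v1 z)"
    "\<psi>xx z = - r (q z) * (b - k (q z) * (v1 z * a + v2 z * b) * v2 z)"
    "\<psi>xy z = - r (q z) * (d - k (q z) * (v1 z * b + v2 z * d) * v2 z)"
proof -
  note g = velocity_gradient[OF z, unfolded a_def[symmetric] b_def[symmetric] d_def[symmetric]]
  define A where "A = v1 z * a + v2 z * b"
  define B where "B = v1 z * b + v2 z * d"
  have q: "q = (\<lambda>z. v1 z * v1 z + v2 z * v2 z)" unfolding cmod_power2 by (simp add: power2_eq_square)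
  have "has_gradient q (2 * A) (2 * B) z"
    unfolding q by (rule has_derivative_eq_rhs[OF has_derivative_add[OF has_derivative_mult[OF g(1) g(1)] has_derivative_mult[OF g(2) g(2)]]])
      (auto simp: A_def B_def g(3) algebra_simps)
  from has_derivative_compose[OF this r_deriv[OF q_in[OF z], unfolded has_field_derivative_def]]
  have rq: "has_gradient (\<lambda>z. r (q z)) (- k (q z) * r (q z) * A) (- k (q z) * r (q z) * B) z"
    by (rule has_derivative_eq_rhs) (auto simp: algebra_simps)
  have m1: "has_gradient (\<lambda>z. r (q z) * v1 z) (r (q z) * (a - k (q z) * A * v1 z)) (r (q z) * (b - k (q z) * B * v1 z)) z"
    by (rule has_derivative_eq_rhs[OF has_derivative_mult[OF rq g(1)]]) (auto simp: algebra_simps)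
  have m2: "has_gradient (\<lambda>z. - (r (q z) * v2 z)) (- r (q z) * (b - k (q z) * A * v2 z)) (- r (q z) * (d - k (q z) * B * v2 z)) z"
    by (rule has_derivative_eq_rhs[OF has_derivative_minus[OF has_derivative_mult[OF rq g(2)]]]) (auto simp: algebra_simps g(3))
  have "has_gradient \<psi>y (r (q z) * (a - k (q z) * A * v1 z)) (r (q z) * (b - k (q z) * B * v1 z)) z"
    by (rule has_derivative_transform_within_open[OF m1 \<Omega>(1) z]) (simp add: momentum_components)
  from has_gradient_unique[OF this C1_onD(1)[OF psi_C1(3) z]]
  show "\<psi>xy z = r (q z) * (a - k (q z) * (v1 z * a + v2 z * b) * v1 z)"
    "\<psi>yy z = r (q z) * (b - k (q z) * (v1 z * b + v2 z * d) * v1 z)"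
    by (simp_all add: A_def B_def)
  have "has_gradient \<psi>x (- r (q z) * (b - k (q z) * A * v2 z)) (- r (q z) * (d - k (q z) * B * v2 z)) z"
    by (rule has_derivative_transform_within_open[OF m2 \<Omega>(1) z]) (simp add: momentum_components)
  from has_gradient_unique[OF this C1_onD(1)[OF psi_C1(2) z]]
  show "\<psi>xx z = - r (q z) * (b - k (q z) * (v1 z * a + v2 z * b) * v2 z)"
    "\<psi>xy z = - r (q z) * (d - k (q z) * (v1 z * b + v2 z * d) * v2 z)"
    by (simp_all add: A_def B_def)
qed

lemma stream_equation:
  assumes z: "z \<in> \<Omega>"
  shows "\<psi>xx z + \<psi>yy z = k (q z) * ((v1 z)\<^sup>2 * \<psi>xx z + 2 * v1 z * v2 z * \<psi>xy z + (v2 z)\<^sup>2 * \<psi>yy z)"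
proof -
  note m = momentum_gradient[OF z]
  have "2 * \<psi>xy z = r (q z) * (partial_x v1 z - k (q z) * (v1 z * partial_x v1 z + v2 z * partial_y v1 z) * v1 z)
     + - r (q z) * (partial_y v2 z - k (q z) * (v1 z * partial_y v1 z + v2 z * partial_y v2 z) * v2 z)"
    using m(1,4) by simp
  then show ?thesis using m(2,3) by algebra
qed

definition "n z = of_real (sqrt (k (q z))) * v z"

lemma norm_n: "z \<in> \<Omega> \<Longrightarrow> (norm (n z))\<^sup>2 \<le> \<mu>"
  using subsonic[OF q_in] k_nonneg[OF q_in] by (simp add: n_def norm_mult power_mult_distrib mult.commute)

lemma elliptic_op_n: "z \<in> \<Omega> \<Longrightarrow> elliptic_op (n z) a b c = a + c - k (q z) * ((v1 z)\<^sup>2 * a + 2 * v1 z * v2 z * b + (v2 z)\<^sup>2 * c)"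
  using k_nonneg[OF q_in, of z] by (simp add: elliptic_op_def n_def power_mult_distrib algebra_simps flip: power2_eq_square)

lemma stream_elliptic: "z \<in> \<Omega> \<Longrightarrow> elliptic_op (n z) (\<psi>xx z) (\<psi>xy z) (\<psi>yy z) = 0"
  using stream_equation by (simp add: elliptic_op_n)

lemma subsonic_denominator_pos: "z \<in> \<Omega> \<Longrightarrow> 1 - k (q z) * q z > 0"
  using subsonic[OF q_in, of z] \<mu> by (simp add: mult.commute)

lemma v_continuous: "continuous_on \<Omega> v"
  using v_diff by (auto intro!: continuous_at_imp_continuous_on differentiable_imp_continuous_within)

text \<open>
  The derivatives of \<open>v\<close> are continuous because the linear system of \<open>momentum_gradient\<close> can be solved for them, its
  determinant being positive for subsonic flow.
\<close>

lemma velocity_C1: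
  "C1_on \<Omega> v1 (partial_x v1) (partial_y v1)" "C1_on \<Omega> v2 (partial_y v1) (partial_y v2)"
proof -
  have qc: "continuous_on \<Omega> q" by (intro continuous_intros v_continuous)
  have kc: "continuous_on \<Omega> (\<lambda>z. k (q z))" and rc: "continuous_on \<Omega> (\<lambda>z. r (q z))"
    using q_in by (auto intro!: continuous_on_compose2[OF k_continuous qc] continuous_on_compose2[OF r_continuous qc])
  define A where "A z = (v1 z * \<psi>xy z - v2 z * \<psi>xx z) / (r (q z) * (1 - k (q z) * q z))" for z
  define B where "B z = (v1 z * \<psi>yy z - v2 z * \<psi>xy z) / (r (q z) * (1 - k (q z) * q z))" for z
  have nz: "r (q z) \<noteq> 0" "1 - k (q z) * q z \<noteq> 0" if "z \<in> \<Omega>" for z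
    using r_pos[OF q_in[OF that]] subsonic_denominator_pos[OF that] by auto
  have A: "A z = v1 z * partial_x v1 z + v2 z * partial_y v1 z" and B: "B z = v1 z * partial_y v1 z + v2 z * partial_y v2 z" if z: "z \<in> \<Omega>" for z
  proof -
    note m = momentum_gradient[OF z]
    have q: "q z = (v1 z)\<^sup>2 + (v2 z)\<^sup>2" by (simp add: cmod_power2)
    have "v1 z * \<psi>xy z - v2 z * \<psi>xx z = (v1 z * partial_x v1 z + v2 z * partial_y v1 z) * (r (q z) * (1 - k (q z) * q z))"
      unfolding m(1,3) by (subst (5) q) algebra
    then show "A z = v1 z * partial_x v1 z + v2 z * partial_y v1 z" using nz[OF z] by (simp add: A_def field_simps)
    have "v1 z * \<psi>yy z - v2 z * \<psi>xy z = (v1 z * partial_y v1 z + v2 z * partial_y v2 z) * (r (q z) * (1 - k (q z) * q z))"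
      unfolding m(2,4) by (subst (5) q) algebra
    then show "B z = v1 z * partial_y v1 z + v2 z * partial_y v2 z" using nz[OF z] by (simp add: B_def field_simps)
  qed
  have v12: "continuous_on \<Omega> v1" "continuous_on \<Omega> v2" by (intro continuous_intros v_continuous)+
  have ABc: "continuous_on \<Omega> A" "continuous_on \<Omega> B"
    unfolding A_def B_def using nz
    by (intro continuous_intros v12 v_continuous kc rc C1_onD(2,3)[OF psi_C1(2)] C1_onD(2,3)[OF psi_C1(3)]; auto)+
  have "partial_x v1 z = \<psi>xy z / r (q z) + k (q z) * A z * v1 z"
    "partial_y v1 z = \<psi>yy z / r (q z) + k (q z) * B z * v1 z"
    "partial_y v2 z = - \<psi>xy z / r (q z) + k (q z) * B z * v2 z" if z: "z \<in> \<Omega>" for z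
    unfolding A[OF z] B[OF z] using momentum_gradient(1,2,4)[OF z] nz[OF z] by (simp_all add: field_simps)
  note eq = this
  have c: "continuous_on \<Omega> (partial_x v1)" "continuous_on \<Omega> (partial_y v1)" "continuous_on \<Omega> (partial_y v2)"
  proof -
    have "continuous_on \<Omega> (\<lambda>z. \<psi>xy z / r (q z) + k (q z) * A z * v1 z)"
      using nz by (intro continuous_intros v12 kc rc ABc C1_onD(2,3)[OF psi_C1(2)]) auto
    then show "continuous_on \<Omega> (partial_x v1)" by (rule continuous_on_eq) (simp add: eq(1))
    have "continuous_on \<Omega> (\<lambda>z. \<psi>yy z / r (q z) + k (q z) * B z * v1 z)"
      using nz by (intro continuous_intros v12 kc rc ABc C1_onD(2,3)[OF psi_C1(3)]) auto
    then show "continuous_on \<Omega> (partial_y v1)" by (rule continuous_on_eq) (simp add: eq(2))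
    have "continuous_on \<Omega> (\<lambda>z. - \<psi>xy z / r (q z) + k (q z) * B z * v2 z)"
      using nz by (intro continuous_intros v12 kc rc ABc C1_onD(2,3)[OF psi_C1(2)]) auto
    then show "continuous_on \<Omega> (partial_y v2)" by (rule continuous_on_eq) (simp add: eq(3))
  qed
  show "C1_on \<Omega> v1 (partial_x v1) (partial_y v1)" "C1_on \<Omega> v2 (partial_y v1) (partial_y v2)"
    using c velocity_gradient unfolding C1_on_def by auto
qed

end

section \<open>Behaviour at infinity\<close>

lemma norm_ell_ge:
  assumes "0 < \<beta>" "\<beta> \<le> 1"
  shows "exp s \<le> norm (ell \<beta> s \<theta>)"
proof -
  have "\<bar>sin \<theta>\<bar> \<le> \<bar>sin \<theta>\<bar> / \<beta>" using assms by (simp add: field_simps mult_left_le_one_le)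
  then have "(sin \<theta>)\<^sup>2 \<le> (sin \<theta> / \<beta>)\<^sup>2" using assms by (simp add: abs_le_square_iff[symmetric])
  then have "1 \<le> (cos \<theta>)\<^sup>2 + (sin \<theta> / \<beta>)\<^sup>2" using sin_cos_squared_add[of \<theta>] by linarith
  then have "(exp s)\<^sup>2 * 1 \<le> (exp s)\<^sup>2 * ((cos \<theta>)\<^sup>2 + (sin \<theta> / \<beta>)\<^sup>2)" by (intro mult_left_mono) auto
  also have "\<dots> = (norm (ell \<beta> s \<theta>))\<^sup>2" by (simp add: cmod_power2 power_mult_distrib power_divide algebra_simps)
  finally show ?thesis by simp
qed

lemma eventually_on_ellipses:
  assumes "eventually P at_infinity" and "0 < \<beta>" "\<beta> \<le> 1"
  shows "\<exists>s0\<ge>S. \<forall>s>s0. \<forall>\<theta>. P (ell \<beta> s \<theta>)"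
proof -
  obtain b where b: "\<And>z. norm z \<ge> b \<Longrightarrow> P z" using assms(1) unfolding eventually_at_infinity by blast
  define s0 where "s0 = max S (ln (max b 1))"
  have "P (ell \<beta> s \<theta>)" if "s > s0" for s \<theta>
  proof (rule b)
    have "b \<le> exp (ln (max b 1))" by simp
    also have "\<dots> \<le> exp s" using that unfolding s0_def exp_le_cancel_iff by simp
    also have "\<dots> \<le> norm (ell \<beta> s \<theta>)" by (rule norm_ell_ge[OF assms(2,3)])
    finally show "b \<le> norm (ell \<beta> s \<theta>)" .
  qed
  then show ?thesis by (intro exI[of _ s0]) (auto simp: s0_def)
qed

lemma point_on_ellipse:
  assumes "\<beta> > 0" "(Re z)\<^sup>2 + (\<beta> * Im z)\<^sup>2 = (exp s)\<^sup>2"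
  shows "\<exists>\<theta>\<in>{0..2 * pi}. z = ell \<beta> s \<theta>"
proof -
  have "(Re z / exp s)\<^sup>2 + (\<beta> * Im z / exp s)\<^sup>2 = 1"
    using assms(2) by (simp add: power_divide add_divide_distrib[symmetric])
  then obtain \<theta> where "0 \<le> \<theta>" "\<theta> \<le> 2 * pi" "Re z / exp s = cos \<theta>" "\<beta> * Im z / exp s = sin \<theta>"
    using sincos_total_2pi_le by blast
  then have "Re z = exp s * cos \<theta>" "\<beta> * Im z = exp s * sin \<theta>"
    by (metis nonzero_eq_divide_eq exp_not_eq_zero mult.commute)+
  then have "Re z = exp s * cos \<theta>" "Im z = exp s * sin \<theta> / \<beta>"
    using assms(1) by (auto simp: nonzero_eq_divide_eq mult.commute)
  then have "z = ell \<beta> s \<theta>" by (simp add: complex_eq_iff)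
  then show ?thesis using \<open>0 \<le> \<theta>\<close> \<open>\<theta> \<le> 2 * pi\<close> by auto
qed

lemma eventually_at_infinity_notin_bounded:
  fixes A :: "complex set"
  assumes "bounded A"
  shows "\<forall>\<^sub>F z in at_infinity. z \<in> - A"
proof -
  obtain R where R: "\<forall>z\<in>A. norm z \<le> R" using assms unfolding bounded_iff by auto
  then show ?thesis unfolding eventually_at_infinity by (intro exI[of _ "R + 1"]) force
qed

text \<open>
  The weak maximum principle for \<open>f + \<eta>\<close> on the part of \<open>\<Omega>\<close> inside a large ellipse.
\<close>

lemma nonneg_of_large_ellipses:
  assumes \<Omega>: "open \<Omega>" "bounded (- \<Omega>)" and \<mu>: "\<mu> < 1" and \<beta>: "0 < \<beta>" "\<beta> \<le> 1"
    and f: "C2_on \<Omega> f fx fy fxx fxy fyy"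
    and op: "\<And>K. compact K \<Longrightarrow> K \<subseteq> \<Omega> \<Longrightarrow>
       \<exists>C. \<forall>z\<in>K. \<exists>n. (norm n)\<^sup>2 \<le> \<mu> \<and> elliptic_op n (fxx z) (fxy z) (fyy z) \<le> C * (\<bar>fx z\<bar> + \<bar>fy z\<bar>)"
    and bd: "\<And>y \<epsilon>. y \<in> frontier \<Omega> \<Longrightarrow> \<epsilon> > 0 \<Longrightarrow> \<forall>\<^sub>F z in at y within \<Omega>. f z \<ge> - \<epsilon>"
    and large: "\<And>\<eta> S. \<eta> > 0 \<Longrightarrow> \<exists>s>S. \<forall>\<theta>\<in>{0..2 * pi}. f (ell \<beta> s \<theta>) \<ge> - \<eta>"
    and z0: "z0 \<in> \<Omega>"
  shows "f z0 \<ge> 0"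
proof (rule field_le_epsilon)
  fix \<eta> :: real assume \<eta>: "\<eta> > 0"
  from eventually_on_ellipses[OF eventually_at_infinity_notin_bounded[OF \<Omega>(2), unfolded double_complement] \<beta>, of "norm z0"]
  obtain S where S: "S \<ge> norm z0" "\<And>s \<theta>. s > S \<Longrightarrow> ell \<beta> s \<theta> \<in> \<Omega>" by blast
  obtain s where s: "s > S" "\<And>\<theta>. \<theta> \<in> {0..2 * pi} \<Longrightarrow> f (ell \<beta> s \<theta>) \<ge> - \<eta>" using large[OF \<eta>] by blast
  define e where "e z = (Re z)\<^sup>2 + (\<beta> * Im z)\<^sup>2" for z
  define U where "U = \<Omega> \<inter> {z. e z < (exp s)\<^sup>2}"
  have ec: "continuous_on UNIV e" unfolding e_def by (intro continuous_intros)
  have U: "open U" "U \<subseteq> \<Omega>"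
    unfolding U_def using \<Omega>(1) by (auto intro!: open_Int open_Collect_less ec continuous_intros)
  have "bounded U"
  proof (rule boundedI)
    fix z assume "z \<in> U"
    have "\<beta>\<^sup>2 * (norm z)\<^sup>2 \<le> e z"
    proof -
      have "\<beta>\<^sup>2 * (Re z)\<^sup>2 \<le> 1 * (Re z)\<^sup>2" using \<beta> by (intro mult_right_mono) (auto simp: power_le_one)
      then show ?thesis by (simp add: e_def cmod_power2 power_mult_distrib distrib_left)
    qed
    also have "e z \<le> (exp s)\<^sup>2" using \<open>z \<in> U\<close> by (simp add: U_def)
    finally have "(\<beta> * norm z)\<^sup>2 \<le> (exp s)\<^sup>2" by (simp add: power_mult_distrib)
    then have "\<beta> * norm z \<le> exp s" using power2_le_imp_le[of "\<beta> * norm z" "exp s"] by simp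
    then show "norm z \<le> exp s / \<beta>" using \<beta> by (simp add: field_simps)
  qed
  have w: "C2_on U (\<lambda>z. f z + \<eta>) (\<lambda>z. fx z + 0) (\<lambda>z. fy z + 0) (\<lambda>z. fxx z + 0) (\<lambda>z. fxy z + 0) (\<lambda>z. fyy z + 0)"
    by (intro C2_on_add C2_on_subset[OF f U(2)] C2_on_const)
  have "f z0 + \<eta> \<ge> 0"
  proof (rule weak_max_principle[OF U(1) \<open>bounded U\<close> \<mu> w])
    fix K assume "compact K" "K \<subseteq> U"
    then show "\<exists>C. \<forall>z\<in>K. \<exists>n. (norm n)\<^sup>2 \<le> \<mu> \<and> elliptic_op n (fxx z + 0) (fxy z + 0) (fyy z + 0) \<le> C * (\<bar>fx z + 0\<bar> + \<bar>fy z + 0\<bar>)"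
      using op[of K] U by simp
  next
    fix y and \<epsilon> :: real assume y: "y \<in> frontier U" and \<epsilon>: "\<epsilon> > 0"
    have yc: "y \<in> closure U" "y \<notin> U" using y U(1) by (auto simp: frontier_def interior_open)
    have y\<Omega>: "y \<in> closure \<Omega>" using yc U(2) closure_mono by blast
    show "\<forall>\<^sub>F z in at y within U. f z + \<eta> \<ge> - \<epsilon>"
    proof (cases "y \<in> \<Omega>")
      case False
      then have "y \<in> frontier \<Omega>" using y\<Omega> \<Omega>(1) by (simp add: frontier_def interior_open)
      from bd[OF this \<epsilon>] have "\<forall>\<^sub>F z in at y within U. f z \<ge> - \<epsilon>"
        by (rule filter_leD[OF at_le[OF U(2)]])
      then show ?thesis by eventually_elim (use \<eta> in simp)
    next
      case True
      have "closure U \<subseteq> {z. e z \<le> (exp s)\<^sup>2}"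
        by (rule closure_minimal) (auto simp: U_def intro!: closed_Collect_le ec continuous_intros)
      then have "e y = (exp s)\<^sup>2" using yc True by (force simp: U_def)
      then obtain \<theta> where "\<theta> \<in> {0..2 * pi}" "y = ell \<beta> s \<theta>"
        using point_on_ellipse[OF \<beta>(1), of y s] by (auto simp: e_def)
      then have "f y + \<eta> \<ge> 0" using s(2) by fastforce
      moreover have "continuous (at y) (\<lambda>z. f z + \<eta>)"
        using f True unfolding C2_on_def by (intro continuous_intros C1_on_continuous_at) auto
      ultimately show ?thesis using eventually_ge_neg_within \<epsilon> by blast
    qed
  next
    have "norm z0 < exp s" using S(1) s(1) exp_ge_add_one_self[of s] by linarith
    then have lt: "(norm z0)\<^sup>2 < (exp s)\<^sup>2" by (intro power_strict_mono) auto
    have "e z0 \<le> (norm z0)\<^sup>2"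
    proof -
      have "\<beta>\<^sup>2 * (Im z0)\<^sup>2 \<le> 1 * (Im z0)\<^sup>2" using \<beta> by (intro mult_right_mono) (auto simp: power_le_one)
      then show ?thesis by (simp add: e_def cmod_power2 power_mult_distrib)
    qed
    also note lt
    finally show "z0 \<in> U" using z0 by (simp add: U_def)
  qed
  then show "0 \<le> f z0 + \<eta>" .
qed

context planar_flow
begin

lemma eventually_in: "\<forall>\<^sub>F z in at_infinity. z \<in> \<Omega>"
  using eventually_at_infinity_notin_bounded[OF \<Omega>(2)] by simp

lemma q_lim: "(q \<longlongrightarrow> u\<^sup>2) at_infinity"
proof -
  have "(q \<longlongrightarrow> (norm (Complex u 0))\<^sup>2) at_infinity" by (intro tendsto_intros v_lim)
  then show ?thesis by (simp add: cmod_power2)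
qed

lemma u_in: "u\<^sup>2 \<in> {0..Qmax}"
proof -
  have "u\<^sup>2 \<le> Qmax"
    using eventually_in by (intro tendsto_upperbound[OF q_lim]) (auto elim!: eventually_mono intro: speed simp: trivial_limit_at_infinity)
  then show ?thesis by simp
qed

lemma comp_q_lim:
  assumes "continuous_on {0..Qmax} g"
  shows "((\<lambda>z. g (q z)) \<longlongrightarrow> g (u\<^sup>2)) at_infinity"
  by (rule continuous_on_tendsto_compose[OF assms q_lim u_in])
    (use eventually_in in \<open>auto elim!: eventually_mono intro: speed\<close>)

text \<open>
  The Prandtl-Glauert factor: stretching $y$ by it turns the equation at infinity into Laplace's equation.
\<close>

definition "\<beta> = sqrt (1 - k (u\<^sup>2) * u\<^sup>2)"

lemma \<beta>: "0 < \<beta>" "\<beta> \<le> 1" "\<beta>\<^sup>2 = 1 - k (u\<^sup>2) * u\<^sup>2"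
proof -
  have "k (u\<^sup>2) * u\<^sup>2 < 1" using subsonic[OF u_in] \<mu> by (simp add: mult.commute)
  then show "0 < \<beta>" "\<beta>\<^sup>2 = 1 - k (u\<^sup>2) * u\<^sup>2" by (simp_all add: \<beta>_def)
  show "\<beta> \<le> 1" using k_nonneg[OF u_in] by (simp add: \<beta>_def)
qed

definition "flow_rate = r (u\<^sup>2) * u"

lemma gradient_lim: "(\<psi>y \<longlongrightarrow> flow_rate) at_infinity" "(\<psi>x \<longlongrightarrow> 0) at_infinity"
proof -
  have ev: "\<forall>\<^sub>F z in at_infinity. r (q z) * v1 z = \<psi>y z" "\<forall>\<^sub>F z in at_infinity. - (r (q z) * v2 z) = \<psi>x z"
    using eventually_in by (auto elim!: eventually_mono simp: momentum_components)
  have "((\<lambda>z. r (q z) * v1 z) \<longlongrightarrow> r (u\<^sup>2) * Re (Complex u 0)) at_infinity"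
    by (intro tendsto_intros comp_q_lim r_continuous v_lim)
  from Lim_transform_eventually[OF this ev(1)]
  show "(\<psi>y \<longlongrightarrow> flow_rate) at_infinity" by (simp add: flow_rate_def)
  have "((\<lambda>z. - (r (q z) * v2 z)) \<longlongrightarrow> - (r (u\<^sup>2) * Im (Complex u 0))) at_infinity"
    by (intro tendsto_intros comp_q_lim r_continuous v_lim)
  from Lim_transform_eventually[OF this ev(2)]
  show "(\<psi>x \<longlongrightarrow> 0) at_infinity" by simp
qed

text \<open>
  The Cauchy-Riemann equations for the pair $(\psi_y,\beta\psi_x)$ in the coordinates $(x,\beta y)$. One
  holds exactly, by symmetry of the Hessian; the error in the other is the difference between the coefficients of the
  equation and their limits, times second derivatives.
\<close>

lemma asymptotically_conformal:
  "\<forall>\<^sub>F z in at_infinity. (\<beta> * \<psi>xx z + \<psi>yy z / \<beta>)\<^sup>2 \<le> (1/20)\<^sup>2 * ((\<psi>xy z)\<^sup>2 + (\<psi>yy z / \<beta>)\<^sup>2)"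
proof -
  define \<epsilon> where "\<epsilon> = \<beta>\<^sup>2 / 200"
  have \<epsilon>: "\<epsilon> > 0" using \<beta>(1) by (simp add: \<epsilon>_def)
  note l = comp_q_lim[OF k_continuous] tendsto_Re[OF v_lim] tendsto_Im[OF v_lim]
  have "((\<lambda>z. \<beta>\<^sup>2 - 1 + k (q z) * (v1 z)\<^sup>2) \<longlongrightarrow> \<beta>\<^sup>2 - 1 + k (u\<^sup>2) * (Re (Complex u 0))\<^sup>2) at_infinity"
    by (intro tendsto_intros l)
  then have "((\<lambda>z. \<beta>\<^sup>2 - 1 + k (q z) * (v1 z)\<^sup>2) \<longlongrightarrow> 0) at_infinity"
    by (rule tendsto_eq_rhs) (simp add: \<beta>(3))
  from tendstoD[OF this \<epsilon>] have 1: "\<forall>\<^sub>F z in at_infinity. \<bar>\<beta>\<^sup>2 - 1 + k (q z) * (v1 z)\<^sup>2\<bar> < \<epsilon>"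
    unfolding dist_real_def diff_0_right .
  have "((\<lambda>z. 2 * (k (q z) * v1 z * v2 z)) \<longlongrightarrow> 2 * (k (u\<^sup>2) * Re (Complex u 0) * Im (Complex u 0))) at_infinity"
    by (intro tendsto_intros l)
  then have "((\<lambda>z. 2 * (k (q z) * v1 z * v2 z)) \<longlongrightarrow> 0) at_infinity"
    by (rule tendsto_eq_rhs) (simp)
  from tendstoD[OF this \<epsilon>] have 2: "\<forall>\<^sub>F z in at_infinity. \<bar>2 * (k (q z) * v1 z * v2 z)\<bar> < \<epsilon>"
    unfolding dist_real_def diff_0_right .
  have "((\<lambda>z. k (q z) * (v2 z)\<^sup>2) \<longlongrightarrow> k (u\<^sup>2) * (Im (Complex u 0))\<^sup>2) at_infinity"
    by (intro tendsto_intros l)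
  then have "((\<lambda>z. k (q z) * (v2 z)\<^sup>2) \<longlongrightarrow> 0) at_infinity"
    by (rule tendsto_eq_rhs) (simp)
  from tendstoD[OF this \<epsilon>] have 3: "\<forall>\<^sub>F z in at_infinity. \<bar>k (q z) * (v2 z)\<^sup>2\<bar> < \<epsilon>"
    unfolding dist_real_def diff_0_right .
  show ?thesis
    using 1 2 3 eventually_in
  proof eventually_elim
    case (elim z)
    define c1 c2 c3 where "c1 = \<beta>\<^sup>2 - 1 + k (q z) * (v1 z)\<^sup>2" and "c2 = 2 * (k (q z) * v1 z * v2 z)" and "c3 = k (q z) * (v2 z)\<^sup>2"
    have c: "\<bar>c1\<bar> \<le> \<epsilon>" "\<bar>c2\<bar> \<le> \<epsilon>" "\<bar>c3\<bar> \<le> \<epsilon>" using elim by (simp_all add: c1_def c2_def c3_def)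
    define A B C where "A = \<psi>xx z" and "B = \<psi>xy z" and "C = \<psi>yy z"
    define t where "t = \<beta>\<^sup>2 * A + C"
    have "t = c1 * A + c2 * B + c3 * C"
      using stream_equation[OF elim(4)] unfolding t_def c1_def c2_def c3_def A_def B_def C_def
      by (simp add: algebra_simps)
    then have "\<bar>t\<bar> \<le> \<bar>c1\<bar> * \<bar>A\<bar> + \<bar>c2\<bar> * \<bar>B\<bar> + \<bar>c3\<bar> * \<bar>C\<bar>"
      by (simp add: abs_mult[symmetric])
    also have "\<dots> \<le> \<epsilon> * \<bar>A\<bar> + \<epsilon> * \<bar>B\<bar> + \<epsilon> * \<bar>C\<bar>" using c by (intro add_mono mult_right_mono) auto
    finally have t: "\<bar>t\<bar> \<le> \<epsilon> * \<bar>A\<bar> + \<epsilon> * \<bar>B\<bar> + \<epsilon> * \<bar>C\<bar>" .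
    have "\<epsilon> * \<bar>A\<bar> = \<bar>t - C\<bar> / 200" using \<beta>(1) by (simp add: \<epsilon>_def t_def abs_mult)
    also have "\<dots> \<le> (\<bar>t\<bar> + \<bar>C\<bar>) / 200" by simp
    finally have A: "\<epsilon> * \<bar>A\<bar> \<le> (\<bar>t\<bar> + \<bar>C\<bar>) / 200" .
    have b2: "\<beta>\<^sup>2 \<le> \<beta>" using \<beta>(1,2) by (simp add: power2_eq_square mult_left_le)
    have arith: "T \<le> (b + c) / 50"
      if "T \<le> a1 + b1 + c1" "a1 \<le> (T + c) / 200" "b1 \<le> b / 200" "c1 \<le> c / 200" "0 \<le> b" "0 \<le> c"
      for T a1 b1 c1 b c :: real
      using that by argo
    have "\<epsilon> * \<bar>B\<bar> \<le> \<beta> / 200 * \<bar>B\<bar>" using b2 by (intro mult_right_mono) (simp_all add: \<epsilon>_def)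
    moreover have "\<epsilon> * \<bar>C\<bar> \<le> 1/200 * \<bar>C\<bar>" using b2 \<beta>(2) by (intro mult_right_mono) (simp_all add: \<epsilon>_def)
    ultimately have "\<bar>t\<bar> \<le> (\<beta> * \<bar>B\<bar> + \<bar>C\<bar>) / 50"
      using \<beta>(1) by (intro arith[OF t A]) simp_all
    then have "\<bar>t / \<beta>\<bar> \<le> 1/50 * (\<bar>B\<bar> + \<bar>C / \<beta>\<bar>)"
      using \<beta>(1) by (simp add: field_simps)
    then have "(t / \<beta>)\<^sup>2 \<le> (1/50 * (\<bar>B\<bar> + \<bar>C / \<beta>\<bar>))\<^sup>2"
      by (metis abs_ge_zero power2_abs power_mono)
    also have "\<dots> \<le> (1/50)\<^sup>2 * (2 * (B\<^sup>2 + (C / \<beta>)\<^sup>2))"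
    proof -
      have "(\<bar>B\<bar> + \<bar>C / \<beta>\<bar>)\<^sup>2 \<le> 2 * (B\<^sup>2 + (C / \<beta>)\<^sup>2)"
        using zero_le_power2[of "\<bar>B\<bar> - \<bar>C / \<beta>\<bar>"] unfolding power2_diff power2_sum power2_abs by argo
      then show ?thesis unfolding power_mult_distrib by (intro mult_left_mono) auto
    qed
    also have "\<dots> \<le> (1/20)\<^sup>2 * (B\<^sup>2 + (C / \<beta>)\<^sup>2)"
    proof -
      have "(1/50)\<^sup>2 * (2 * S) \<le> (1/20)\<^sup>2 * S" if "0 \<le> S" for S :: real
        using that by (simp add: power2_eq_square)
      from this[of "B\<^sup>2 + (C / \<beta>)\<^sup>2"] show ?thesis by (simp only: sum_power2_ge_zero)
    qed
    finally have "(t / \<beta>)\<^sup>2 \<le> (1/20)\<^sup>2 * (B\<^sup>2 + (C / \<beta>)\<^sup>2)" .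
    moreover have "t / \<beta> = \<beta> * A + C / \<beta>" using \<beta>(1) by (simp add: t_def add_divide_distrib power2_eq_square)
    ultimately show ?case by (simp add: A_def B_def C_def)
  qed
qed

lemma gradient_decay:
  "\<exists>C s1. \<forall>s\<ge>s1. circ (\<lambda>\<theta>. (\<psi>y (ell \<beta> s \<theta>) - flow_rate)\<^sup>2 + (\<beta> * \<psi>x (ell \<beta> s \<theta>))\<^sup>2) \<le> C * exp (- (7/5) * s)"
proof -
  have "\<forall>\<^sub>F z in at_infinity. \<bar>\<psi>y z - flow_rate\<bar> < 1"
    using tendstoD[OF gradient_lim(1), of 1] by (simp add: dist_real_def)
  then have "\<forall>\<^sub>F z in at_infinity. z \<in> \<Omega> \<and> \<bar>\<psi>y z - flow_rate\<bar> < 1 \<and>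
      (\<beta> * \<psi>xx z + \<psi>yy z / \<beta>)\<^sup>2 \<le> (1/20)\<^sup>2 * ((\<psi>xy z)\<^sup>2 + (\<psi>yy z / \<beta>)\<^sup>2)"
    using eventually_in asymptotically_conformal by eventually_elim blast
  from eventually_on_ellipses[OF this \<beta>(1,2), of 0]
  obtain s0 where s0: "\<And>s \<theta>. s > s0 \<Longrightarrow> ell \<beta> s \<theta> \<in> \<Omega>"
    "\<And>s \<theta>. s > s0 \<Longrightarrow> \<bar>\<psi>y (ell \<beta> s \<theta>) - flow_rate\<bar> < 1"
    "\<And>s \<theta>. s > s0 \<Longrightarrow> (\<beta> * \<psi>xx (ell \<beta> s \<theta>) + \<psi>yy (ell \<beta> s \<theta>) / \<beta>)\<^sup>2
       \<le> (1/20)\<^sup>2 * ((\<psi>xy (ell \<beta> s \<theta>))\<^sup>2 + (\<psi>yy (ell \<beta> s \<theta>) / \<beta>)\<^sup>2)" by blast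
  interpret nc: near_conformal \<Omega> \<beta> s0 "\<lambda>z. \<psi>y z + (- flow_rate)" "\<lambda>z. \<psi>xy z + 0" "\<lambda>z. \<psi>yy z + 0"
    "\<lambda>z. \<beta> * \<psi>xx z" "\<lambda>z. \<beta> * partial_x \<psi>xx z" "\<lambda>z. \<beta> * partial_y \<psi>xx z"
    "\<lambda>z. \<beta> * \<psi>xy z" "\<lambda>z. \<beta> * partial_x \<psi>xy z" "\<lambda>z. \<beta> * partial_y \<psi>xy z"
  proof unfold_locales
    show "C1_on \<Omega> (\<lambda>z. \<psi>y z + (- flow_rate)) (\<lambda>z. \<psi>xy z + 0) (\<lambda>z. \<psi>yy z + 0)"
      by (intro C1_on_add C1_on_const psi_C1)
  qed (use \<beta> s0 psi_C1(6) in \<open>auto intro!: C1_on_cmult psi_C1(4,5)\<close>)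
  define h where "h s = circ (\<lambda>\<theta>. (\<psi>y (ell \<beta> s \<theta>) - flow_rate)\<^sup>2 + (\<beta> * \<psi>x (ell \<beta> s \<theta>))\<^sup>2)" for s
  have h_eq: "h = (\<lambda>s. circ (\<lambda>\<theta>. (nc.F s \<theta>)\<^sup>2 + (\<beta> * \<psi>x (ell \<beta> s \<theta>))\<^sup>2))"
    unfolding h_def[abs_def] nc.F_def by simp
  have "(h \<longlongrightarrow> 0) at_top"
  proof (rule tendstoI)
    fix e :: real assume e: "e > 0"
    have "((\<lambda>z. (\<psi>y z - flow_rate)\<^sup>2 + (\<beta> * \<psi>x z)\<^sup>2) \<longlongrightarrow> (flow_rate - flow_rate)\<^sup>2 + (\<beta> * 0)\<^sup>2) at_infinity"
      by (intro tendsto_intros gradient_lim)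
    then have "\<forall>\<^sub>F z in at_infinity. (\<psi>y z - flow_rate)\<^sup>2 + (\<beta> * \<psi>x z)\<^sup>2 < e / 7"
      using e by (intro order_tendstoD(2)[of _ 0]) auto
    from eventually_on_ellipses[OF this \<beta>(1,2), of s0]
    obtain s2 where s2: "s2 \<ge> s0" "\<And>s \<theta>. s > s2 \<Longrightarrow> (\<psi>y (ell \<beta> s \<theta>) - flow_rate)\<^sup>2 + (\<beta> * \<psi>x (ell \<beta> s \<theta>))\<^sup>2 < e / 7" by blast
    have "dist (h s) 0 < e" if s: "s > s2" for s
    proof -
      have s': "s > s0" using s s2 by simp
      have c: "continuous_on {0..2 * pi} (\<lambda>\<theta>. (\<psi>y (ell \<beta> s \<theta>) - flow_rate)\<^sup>2 + (\<beta> * \<psi>x (ell \<beta> s \<theta>))\<^sup>2)"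
        by (intro continuous_intros nc.continuous_on_ellipse C1_onD(4)[OF psi_C1(2)] C1_onD(4)[OF psi_C1(3)] s')
      have "h s \<le> circ (\<lambda>\<theta>. e / 7)"
        unfolding h_def using s2(2)[OF s] by (intro circ_le c continuous_intros) (simp add: less_imp_le)
      also have "\<dots> = e * (2 * pi / 7)" by simp
      also have "\<dots> < e * 1" using e pi_less_4 pi_approx by (intro mult_strict_left_mono) auto
      finally have "h s < e" by simp
      moreover have "h s \<ge> 0" unfolding h_def using c by (intro integral_nonneg integrable_continuous_interval) auto
      ultimately show ?thesis by (simp add: dist_real_def)
    qed
    then show "\<forall>\<^sub>F s in at_top. dist (h s) 0 < e"
      by (rule eventually_mono[OF eventually_gt_at_top[of s2]])
  qed
  moreover have "C1_on \<Omega> (\<lambda>z. \<beta> * \<psi>x z) (\<lambda>z. \<beta> * \<psi>xx z) (\<lambda>z. \<beta> * \<psi>xy z)"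
    by (intro C1_on_cmult psi_C1)
  moreover have "\<bar>nc.F s \<theta>\<bar> \<le> 1" if "s > s0" for s \<theta>
    using s0(2)[OF that, of \<theta>] unfolding nc.F_def by simp
  ultimately have "\<exists>C. \<forall>s\<ge>s0 + 1. h s \<le> C * exp (- (7/5) * s)"
    unfolding h_eq by (intro nc.mean_square_decay[where M = 1]) auto
  then show ?thesis unfolding h_def by blast
qed

end

context density_law
begin

section \<open>The difference of two flows\<close>

lemma r_antimono:
  assumes "0 \<le> q" "q \<le> q'" "q' \<le> Qmax"
  shows "r q' \<le> r q"
proof (rule DERIV_nonpos_imp_nonincreasing[OF \<open>q \<le> q'\<close>])
  fix x assume "q \<le> x" "x \<le> q'"
  then have "x \<in> {0..Qmax}" using assms by auto
  then show "\<exists>y. (r has_real_derivative y) (at x) \<and> y \<le> 0"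
    using r_deriv[of x] k_nonneg[of x] r_pos[of x] by (intro exI[of _ "- (k x * r x / 2)"]) auto
qed

text \<open>
  Along the segment from \<open>b\<close> to \<open>a\<close> the derivative of the momentum is $r(I-k\,vv^T)$, whose eigenvalues are at least
  $(1-\mu)\,r$. The segment stays in the disk of admissible velocities, which is convex.
\<close>

lemma momentum_monotone:
  fixes a b :: complex
  assumes a: "(norm a)\<^sup>2 \<le> Qmax" and b: "(norm b)\<^sup>2 \<le> Qmax"
  defines "d \<equiv> a - b"
  shows "(r ((norm a)\<^sup>2) * Re a - r ((norm b)\<^sup>2) * Re b) * Re d + (r ((norm a)\<^sup>2) * Im a - r ((norm b)\<^sup>2) * Im b) * Im d
     \<ge> (1 - \<mu>) * r Qmax * (norm d)\<^sup>2"
proof -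
  define x where "x t = Re b + t * Re d" for t
  define y where "y t = Im b + t * Im d" for t
  define N where "N t = (x t)\<^sup>2 + (y t)\<^sup>2" for t
  define X where "X t = x t * Re d + y t * Im d" for t
  define \<phi> where "\<phi> t = r (N t) * X t" for t
  define \<phi>' where "\<phi>' t = r (N t) * ((norm d)\<^sup>2 - k (N t) * (X t)\<^sup>2)" for t
  have N_in: "N t \<in> {0..Qmax}" if "0 \<le> t" "t \<le> 1" for t
  proof -
    have ab: "norm a \<le> sqrt Qmax" "norm b \<le> sqrt Qmax" using a b by (auto intro: real_le_rsqrt)
    have "Complex (x t) (y t) = (1 - t) *\<^sub>R b + t *\<^sub>R a"
      by (simp add: complex_eq_iff x_def y_def d_def algebra_simps)
    then have "Complex (x t) (y t) \<in> cball 0 (sqrt Qmax)"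
      using convexD_alt[OF convex_cball, of b 0 "sqrt Qmax" a t] ab that by simp
    then have "(norm (Complex (x t) (y t)))\<^sup>2 \<le> (sqrt Qmax)\<^sup>2" by (intro power_mono) auto
    then show ?thesis using Qmax by (simp add: N_def cmod_power2)
  qed
  have deriv: "(\<phi> has_real_derivative \<phi>' t) (at t)" if "0 \<le> t" "t \<le> 1" for t
  proof -
    have "(N has_real_derivative 2 * X t) (at t)"
      unfolding N_def X_def x_def y_def by (auto intro!: derivative_eq_intros simp: algebra_simps)
    from DERIV_chain2[OF r_deriv[OF N_in[OF that]] this]
    have 1: "((\<lambda>t. r (N t)) has_real_derivative - (k (N t) * r (N t) / 2) * (2 * X t)) (at t)" .
    have 2: "(X has_real_derivative (norm d)\<^sup>2) (at t)"
      unfolding X_def x_def y_def cmod_power2 by (auto intro!: derivative_eq_intros simp: power2_eq_square)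
    show ?thesis unfolding \<phi>_def[abs_def]
      by (rule DERIV_cong[OF DERIV_mult[OF 1 2]]) (simp add: \<phi>'_def power2_eq_square algebra_simps)
  qed
  have "\<exists>t>0. t < 1 \<and> \<phi> 1 - \<phi> 0 = (1 - 0) * \<phi>' t"
    by (rule MVT2) (use deriv in auto)
  then obtain t where t: "0 < t" "t < 1" "\<phi> 1 - \<phi> 0 = \<phi>' t" by auto
  have Nt: "N t \<in> {0..Qmax}" using N_in t by simp
  have "(X t)\<^sup>2 + (x t * Im d - y t * Re d)\<^sup>2 = N t * (norm d)\<^sup>2"
    unfolding X_def N_def cmod_power2 by algebra
  then have "(X t)\<^sup>2 \<le> N t * (norm d)\<^sup>2" using zero_le_power2[of "x t * Im d - y t * Re d"] by linarith
  then have "k (N t) * (X t)\<^sup>2 \<le> k (N t) * (N t * (norm d)\<^sup>2)" using k_nonneg[OF Nt] by (intro mult_left_mono) auto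
  also have "\<dots> = (N t * k (N t)) * (norm d)\<^sup>2" by simp
  also have "\<dots> \<le> \<mu> * (norm d)\<^sup>2" using subsonic[OF Nt] by (intro mult_right_mono) auto
  finally have 1: "(norm d)\<^sup>2 - k (N t) * (X t)\<^sup>2 \<ge> (1 - \<mu>) * (norm d)\<^sup>2" by (simp add: algebra_simps)
  have "r Qmax * ((1 - \<mu>) * (norm d)\<^sup>2) \<le> r (N t) * ((norm d)\<^sup>2 - k (N t) * (X t)\<^sup>2)"
    using r_antimono[of "N t" Qmax] Nt 1 \<mu> r_pos[OF Nt] by (intro mult_mono) auto
  then have "(1 - \<mu>) * r Qmax * (norm d)\<^sup>2 \<le> \<phi> 1 - \<phi> 0" using t(3) by (simp add: \<phi>'_def mult_ac)
  moreover have "N 1 = (norm a)\<^sup>2" "N 0 = (norm b)\<^sup>2"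
    unfolding N_def x_def y_def cmod_power2 by (simp_all add: d_def)
  moreover have "X 1 = Re a * Re d + Im a * Im d" "X 0 = Re b * Re d + Im b * Im d"
    by (simp_all add: X_def x_def y_def d_def)
  ultimately show ?thesis by (simp add: \<phi>_def algebra_simps)
qed

lemma speed_diff_le:
  fixes a b :: complex
  assumes a: "(norm a)\<^sup>2 \<le> Qmax" and b: "(norm b)\<^sup>2 \<le> Qmax"
  shows "(1 - \<mu>) * r Qmax * norm (a - b) \<le>
     \<bar>r ((norm a)\<^sup>2) * Re a - r ((norm b)\<^sup>2) * Re b\<bar> + \<bar>r ((norm a)\<^sup>2) * Im a - r ((norm b)\<^sup>2) * Im b\<bar>"
proof (cases "a = b")
  case False
  define M1 where "M1 = r ((norm a)\<^sup>2) * Re a - r ((norm b)\<^sup>2) * Re b"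
  define M2 where "M2 = r ((norm a)\<^sup>2) * Im a - r ((norm b)\<^sup>2) * Im b"
  define N where "N = norm (a - b)"
  have "(1 - \<mu>) * r Qmax * N\<^sup>2 \<le> M1 * Re (a - b) + M2 * Im (a - b)"
    using momentum_monotone[OF a b] by (simp add: M1_def M2_def N_def)
  also have "\<dots> \<le> \<bar>M1\<bar> * \<bar>Re (a - b)\<bar> + \<bar>M2\<bar> * \<bar>Im (a - b)\<bar>"
    unfolding abs_mult[symmetric] by (intro add_mono) auto
  also have "\<dots> \<le> \<bar>M1\<bar> * N + \<bar>M2\<bar> * N"
    using abs_Re_le_cmod[of "a - b"] abs_Im_le_cmod[of "a - b"] unfolding N_def by (intro add_mono mult_left_mono) auto
  finally have "((1 - \<mu>) * r Qmax * N) * N \<le> (\<bar>M1\<bar> + \<bar>M2\<bar>) * N" by (simp add: power2_eq_square algebra_simps)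
  moreover have "N > 0" using False by (simp add: N_def)
  ultimately show ?thesis unfolding M1_def M2_def N_def by simp
qed simp

lemma coefficient_diff_le:
  obtains C where "C \<ge> 0" and "\<And>a b :: complex. (norm a)\<^sup>2 \<le> Qmax \<Longrightarrow> (norm b)\<^sup>2 \<le> Qmax \<Longrightarrow>
     (let ka = k ((norm a)\<^sup>2); kb = k ((norm b)\<^sup>2) in
      \<bar>ka * (Re a)\<^sup>2 - kb * (Re b)\<^sup>2\<bar> \<le> C * norm (a - b) \<and>
      \<bar>ka * (Re a * Im a) - kb * (Re b * Im b)\<bar> \<le> C * norm (a - b) \<and>
      \<bar>ka * (Im a)\<^sup>2 - kb * (Im b)\<^sup>2\<bar> \<le> C * norm (a - b))"
proof -
  define V where "V = sqrt Qmax"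
  define kM where "kM = k 0 + \<bar>L\<bar> * Qmax"
  define C where "C = \<bar>L\<bar> * (2 * V) * V\<^sup>2 + kM * (2 * V)"
  have V: "V \<ge> 0" using Qmax by (simp add: V_def)
  have kM: "k q \<le> kM" if "q \<in> {0..Qmax}" for q
  proof -
    have "k q - k 0 \<le> L * \<bar>q - 0\<bar>" using k_lip[of q 0] that Qmax by auto
    also have "\<dots> \<le> \<bar>L\<bar> * Qmax" using that by (intro mult_mono) auto
    finally show ?thesis by (simp add: kM_def)
  qed
  have kM0: "kM \<ge> 0" using kM[of 0] k_nonneg[of 0] Qmax by auto
  have C: "C \<ge> 0" using V kM0 by (simp add: C_def)
  have main: "\<bar>ka * (x * y) - kb * (x' * y')\<bar> \<le> C * N"
    if a: "(norm a)\<^sup>2 \<le> Qmax" and b: "(norm b)\<^sup>2 \<le> Qmax" and k: "ka = k ((norm a)\<^sup>2)" "kb = k ((norm b)\<^sup>2)"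
     and N: "N = norm (a - b)"
     and x: "\<bar>x\<bar> \<le> norm a" "\<bar>y\<bar> \<le> norm a" "\<bar>x'\<bar> \<le> norm b" "\<bar>y'\<bar> \<le> norm b"
     and d: "\<bar>x - x'\<bar> \<le> N" "\<bar>y - y'\<bar> \<le> N" for a b :: complex and ka kb x y x' y' N
  proof -
    have n: "norm a \<le> V" "norm b \<le> V" using a b by (auto simp: V_def intro: real_le_rsqrt)
    have N0: "N \<ge> 0" by (simp add: N)
    have "\<bar>(norm a)\<^sup>2 - (norm b)\<^sup>2\<bar> = (norm a + norm b) * \<bar>norm a - norm b\<bar>"
      by (simp add: square_diff_square_factored power2_eq_square abs_mult)
    also have "\<dots> \<le> (2 * V) * N" using n norm_triangle_ineq3[of a b] V unfolding N by (intro mult_mono) auto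
    finally have q: "\<bar>(norm a)\<^sup>2 - (norm b)\<^sup>2\<bar> \<le> 2 * V * N" .
    have "\<bar>ka - kb\<bar> \<le> L * \<bar>(norm a)\<^sup>2 - (norm b)\<^sup>2\<bar>" unfolding k using a b by (intro k_lip) auto
    also have "\<dots> \<le> \<bar>L\<bar> * (2 * V * N)" using q by (intro mult_mono) auto
    finally have kk: "\<bar>ka - kb\<bar> \<le> \<bar>L\<bar> * (2 * V * N)" .
    have kb: "\<bar>kb\<bar> \<le> kM" using kM[of "(norm b)\<^sup>2"] k_nonneg[of "(norm b)\<^sup>2"] b by (simp add: k)
    have xy: "\<bar>x\<bar> \<le> V" "\<bar>y\<bar> \<le> V" "\<bar>y'\<bar> \<le> V" using x n by auto
    have "ka * (x * y) - kb * (x' * y') = (ka - kb) * (x * y) + kb * (x * (y - y') + (x - x') * y')" by algebra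
    also have "\<bar>\<dots>\<bar> \<le> \<bar>ka - kb\<bar> * (\<bar>x\<bar> * \<bar>y\<bar>) + \<bar>kb\<bar> * (\<bar>x\<bar> * \<bar>y - y'\<bar> + \<bar>x - x'\<bar> * \<bar>y'\<bar>)"
      unfolding abs_mult[symmetric]
      by (rule order_trans[OF abs_triangle_ineq]) (auto simp: abs_mult intro!: mult_left_mono order_trans[OF abs_triangle_ineq])
    also have "\<dots> \<le> (\<bar>L\<bar> * (2 * V * N)) * (V * V) + kM * (V * N + N * V)"
    proof (intro add_mono)
      have "\<bar>x\<bar> * \<bar>y\<bar> \<le> V * V" using xy V by (intro mult_mono) simp_all
      then show "\<bar>ka - kb\<bar> * (\<bar>x\<bar> * \<bar>y\<bar>) \<le> (\<bar>L\<bar> * (2 * V * N)) * (V * V)"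
        using kk V N0 by - (rule mult_mono; simp)
      have "\<bar>x\<bar> * \<bar>y - y'\<bar> \<le> V * N" "\<bar>x - x'\<bar> * \<bar>y'\<bar> \<le> N * V"
        using xy d V N0 by (auto intro!: mult_mono)
      then have "\<bar>x\<bar> * \<bar>y - y'\<bar> + \<bar>x - x'\<bar> * \<bar>y'\<bar> \<le> V * N + N * V" by (rule add_mono)
      from mult_mono[OF kb this kM0]
      show "\<bar>kb\<bar> * (\<bar>x\<bar> * \<bar>y - y'\<bar> + \<bar>x - x'\<bar> * \<bar>y'\<bar>) \<le> kM * (V * N + N * V)"
        by simp
    qed
    also have "\<dots> = C * N" by (simp add: C_def power2_eq_square algebra_simps)
    finally show ?thesis .
  qed
  show ?thesis
  proof (rule that[OF C])
    fix a b :: complex assume a: "(norm a)\<^sup>2 \<le> Qmax" and b: "(norm b)\<^sup>2 \<le> Qmax"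
    have d: "\<bar>Re a - Re b\<bar> \<le> norm (a - b)" "\<bar>Im a - Im b\<bar> \<le> norm (a - b)"
      using abs_Re_le_cmod[of "a - b"] abs_Im_le_cmod[of "a - b"] by simp_all
    show "let ka = k ((norm a)\<^sup>2); kb = k ((norm b)\<^sup>2) in
      \<bar>ka * (Re a)\<^sup>2 - kb * (Re b)\<^sup>2\<bar> \<le> C * norm (a - b) \<and>
      \<bar>ka * (Re a * Im a) - kb * (Re b * Im b)\<bar> \<le> C * norm (a - b) \<and>
      \<bar>ka * (Im a)\<^sup>2 - kb * (Im b)\<^sup>2\<bar> \<le> C * norm (a - b)"
      unfolding Let_def power2_eq_square[of "Re a"] power2_eq_square[of "Re b"] power2_eq_square[of "Im a"] power2_eq_square[of "Im b"]
      by (intro conjI main[OF a b refl refl refl] d abs_Re_le_cmod abs_Im_le_cmod)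
  qed
qed

end

text \<open>
  Two flows with the same density law and the same velocity at infinity.
\<close>

locale flow_pair = A: planar_flow r k Qmax \<mu> L \<Omega> \<psi> v u + B: planar_flow r k Qmax \<mu> L \<Omega> \<psi>' v' u
  for r k Qmax \<mu> L \<Omega> \<psi> v u \<psi>' v'
begin

definition "W z = \<psi> z - \<psi>' z"
definition "Wx z = A.\<psi>x z - B.\<psi>x z"
definition "Wy z = A.\<psi>y z - B.\<psi>y z"
definition "Wxx z = A.\<psi>xx z - B.\<psi>xx z"
definition "Wxy z = A.\<psi>xy z - B.\<psi>xy z"
definition "Wyy z = A.\<psi>yy z - B.\<psi>yy z"

lemma W_C2: "C2_on \<Omega> W Wx Wy Wxx Wxy Wyy"
  unfolding W_def[abs_def] Wx_def[abs_def] Wy_def[abs_def] Wxx_def[abs_def] Wxy_def[abs_def] Wyy_def[abs_def]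
  using C2_on_add[OF A.psi_C2 C2_on_cmult[OF B.psi_C2, of "-1"]] by simp

lemma velocity_diff_le:
  assumes "z \<in> \<Omega>"
  shows "(1 - \<mu>) * r Qmax * norm (v z - v' z) \<le> \<bar>Wx z\<bar> + \<bar>Wy z\<bar>"
  using A.speed_diff_le[OF A.speed B.speed, OF assms assms]
  unfolding A.momentum_components[OF assms] B.momentum_components[OF assms] Wx_def Wy_def by simp

text \<open>
  Subtracting the two equations leaves the coefficient difference times the Hessian of \<open>\<psi>'\<close>. The coefficients are Lipschitz in
  the velocity, and the velocity difference is controlled by the gradient of \<open>W\<close>, so this is a first order term; it is
  bounded on compact sets only.
\<close>

lemma W_elliptic:
  assumes K: "compact K" "K \<subseteq> \<Omega>"
  shows "\<exists>C. \<forall>z\<in>K. \<exists>n. (norm n)\<^sup>2 \<le> \<mu> \<and> \<bar>elliptic_op n (Wxx z) (Wxy z) (Wyy z)\<bar> \<le> C * (\<bar>Wx z\<bar> + \<bar>Wy z\<bar>)"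
proof -
  obtain C where C: "C \<ge> 0" and coef: "\<And>a b :: complex. (norm a)\<^sup>2 \<le> Qmax \<Longrightarrow> (norm b)\<^sup>2 \<le> Qmax \<Longrightarrow>
     (let ka = k ((norm a)\<^sup>2); kb = k ((norm b)\<^sup>2) in
      \<bar>ka * (Re a)\<^sup>2 - kb * (Re b)\<^sup>2\<bar> \<le> C * norm (a - b) \<and>
      \<bar>ka * (Re a * Im a) - kb * (Re b * Im b)\<bar> \<le> C * norm (a - b) \<and>
      \<bar>ka * (Im a)\<^sup>2 - kb * (Im b)\<^sup>2\<bar> \<le> C * norm (a - b))"
    using A.coefficient_diff_le by metis
  define H where "H z = \<bar>B.\<psi>xx z\<bar> + 2 * \<bar>B.\<psi>xy z\<bar> + \<bar>B.\<psi>yy z\<bar>" for z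
  have "continuous_on K H"
    unfolding H_def
    by (intro continuous_intros continuous_on_subset[OF _ K(2)] C1_onD(2,3)[OF B.psi_C1(2)] C1_onD(2,3)[OF B.psi_C1(3)])
  then have "bounded (H ` K)" using compact_continuous_image[OF _ K(1)] compact_imp_bounded by blast
  then obtain M where M: "\<And>z. z \<in> K \<Longrightarrow> \<bar>H z\<bar> \<le> M" unfolding bounded_iff by auto
  define \<kappa> where "\<kappa> = (1 - \<mu>) * r Qmax"
  have \<kappa>: "\<kappa> > 0" using A.\<mu> A.r_pos[of Qmax] A.Qmax by (simp add: \<kappa>_def)
  have "(norm (A.n z))\<^sup>2 \<le> \<mu> \<and> \<bar>elliptic_op (A.n z) (Wxx z) (Wxy z) (Wyy z)\<bar> \<le> (C * M / \<kappa>) * (\<bar>Wx z\<bar> + \<bar>Wy z\<bar>)" if "z \<in> K" for z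
  proof
    have z: "z \<in> \<Omega>" using that K by auto
    show "(norm (A.n z))\<^sup>2 \<le> \<mu>" by (rule A.norm_n[OF z])
    define \<delta> where "\<delta> = C * norm (v z - v' z)"
    define e1 where "e1 = k ((norm (v z))\<^sup>2) * (Re (v z))\<^sup>2 - k ((norm (v' z))\<^sup>2) * (Re (v' z))\<^sup>2"
    define e2 where "e2 = k ((norm (v z))\<^sup>2) * (Re (v z) * Im (v z)) - k ((norm (v' z))\<^sup>2) * (Re (v' z) * Im (v' z))"
    define e3 where "e3 = k ((norm (v z))\<^sup>2) * (Im (v z))\<^sup>2 - k ((norm (v' z))\<^sup>2) * (Im (v' z))\<^sup>2"
    have e: "\<bar>e1\<bar> \<le> \<delta>" "\<bar>e2\<bar> \<le> \<delta>" "\<bar>e3\<bar> \<le> \<delta>"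
      using coef[OF A.speed[OF z] B.speed[OF z]] unfolding Let_def e1_def e2_def e3_def \<delta>_def by auto
    have "elliptic_op (A.n z) (Wxx z) (Wxy z) (Wyy z) = elliptic_op (A.n z) (A.\<psi>xx z) (A.\<psi>xy z) (A.\<psi>yy z) - elliptic_op (A.n z) (B.\<psi>xx z) (B.\<psi>xy z) (B.\<psi>yy z)"
      by (simp add: elliptic_op_def Wxx_def Wxy_def Wyy_def algebra_simps)
    also have "\<dots> = elliptic_op (B.n z) (B.\<psi>xx z) (B.\<psi>xy z) (B.\<psi>yy z) - elliptic_op (A.n z) (B.\<psi>xx z) (B.\<psi>xy z) (B.\<psi>yy z)"
      using A.stream_elliptic[OF z] B.stream_elliptic[OF z] by simp
    also have "\<dots> = e1 * B.\<psi>xx z + e2 * (2 * B.\<psi>xy z) + e3 * B.\<psi>yy z"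
      unfolding A.elliptic_op_n[OF z] B.elliptic_op_n[OF z] e1_def e2_def e3_def by (simp add: algebra_simps)
    also have "\<bar>\<dots>\<bar> \<le> \<bar>e1\<bar> * \<bar>B.\<psi>xx z\<bar> + \<bar>e2\<bar> * \<bar>2 * B.\<psi>xy z\<bar> + \<bar>e3\<bar> * \<bar>B.\<psi>yy z\<bar>"
      unfolding abs_mult[symmetric] by (intro order_trans[OF abs_triangle_ineq] add_mono) auto
    also have "\<dots> \<le> \<delta> * \<bar>B.\<psi>xx z\<bar> + \<delta> * \<bar>2 * B.\<psi>xy z\<bar> + \<delta> * \<bar>B.\<psi>yy z\<bar>"
      using e by (intro add_mono mult_right_mono) auto
    also have "\<dots> = \<delta> * H z" by (simp add: H_def abs_mult algebra_simps)
    also have "\<dots> \<le> \<delta> * M" using M[OF that] C by (intro mult_left_mono) (auto simp: \<delta>_def)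
    also have "\<dots> = C * M / \<kappa> * (\<kappa> * norm (v z - v' z))" using \<kappa> by (simp add: \<delta>_def)
    also have "\<dots> \<le> C * M / \<kappa> * (\<bar>Wx z\<bar> + \<bar>Wy z\<bar>)"
      using velocity_diff_le[OF z] C \<kappa> M[OF that] unfolding \<kappa>_def[symmetric] by (intro mult_left_mono divide_nonneg_nonneg mult_nonneg_nonneg) auto
    finally show "\<bar>elliptic_op (A.n z) (Wxx z) (Wxy z) (Wyy z)\<bar> \<le> (C * M / \<kappa>) * (\<bar>Wx z\<bar> + \<bar>Wy z\<bar>)" .
  qed
  then show ?thesis by blast
qed

end

lemma (in density_law) r_mean_value:
  assumes "q \<in> {0..Qmax}" "q' \<in> {0..Qmax}"
  shows "\<exists>x\<in>{min q q'..max q q'}. r q - r q' = - (k x * r x / 2) * (q - q')"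
proof (cases "q = q'")
  case False
  have *: "\<exists>x\<in>{a..b}. r b - r a = - (k x * r x / 2) * (b - a)"
    if "a < b" "a \<in> {0..Qmax}" "b \<in> {0..Qmax}" for a b
  proof -
    have "\<exists>x>a. x < b \<and> r b - r a = (b - a) * - (k x * r x / 2)"
      using that by (intro MVT2 r_deriv) auto
    then show ?thesis by (metis atLeastAtMost_iff less_imp_le mult.commute)
  qed
  show ?thesis
  proof (cases "q < q'")
    case True
    then obtain x where "x \<in> {q..q'}" "r q' - r q = - (k x * r x / 2) * (q' - q)" using *[of q q'] assms by auto
    then have "r q - r q' = - (k x * r x / 2) * (q - q')" by argo
    then show ?thesis using True \<open>x \<in> {q..q'}\<close> by (intro bexI[of _ x]) auto
  next
    case False
    then obtain x where "x \<in> {q'..q}" "r q - r q' = - (k x * r x / 2) * (q - q')" using *[of q' q] assms \<open>q \<noteq> q'\<close> by auto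
    then show ?thesis using False by (intro bexI[of _ x]) auto
  qed
qed auto

context flow_pair
begin

text \<open>
  The momentum difference is, to first order in $v-v'$, the derivative of the momentum at the limit velocity $(u,0)$ applied
  to $v-v'$. That derivative is diagonal, with entries $r\beta^2$ and $r$.
\<close>

lemma momentum_diff_at_infinity:
  assumes "\<epsilon> > 0"
  shows "\<forall>\<^sub>F z in at_infinity.
     \<bar>Wy z - r (u\<^sup>2) * A.\<beta>\<^sup>2 * (Re (v z) - Re (v' z))\<bar> \<le> \<epsilon> * norm (v z - v' z) \<and>
     \<bar>Wx z + r (u\<^sup>2) * (Im (v z) - Im (v' z))\<bar> \<le> \<epsilon> * norm (v z - v' z)"
proof -
  define g where "g x = - (k x * r x / 2)" for x
  have gc: "continuous_on {0..Qmax} g"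
    unfolding g_def by (intro continuous_intros A.k_continuous A.r_continuous) simp
  have "\<forall>z\<in>\<Omega>. \<exists>x. x \<in> {min (A.q z) (B.q z)..max (A.q z) (B.q z)} \<and> r (A.q z) - r (B.q z) = g x * (A.q z - B.q z)"
    unfolding g_def using A.r_mean_value[OF A.q_in B.q_in] by blast
  then obtain \<xi> where \<xi>: "\<And>z. z \<in> \<Omega> \<Longrightarrow> \<xi> z \<in> {min (A.q z) (B.q z)..max (A.q z) (B.q z)}"
      "\<And>z. z \<in> \<Omega> \<Longrightarrow> r (A.q z) - r (B.q z) = g (\<xi> z) * (A.q z - B.q z)"
    unfolding bchoice_iff by blast
  have \<xi>_lim: "(\<xi> \<longlongrightarrow> u\<^sup>2) at_infinity"
  proof (rule tendsto_sandwich)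
    show "((\<lambda>z. min (A.q z) (B.q z)) \<longlongrightarrow> u\<^sup>2) at_infinity"
      using tendsto_min[OF A.q_lim B.q_lim] by simp
    show "((\<lambda>z. max (A.q z) (B.q z)) \<longlongrightarrow> u\<^sup>2) at_infinity"
      using tendsto_max[OF A.q_lim B.q_lim] by simp
    show "\<forall>\<^sub>F z in at_infinity. min (A.q z) (B.q z) \<le> \<xi> z" "\<forall>\<^sub>F z in at_infinity. \<xi> z \<le> max (A.q z) (B.q z)"
      using A.eventually_in \<xi>(1) by (auto elim!: eventually_mono simp del: min_le_iff_disj le_max_iff_disj)
  qed
  have g_lim: "((\<lambda>z. g (\<xi> z)) \<longlongrightarrow> g (u\<^sup>2)) at_infinity"
  proof (rule continuous_on_tendsto_compose[OF gc \<xi>_lim A.u_in])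
    show "\<forall>\<^sub>F z in at_infinity. \<xi> z \<in> {0..Qmax}"
      using A.eventually_in
    proof eventually_elim
      case (elim z)
      have "0 \<le> min (A.q z) (B.q z)" "max (A.q z) (B.q z) \<le> Qmax"
        using A.speed[OF elim] B.speed[OF elim] by simp_all
      moreover have "min (A.q z) (B.q z) \<le> \<xi> z" "\<xi> z \<le> max (A.q z) (B.q z)"
        using \<xi>(1)[OF elim] by (simp_all only: atLeastAtMost_iff)
      ultimately show ?case unfolding atLeastAtMost_iff by (blast intro: order_trans)
    qed
  qed
  note lims = g_lim A.comp_q_lim[OF A.r_continuous] tendsto_Re[OF A.v_lim] tendsto_Re[OF B.v_lim] tendsto_Im[OF A.v_lim] tendsto_Im[OF B.v_lim]
  define c1 where "c1 z = r (A.q z) + g (\<xi> z) * (A.v1 z + B.v1 z) * B.v1 z - r (u\<^sup>2) * A.\<beta>\<^sup>2" for z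
  define c2 where "c2 z = g (\<xi> z) * (A.v2 z + B.v2 z) * B.v1 z" for z
  define c3 where "c3 z = - (g (\<xi> z) * (A.v1 z + B.v1 z) * B.v2 z)" for z
  define c4 where "c4 z = r (u\<^sup>2) - r (A.q z) - g (\<xi> z) * (A.v2 z + B.v2 z) * B.v2 z" for z
  have small: "\<forall>\<^sub>F z in at_infinity. \<bar>c z\<bar> < \<epsilon> / 2" if "(c \<longlongrightarrow> 0) at_infinity" for c :: "complex \<Rightarrow> real"
    using tendstoD[OF that, of "\<epsilon>/2"] assms unfolding dist_real_def diff_0_right by simp
  have "(c1 \<longlongrightarrow> r (u\<^sup>2) + g (u\<^sup>2) * (Re (Complex u 0) + Re (Complex u 0)) * Re (Complex u 0) - r (u\<^sup>2) * A.\<beta>\<^sup>2) at_infinity"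
    unfolding c1_def by (intro tendsto_intros lims)
  moreover have "r (u\<^sup>2) + g (u\<^sup>2) * (Re (Complex u 0) + Re (Complex u 0)) * Re (Complex u 0) - r (u\<^sup>2) * A.\<beta>\<^sup>2 = 0"
    unfolding A.\<beta>(3) g_def by (simp add: power2_eq_square algebra_simps)
  ultimately have 1: "\<forall>\<^sub>F z in at_infinity. \<bar>c1 z\<bar> < \<epsilon> / 2" using small by simp
  have "(c2 \<longlongrightarrow> g (u\<^sup>2) * (Im (Complex u 0) + Im (Complex u 0)) * Re (Complex u 0)) at_infinity"
    unfolding c2_def by (intro tendsto_intros lims)
  then have 2: "\<forall>\<^sub>F z in at_infinity. \<bar>c2 z\<bar> < \<epsilon> / 2" using small by simp
  have "(c3 \<longlongrightarrow> - (g (u\<^sup>2) * (Re (Complex u 0) + Re (Complex u 0)) * Im (Complex u 0))) at_infinity"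
    unfolding c3_def by (intro tendsto_intros lims)
  then have 3: "\<forall>\<^sub>F z in at_infinity. \<bar>c3 z\<bar> < \<epsilon> / 2" using small by simp
  have "(c4 \<longlongrightarrow> r (u\<^sup>2) - r (u\<^sup>2) - g (u\<^sup>2) * (Im (Complex u 0) + Im (Complex u 0)) * Im (Complex u 0)) at_infinity"
    unfolding c4_def by (intro tendsto_intros lims)
  then have 4: "\<forall>\<^sub>F z in at_infinity. \<bar>c4 z\<bar> < \<epsilon> / 2" using small by simp
  show ?thesis
    using 1 2 3 4 A.eventually_in
  proof eventually_elim
    case (elim z)
    define D1 D2 N where "D1 = A.v1 z - B.v1 z" and "D2 = A.v2 z - B.v2 z" and "N = norm (v z - v' z)"
    have D: "\<bar>D1\<bar> \<le> N" "\<bar>D2\<bar> \<le> N"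
      using abs_Re_le_cmod[of "v z - v' z"] abs_Im_le_cmod[of "v z - v' z"] by (simp_all add: D1_def D2_def N_def)
    have q: "A.q z - B.q z = (A.v1 z + B.v1 z) * D1 + (A.v2 z + B.v2 z) * D2"
      unfolding cmod_power2 D1_def D2_def by algebra
    note m = A.momentum_components[OF elim(5)] B.momentum_components[OF elim(5)]
    have "Wy z = r (A.q z) * D1 + (r (A.q z) - r (B.q z)) * B.v1 z"
      unfolding Wy_def m(1,3)[symmetric] D1_def by (simp add: algebra_simps)
    then have Wy: "Wy z - r (u\<^sup>2) * A.\<beta>\<^sup>2 * D1 = c1 z * D1 + c2 z * D2"
      unfolding \<xi>(2)[OF elim(5)] q c1_def c2_def by (simp add: algebra_simps)
    have "- Wx z = r (A.q z) * D2 + (r (A.q z) - r (B.q z)) * B.v2 z"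
      using m(2,4) unfolding Wx_def D2_def by (simp add: algebra_simps)
    then have Wx: "Wx z + r (u\<^sup>2) * D2 = c3 z * D1 + c4 z * D2"
      unfolding \<xi>(2)[OF elim(5)] q c3_def c4_def by (simp add: algebra_simps)
    have bound: "\<bar>a * D1 + b * D2\<bar> \<le> \<epsilon> * N" if "\<bar>a\<bar> < \<epsilon> / 2" "\<bar>b\<bar> < \<epsilon> / 2" for a b
    proof -
      have "\<bar>a * D1 + b * D2\<bar> \<le> \<bar>a\<bar> * \<bar>D1\<bar> + \<bar>b\<bar> * \<bar>D2\<bar>" unfolding abs_mult[symmetric] by (rule abs_triangle_ineq)
      also have "\<dots> \<le> \<epsilon> / 2 * N + \<epsilon> / 2 * N"
      proof (rule add_mono)
        show "\<bar>a\<bar> * \<bar>D1\<bar> \<le> \<epsilon> / 2 * N" using that(1) D(1) assms by - (rule mult_mono; simp)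
        show "\<bar>b\<bar> * \<bar>D2\<bar> \<le> \<epsilon> / 2 * N" using that(2) D(2) assms by - (rule mult_mono; simp)
      qed
      finally show ?thesis by (simp add: mult.commute)
    qed
    show ?case
      using bound[OF elim(1,2)] bound[OF elim(3,4)] Wx Wy unfolding D1_def D2_def N_def by simp
  qed
qed

text \<open>
  The 1-form paired with \<open>W\<close> is $-r\beta\,(v-v')\cdot dz$. It is closed but has a period whenever the circulations differ.
\<close>

lemma W_asymptotically_conformal:
  "\<forall>\<^sub>F z in at_infinity.
     (- r (u\<^sup>2) * A.\<beta> * (Im (v z) - Im (v' z)) / A.\<beta> - Wx z)\<^sup>2 + (- r (u\<^sup>2) * A.\<beta> * (Re (v z) - Re (v' z)) + Wy z / A.\<beta>)\<^sup>2
      \<le> (1/20)\<^sup>2 * ((Wx z)\<^sup>2 + (Wy z / A.\<beta>)\<^sup>2)"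
proof -
  define R where "R = r (u\<^sup>2)"
  define \<beta> where "\<beta> = A.\<beta>"
  have R: "R > 0" using A.r_pos[OF A.u_in] by (simp add: R_def)
  have \<beta>: "0 < \<beta>" "\<beta> \<le> 1" using A.\<beta> by (simp_all add: \<beta>_def)
  define \<epsilon> where "\<epsilon> = R * \<beta>\<^sup>2 / 50"
  have "\<epsilon> > 0" using R \<beta> by (simp add: \<epsilon>_def)
  from momentum_diff_at_infinity[OF this]
  show ?thesis
    unfolding R_def[symmetric] \<beta>_def[symmetric]
  proof eventually_elim
    case (elim z)
    define D1 D2 N where "D1 = Re (v z) - Re (v' z)" and "D2 = Im (v z) - Im (v' z)" and "N = norm (v z - v' z)"
    define X Y where "X = Wx z" and "Y = Wy z / \<beta>"
    define e1 where "e1 = Y - R * \<beta> * D1"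
    define e2 where "e2 = X + R * D2"
    define E where "E = e1\<^sup>2 + e2\<^sup>2"
    define M where "M = (R * \<beta> * N)\<^sup>2"
    have N: "N\<^sup>2 = D1\<^sup>2 + D2\<^sup>2" by (simp add: N_def D1_def D2_def cmod_power2)
    have "\<bar>Wy z - R * \<beta>\<^sup>2 * D1\<bar> \<le> \<epsilon> * N" and w2: "\<bar>e2\<bar> \<le> \<epsilon> * N"
      using elim by (simp_all add: D1_def D2_def N_def e2_def X_def)
    moreover have "Wy z - R * \<beta>\<^sup>2 * D1 = \<beta> * e1" using \<beta> by (simp add: e1_def Y_def power2_eq_square algebra_simps)
    ultimately have "\<beta> * \<bar>e1\<bar> \<le> \<epsilon> * N" using \<beta> by (simp add: abs_mult)
    moreover have \<epsilon>N: "\<epsilon> * N = \<beta> * (R * \<beta> * N / 50)" by (simp add: \<epsilon>_def power2_eq_square)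
    ultimately have 1: "\<bar>e1\<bar> \<le> R * \<beta> * N / 50" using \<beta> by simp
    have "\<beta> * (R * \<beta> * N / 50) \<le> 1 * (R * \<beta> * N / 50)" using \<beta> R by (intro mult_right_mono) (auto simp: N_def)
    then have 2: "\<bar>e2\<bar> \<le> R * \<beta> * N / 50" using w2 \<epsilon>N by simp
    have sq: "x\<^sup>2 \<le> M / 2500" if "\<bar>x\<bar> \<le> R * \<beta> * N / 50" for x
      using power_mono[OF that, of 2] by (simp add: M_def power_divide power_mult_distrib)
    have E: "E \<le> M / 1250" using sq[OF 1] sq[OF 2] by (simp add: E_def)
    have "M \<le> 2 * (X\<^sup>2 + Y\<^sup>2) + 2 * E"
    proof -
      have "\<beta>\<^sup>2 \<le> 1" using \<beta> by (simp add: power_le_one)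
      then have "\<beta>\<^sup>2 * (R * D2)\<^sup>2 \<le> 1 * (R * D2)\<^sup>2" by (intro mult_right_mono) auto
      moreover have "M = \<beta>\<^sup>2 * (R * D2)\<^sup>2 + (R * \<beta> * D1)\<^sup>2" by (simp add: M_def N power_mult_distrib algebra_simps)
      ultimately have "M \<le> (R * D2)\<^sup>2 + (R * \<beta> * D1)\<^sup>2" by simp
      also have "\<dots> = (e2 - X)\<^sup>2 + (Y - e1)\<^sup>2" by (simp add: e1_def e2_def)
      also have "\<dots> \<le> 2 * (X\<^sup>2 + Y\<^sup>2) + 2 * E"
      proof -
        have "0 \<le> (e2 + X)\<^sup>2 + (Y + e1)\<^sup>2" by simp
        also have "\<dots> = 2 * (X\<^sup>2 + Y\<^sup>2) + 2 * E - ((e2 - X)\<^sup>2 + (Y - e1)\<^sup>2)" unfolding E_def by algebra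
        finally show ?thesis by simp
      qed
      finally show ?thesis .
    qed
    moreover have "0 \<le> X\<^sup>2 + Y\<^sup>2" by simp
    ultimately have "E \<le> (X\<^sup>2 + Y\<^sup>2) / 400" using E by argo
    moreover have "(- R * \<beta> * D2 / \<beta> - X)\<^sup>2 + (- R * \<beta> * D1 + Y)\<^sup>2 = E"
      using \<beta> unfolding E_def e1_def e2_def by (simp add: power2_eq_square algebra_simps)
    ultimately show ?case unfolding D1_def D2_def X_def Y_def by (simp add: power2_eq_square)
  qed
qed

text \<open>
  Either some sign is attained on the whole of arbitrarily large ellipses, or \<open>W\<close> has a zero on every large ellipse. In the
  latter case \<open>gradient_decay\<close> bounds the energy by $e^{2s}e^{-7s/5}=e^{3s/5}$, and \<open>small_on_large_ellipses\<close> applies.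
\<close>

lemma W_sign:
  assumes slip: "\<And>y. y \<in> frontier \<Omega> \<Longrightarrow> (\<psi> \<longlongrightarrow> 0) (at y within \<Omega>)"
    and slip': "\<And>y. y \<in> frontier \<Omega> \<Longrightarrow> (\<psi>' \<longlongrightarrow> 0) (at y within \<Omega>)"
  shows "(\<forall>z\<in>\<Omega>. W z \<ge> 0) \<or> (\<forall>z\<in>\<Omega>. W z \<le> 0)"
proof -
  define \<beta> where "\<beta> = A.\<beta>"
  have \<beta>: "0 < \<beta>" "\<beta> \<le> 1" using A.\<beta> by (simp_all add: \<beta>_def)
  define R where "R = r (u\<^sup>2)"
  have bd: "\<forall>\<^sub>F z in at y within \<Omega>. c * W z \<ge> - \<epsilon>" if "y \<in> frontier \<Omega>" "\<epsilon> > 0" for y \<epsilon> c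
  proof -
    have "((\<lambda>z. c * W z) \<longlongrightarrow> c * (0 - 0)) (at y within \<Omega>)"
      unfolding W_def by (intro tendsto_intros slip slip' that)
    then have "\<forall>\<^sub>F z in at y within \<Omega>. c * W z > - \<epsilon>"
      using that(2) by (intro order_tendstoD(1)[of _ 0]) auto
    then show ?thesis by eventually_elim simp
  qed
  have nonneg: "c * W z \<ge> 0"
    if large: "\<And>\<eta> S. \<eta> > 0 \<Longrightarrow> \<exists>s>S. \<forall>\<theta>\<in>{0..2 * pi}. c * W (ell \<beta> s \<theta>) \<ge> - \<eta>" and z: "z \<in> \<Omega>" and c: "\<bar>c\<bar> = 1" for c z
  proof (rule nonneg_of_large_ellipses[OF A.\<Omega> A.\<mu>(2) \<beta> C2_on_cmult[OF W_C2] _ bd large z])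
    fix K assume K: "compact K" "K \<subseteq> \<Omega>"
    obtain C where C: "\<And>z. z \<in> K \<Longrightarrow> \<exists>n. (norm n)\<^sup>2 \<le> \<mu> \<and> \<bar>elliptic_op n (Wxx z) (Wxy z) (Wyy z)\<bar> \<le> C * (\<bar>Wx z\<bar> + \<bar>Wy z\<bar>)"
      using W_elliptic[OF K] by blast
    show "\<exists>C. \<forall>z\<in>K. \<exists>n. (norm n)\<^sup>2 \<le> \<mu> \<and> elliptic_op n (c * Wxx z) (c * Wxy z) (c * Wyy z) \<le> C * (\<bar>c * Wx z\<bar> + \<bar>c * Wy z\<bar>)"
    proof (intro exI[of _ C] ballI)
      fix z assume "z \<in> K"
      then obtain n where n: "(norm n)\<^sup>2 \<le> \<mu>" "\<bar>elliptic_op n (Wxx z) (Wxy z) (Wyy z)\<bar> \<le> C * (\<bar>Wx z\<bar> + \<bar>Wy z\<bar>)" using C by blast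
      have "elliptic_op n (c * Wxx z) (c * Wxy z) (c * Wyy z) = c * elliptic_op n (Wxx z) (Wxy z) (Wyy z)"
        by (simp add: elliptic_op_def algebra_simps)
      also have "\<dots> \<le> \<bar>c * elliptic_op n (Wxx z) (Wxy z) (Wyy z)\<bar>" by simp
      also have "\<dots> \<le> C * (\<bar>c * Wx z\<bar> + \<bar>c * Wy z\<bar>)" using n(2) c by (simp add: abs_mult)
      finally show "\<exists>n. (norm n)\<^sup>2 \<le> \<mu> \<and> elliptic_op n (c * Wxx z) (c * Wxy z) (c * Wyy z) \<le> C * (\<bar>c * Wx z\<bar> + \<bar>c * Wy z\<bar>)"
        using n(1) by blast
    qed
  qed
  define big where "big c \<longleftrightarrow> (\<forall>S. \<exists>s>S. \<forall>\<theta>\<in>{0..2 * pi}. c * W (ell \<beta> s \<theta>) > 0)" for c :: real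
  have big: "\<forall>z\<in>\<Omega>. c * W z \<ge> 0" if "big c" "\<bar>c\<bar> = 1" for c
  proof
    fix z assume z: "z \<in> \<Omega>"
    show "c * W z \<ge> 0"
    proof (rule nonneg[OF _ z that(2)])
      fix \<eta> S :: real assume "\<eta> > 0"
      have "\<exists>s>S. \<forall>\<theta>\<in>{0..2 * pi}. c * W (ell \<beta> s \<theta>) > 0"
        using that(1) unfolding big_def by (rule spec)
      then obtain s where s: "s > S" "\<And>\<theta>. \<theta> \<in> {0..2 * pi} \<Longrightarrow> c * W (ell \<beta> s \<theta>) > 0"
        by metis
      have "c * W (ell \<beta> s \<theta>) \<ge> - \<eta>" if "\<theta> \<in> {0..2 * pi}" for \<theta>
        using s(2)[OF that] \<open>\<eta> > 0\<close> by linarith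
      then show "\<exists>s>S. \<forall>\<theta>\<in>{0..2 * pi}. c * W (ell \<beta> s \<theta>) \<ge> - \<eta>" using s(1) by blast
    qed
  qed
  show ?thesis
  proof (cases "big 1 \<or> big (- 1)")
    case True
    then show ?thesis using big[of 1] big[of "- 1"] by force
  next
    case False
    then obtain S1 S2 where S12: "\<And>s. s > S1 \<Longrightarrow> \<exists>\<theta>\<in>{0..2 * pi}. W (ell \<beta> s \<theta>) \<le> 0"
      "\<And>s. s > S2 \<Longrightarrow> \<exists>\<theta>\<in>{0..2 * pi}. W (ell \<beta> s \<theta>) \<ge> 0"
      unfolding big_def by (simp add: not_less not_le[symmetric]) (metis not_le)
    obtain CA sA where CA: "\<And>s. s \<ge> sA \<Longrightarrow> circ (\<lambda>\<theta>. (A.\<psi>y (ell \<beta> s \<theta>) - A.flow_rate)\<^sup>2 + (\<beta> * A.\<psi>x (ell \<beta> s \<theta>))\<^sup>2) \<le> CA * exp (- (7/5) * s)"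
      using A.gradient_decay unfolding \<beta>_def by blast
    obtain CB sB where CB: "\<And>s. s \<ge> sB \<Longrightarrow> circ (\<lambda>\<theta>. (B.\<psi>y (ell \<beta> s \<theta>) - A.flow_rate)\<^sup>2 + (\<beta> * B.\<psi>x (ell \<beta> s \<theta>))\<^sup>2) \<le> CB * exp (- (7/5) * s)"
      using B.gradient_decay unfolding \<beta>_def by blast
    have "\<forall>\<^sub>F z in at_infinity. z \<in> \<Omega> \<and>
       (- R * \<beta> * (Im (v z) - Im (v' z)) / \<beta> - Wx z)\<^sup>2 + (- R * \<beta> * (Re (v z) - Re (v' z)) + Wy z / \<beta>)\<^sup>2
      \<le> (1/20)\<^sup>2 * ((Wx z)\<^sup>2 + (Wy z / \<beta>)\<^sup>2)"
      using A.eventually_in W_asymptotically_conformal unfolding R_def \<beta>_def by eventually_elim blast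
    from eventually_on_ellipses[OF this \<beta>, of "max (max S1 S2) (max sA sB)"]
    obtain s0 where s0: "s0 \<ge> max (max S1 S2) (max sA sB)" "\<And>s \<theta>. s > s0 \<Longrightarrow> ell \<beta> s \<theta> \<in> \<Omega>"
      "\<And>s \<theta>. s > s0 \<Longrightarrow> (- R * \<beta> * (Im (v (ell \<beta> s \<theta>)) - Im (v' (ell \<beta> s \<theta>))) / \<beta> - Wx (ell \<beta> s \<theta>))\<^sup>2
          + (- R * \<beta> * (Re (v (ell \<beta> s \<theta>)) - Re (v' (ell \<beta> s \<theta>))) + Wy (ell \<beta> s \<theta>) / \<beta>)\<^sup>2
      \<le> (1/20)\<^sup>2 * ((Wx (ell \<beta> s \<theta>))\<^sup>2 + (Wy (ell \<beta> s \<theta>) / \<beta>)\<^sup>2)" by blast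
    note W1 = W_C2[unfolded C2_on_def, THEN conjunct1]
    have diff: "C1_on \<Omega> (\<lambda>z. c * (f z - g z)) (\<lambda>z. c * (fx z - gx z)) (\<lambda>z. c * (fy z - gy z))"
      if "C1_on \<Omega> f fx fy" "C1_on \<Omega> g gx gy" for c f fx fy g gx gy
      using C1_on_cmult[OF C1_on_add[OF that(1) C1_on_cmult[OF that(2), of "-1"]], of c] by simp
    interpret nc: near_conformal \<Omega> \<beta> s0 W Wx Wy
      "\<lambda>z. (- R * \<beta>) * (A.v1 z - B.v1 z)" "\<lambda>z. (- R * \<beta>) * (partial_x A.v1 z - partial_x B.v1 z)" "\<lambda>z. (- R * \<beta>) * (partial_y A.v1 z - partial_y B.v1 z)"
      "\<lambda>z. (- R * \<beta>) * (A.v2 z - B.v2 z)" "\<lambda>z. (- R * \<beta>) * (partial_y A.v1 z - partial_y B.v1 z)" "\<lambda>z. (- R * \<beta>) * (partial_y A.v2 z - partial_y B.v2 z)"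
    proof unfold_locales
      show "C1_on \<Omega> W Wx Wy" by (rule W1)
      show "C1_on \<Omega> (\<lambda>z. (- R * \<beta>) * (A.v1 z - B.v1 z)) (\<lambda>z. (- R * \<beta>) * (partial_x A.v1 z - partial_x B.v1 z))
         (\<lambda>z. (- R * \<beta>) * (partial_y A.v1 z - partial_y B.v1 z))"
        by (rule diff[OF A.velocity_C1(1) B.velocity_C1(1)])
      show "C1_on \<Omega> (\<lambda>z. (- R * \<beta>) * (A.v2 z - B.v2 z)) (\<lambda>z. (- R * \<beta>) * (partial_y A.v1 z - partial_y B.v1 z))
         (\<lambda>z. (- R * \<beta>) * (partial_y A.v2 z - partial_y B.v2 z))"
        by (rule diff[OF A.velocity_C1(2) B.velocity_C1(2)])
    qed (use \<beta> s0(2,3) in auto)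
    have zero: "\<exists>\<theta>\<in>{0..2 * pi}. nc.F s \<theta> = 0" if s: "s > s0" for s
    proof -
      obtain \<theta>1 \<theta>2 where \<theta>: "\<theta>1 \<in> {0..2 * pi}" "nc.F s \<theta>1 \<le> 0" "\<theta>2 \<in> {0..2 * pi}" "nc.F s \<theta>2 \<ge> 0"
        using S12[of s] s s0(1) unfolding nc.F_def by auto
      have "0 \<in> nc.F s ` {0..2 * pi}"
      proof (rule connectedD_interval)
        show "connected (nc.F s ` {0..2 * pi})"
          by (intro connected_continuous_image nc.continuous s) simp
      qed (use \<theta> in auto)
      then show ?thesis by force
    qed
    define C where "C = 2 / \<beta>\<^sup>2 * (CA + CB)"
    have growth: "nc.energy s \<le> C * exp (3/5 * s)" if s: "s > s0" for s
    proof -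
      define hA where "hA \<theta> = (A.\<psi>y (ell \<beta> s \<theta>) - A.flow_rate)\<^sup>2 + (\<beta> * A.\<psi>x (ell \<beta> s \<theta>))\<^sup>2" for \<theta>
      define hB where "hB \<theta> = (B.\<psi>y (ell \<beta> s \<theta>) - A.flow_rate)\<^sup>2 + (\<beta> * B.\<psi>x (ell \<beta> s \<theta>))\<^sup>2" for \<theta>
      define c where "c = exp (2 * s) * (2 / \<beta>\<^sup>2)"
      have c: "c \<ge> 0" by (simp add: c_def)
      have hc: "continuous_on T hA" "continuous_on T hB" for T
        unfolding hA_def hB_def
        by (intro continuous_intros nc.continuous_on_ellipse C1_onD(4)[OF A.psi_C1(2)] C1_onD(4)[OF A.psi_C1(3)] C1_onD(4)[OF B.psi_C1(2)] C1_onD(4)[OF B.psi_C1(3)] s)+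
      have "nc.energy s \<le> circ (\<lambda>\<theta>. c * hA \<theta> + c * hB \<theta>)"
        unfolding nc.energy_def
      proof (intro circ_le nc.continuous s continuous_intros hc)
        fix \<theta>
        define z where "z = ell \<beta> s \<theta>"
        define x x' y y' where "x = A.\<psi>x z" and "x' = B.\<psi>x z" and "y = A.\<psi>y z - A.flow_rate" and "y' = B.\<psi>y z - A.flow_rate"
        have sq: "(p - q)\<^sup>2 \<le> 2 * (p\<^sup>2 + q\<^sup>2)" for p q :: real
        proof -
          have "0 \<le> (p + q)\<^sup>2" by simp
          also have "(p + q)\<^sup>2 = 2 * (p\<^sup>2 + q\<^sup>2) - (p - q)\<^sup>2" by algebra
          finally show ?thesis by simp
        qed
        have "(x - x')\<^sup>2 + ((y - y') / \<beta>)\<^sup>2 = ((\<beta> * x - \<beta> * x')\<^sup>2 + (y - y')\<^sup>2) / \<beta>\<^sup>2"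
          using \<beta> by (simp add: right_diff_distrib[symmetric] power_mult_distrib power_divide add_divide_distrib)
        also have "\<dots> \<le> (2 * ((\<beta> * x)\<^sup>2 + (\<beta> * x')\<^sup>2) + 2 * (y\<^sup>2 + y'\<^sup>2)) / \<beta>\<^sup>2"
          by (intro divide_right_mono add_mono sq) simp
        also have "\<dots> = 2 / \<beta>\<^sup>2 * (hA \<theta> + hB \<theta>)"
          by (simp add: hA_def hB_def x_def x'_def y_def y'_def z_def add_divide_distrib distrib_left)
        finally have "exp (2 * s) * ((x - x')\<^sup>2 + ((y - y') / \<beta>)\<^sup>2) \<le> exp (2 * s) * (2 / \<beta>\<^sup>2 * (hA \<theta> + hB \<theta>))"
          by (intro mult_left_mono) auto
        moreover have "nc.D s \<theta> = exp (2 * s) * ((x - x')\<^sup>2 + ((y - y') / \<beta>)\<^sup>2)"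
          unfolding nc.D_def Wx_def Wy_def z_def[symmetric] by (simp add: x_def x'_def y_def y'_def)
        ultimately show "nc.D s \<theta> \<le> c * hA \<theta> + c * hB \<theta>" by (simp add: c_def algebra_simps add_divide_distrib)
      qed
      also have "\<dots> = c * circ hA + c * circ hB" by (rule circ_linear[OF hc])
      also have "\<dots> \<le> c * (CA * exp (- (7/5) * s)) + c * (CB * exp (- (7/5) * s))"
        using CA[of s] CB[of s] s s0(1) c unfolding hA_def[symmetric] hB_def[symmetric]
        by (intro add_mono mult_left_mono) auto
      also have "\<dots> = C * (exp (2 * s) * exp (- (7/5) * s))" by (simp add: c_def C_def algebra_simps add_divide_distrib)
      also have "exp (2 * s) * exp (- (7/5) * s) = exp (3/5 * s)" by (simp add: exp_add[symmetric])
      finally show ?thesis .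
    qed
    have "1 * W z \<ge> 0" if "z \<in> \<Omega>" for z
    proof (rule nonneg[OF _ that])
      fix \<eta> S :: real assume "\<eta> > 0"
      from nc.small_on_large_ellipses[OF zero growth this, of S]
      show "\<exists>s>S. \<forall>\<theta>\<in>{0..2 * pi}. 1 * W (ell \<beta> s \<theta>) \<ge> - \<eta>" unfolding nc.F_def by (force simp: abs_le_iff)
    qed simp
    then show ?thesis by auto
  qed
qed

end

section \<open>Reflected flows and the sign of the stream function\<close>

lemma has_gradient_partials:
  assumes "has_gradient f a b z"
  shows "partial_x f z = a" "partial_y f z = b"
  unfolding partial_x_def partial_y_def frechet_derivative_at[OF assms, symmetric] by simp_all

lemma gradient_cnj:
  assumes "has_gradient f a b (cnj z)"
  shows "has_gradient (\<lambda>z. c * f (cnj z)) (c * a) (- (c * b)) z"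
proof -
  have "((\<lambda>z. f (cnj z)) has_derivative (\<lambda>h. a * Re (cnj h) + b * Im (cnj h))) (at z)"
    by (rule has_derivative_compose[OF bounded_linear_imp_has_derivative[OF bounded_linear_cnj] assms])
  from has_derivative_mult_right[OF this, of c] show ?thesis
    by (rule has_derivative_eq_rhs) (auto simp: algebra_simps)
qed

lemma Ck_on_cong:
  fixes f g :: "complex \<Rightarrow> real"
  assumes "open S"
  shows "Ck_on k S f \<Longrightarrow> (\<And>z. z \<in> S \<Longrightarrow> f z = g z) \<Longrightarrow> Ck_on k S g"
proof (induction k arbitrary: f g)
  case 0
  then show ?case by (auto intro: continuous_on_eq)
next
  case (Suc k)
  have d: "f differentiable at z" if "z \<in> S" for z using Suc.prems(1) that by simp
  have eq: "frechet_derivative f (at z) = frechet_derivative g (at z)" if "z \<in> S" for z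
    by (rule frechet_derivative_transform_within_open[OF d[OF that] assms that Suc.prems(2)])
  have "g differentiable at z" if z: "z \<in> S" for z
  proof -
    obtain f' where "(f has_derivative f') (at z)" using d[OF z] unfolding differentiable_def by blast
    then have "(g has_derivative f') (at z)"
      by (rule has_derivative_transform_within_open[OF _ assms z Suc.prems(2)])
    then show ?thesis unfolding differentiable_def by blast
  qed
  moreover have "Ck_on k S (\<lambda>x. frechet_derivative g (at x) h)" for h
  proof -
    have "Ck_on k S (\<lambda>x. frechet_derivative f (at x) h)" using Suc.prems(1) by simp
    then show ?thesis by (rule Suc.IH) (simp only: eq)
  qed
  ultimately show ?case by simp
qed

lemma Ck_on_reflect:
  fixes f :: "complex \<Rightarrow> real"
  assumes "open S" and sym: "\<And>z. z \<in> S \<Longrightarrow> cnj z \<in> S"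
  shows "Ck_on k S f \<Longrightarrow> Ck_on k S (\<lambda>z. c * f (cnj z))"
proof (induction k arbitrary: f)
  case 0
  then show ?case using sym by (auto intro!: continuous_intros continuous_on_compose2[of S f])
next
  case (Suc k)
  have d: "((\<lambda>z. c * f (cnj z)) has_derivative (\<lambda>h. c * frechet_derivative f (at (cnj z)) (cnj h))) (at z)" if "z \<in> S" for z
  proof -
    have "(f has_derivative frechet_derivative f (at (cnj z))) (at (cnj z))"
      using Suc.prems sym[OF that] frechet_derivative_works by auto
    from has_derivative_mult_right[OF has_derivative_compose[OF bounded_linear_imp_has_derivative[OF bounded_linear_cnj] this], of c]
    show ?thesis .
  qed
  have "Ck_on k S (\<lambda>x. frechet_derivative (\<lambda>z. c * f (cnj z)) (at x) h)" for h
  proof (rule Ck_on_cong[OF \<open>open S\<close>])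
    have "Ck_on k S (\<lambda>z. frechet_derivative f (at z) (cnj h))" using Suc.prems by simp
    from Suc.IH[OF this] show "Ck_on k S (\<lambda>z. c * frechet_derivative f (at (cnj z)) (cnj h))" .
    show "c * frechet_derivative f (at (cnj z)) (cnj h) = frechet_derivative (\<lambda>z. c * f (cnj z)) (at z) h" if "z \<in> S" for z
      using frechet_derivative_at[OF d[OF that]] by metis
  qed
  moreover have "(\<lambda>z. c * f (cnj z)) differentiable at z" if "z \<in> S" for z
    using d[OF that] unfolding differentiable_def by blast
  ultimately show ?case by simp
qed

lemma Ck_on_zero: "Ck_on k S (\<lambda>z. 0)"
  by (induction k) (auto simp: frechet_derivative_const)

lemma (in density_law) planar_flow_zero:
  assumes "open \<Omega>" "bounded (- \<Omega>)"
  shows "planar_flow r k Qmax \<mu> L \<Omega> (\<lambda>z. 0) (\<lambda>z. 0) 0"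
proof unfold_locales
  have 0: "partial_x (\<lambda>z. 0) z = 0" "partial_y (\<lambda>z. 0) z = 0" for z
    using has_gradient_partials[of "\<lambda>z. 0" 0 0 z] by auto
  show "smooth_on \<Omega> (\<lambda>z. 0)" by (simp add: smooth_on_def Ck_on_zero)
  show "of_real (r ((norm (0::complex))\<^sup>2)) * 0 = Complex (partial_y (\<lambda>z. 0) z) (- partial_x (\<lambda>z. 0) z)" for z
    by (simp add: 0 complex_eq_iff)
  show "curl (\<lambda>z. 0) z = 0" for z by (simp add: curl_def 0)
  show "((\<lambda>z. 0) \<longlongrightarrow> Complex 0 0) at_infinity" by (simp add: Complex_eq_0 zero_complex.code)
qed (use assms Qmax in auto)

lemma (in planar_flow) planar_flow_reflect:
  assumes sym: "\<And>z. z \<in> \<Omega> \<Longrightarrow> cnj z \<in> \<Omega>"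
  shows "planar_flow r k Qmax \<mu> L \<Omega> (\<lambda>z. - \<psi> (cnj z)) (\<lambda>z. cnj (v (cnj z))) u"
proof unfold_locales
  fix z assume z: "z \<in> \<Omega>"
  note z' = sym[OF z]
  have \<psi>: "partial_x (\<lambda>z. - \<psi> (cnj z)) z = - \<psi>x (cnj z)" "partial_y (\<lambda>z. - \<psi> (cnj z)) z = \<psi>y (cnj z)"
    using has_gradient_partials[OF gradient_cnj[OF C1_onD(1)[OF psi_C1(1) z'], of "-1"]] by simp_all
  show "of_real (r ((norm (cnj (v (cnj z))))\<^sup>2)) * cnj (v (cnj z))
     = Complex (partial_y (\<lambda>z. - \<psi> (cnj z)) z) (- partial_x (\<lambda>z. - \<psi> (cnj z)) z)"
    using momentum_components[OF z'] by (simp add: \<psi> complex_eq_iff)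
  obtain v' where v': "(v has_derivative v') (at (cnj z))" using v_diff[OF z'] unfolding differentiable_def by blast
  have "((\<lambda>z. v (cnj z)) has_derivative (\<lambda>h. v' (cnj h))) (at z)"
    by (rule has_derivative_compose[OF bounded_linear_imp_has_derivative[OF bounded_linear_cnj] v'])
  from has_derivative_compose[OF this bounded_linear_imp_has_derivative[OF bounded_linear_cnj]]
  show "(\<lambda>z. cnj (v (cnj z))) differentiable at z" unfolding differentiable_def by blast
  note g = velocity_gradient[OF z']
  have "partial_x (\<lambda>z. Im (cnj (v (cnj z)))) z = - partial_x v2 (cnj z)"
    using has_gradient_partials(1)[OF gradient_cnj[OF g(2), of "-1"]] by simp
  moreover have "partial_y (\<lambda>z. Re (cnj (v (cnj z)))) z = - partial_y v1 (cnj z)"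
    using has_gradient_partials(2)[OF gradient_cnj[OF g(1), of 1]] by simp
  ultimately show "curl (\<lambda>z. cnj (v (cnj z))) z = 0" using g(3) by (simp add: curl_def)
  show "(norm (cnj (v (cnj z))))\<^sup>2 \<le> Qmax" using speed[OF z'] by simp
next
  show "smooth_on \<Omega> (\<lambda>z. - \<psi> (cnj z))"
    using smooth Ck_on_reflect[OF \<Omega>(1) sym, of _ \<psi> "-1"] by (simp add: smooth_on_def)
  have "filterlim cnj at_infinity at_infinity"
    by (rule filterlim_norm_at_top_imp_at_infinity) (simp add: filterlim_norm_at_top)
  from filterlim_compose[OF v_lim this]
  have "((\<lambda>z. cnj (v (cnj z))) \<longlongrightarrow> cnj (Complex u 0)) at_infinity" by (rule tendsto_cnj)
  then show "((\<lambda>z. cnj (v (cnj z))) \<longlongrightarrow> Complex u 0) at_infinity"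
    by (rule tendsto_eq_rhs) (simp add: complex_eq_iff)
qed (use \<Omega> in auto)

context planar_flow
begin

lemma gradient_bounded:
  assumes "z \<in> \<Omega>"
  shows "\<bar>\<psi>x z\<bar> + \<bar>\<psi>y z\<bar> \<le> 2 * (r 0 * sqrt Qmax)"
proof -
  have r: "0 < r (q z)" "r (q z) \<le> r 0" using r_pos[OF q_in[OF assms]] r_antimono[of 0 "q z"] speed[OF assms] by auto
  have n: "norm (v z) \<le> sqrt Qmax" using speed[OF assms] by (rule real_le_rsqrt)
  have "\<bar>v1 z\<bar> \<le> sqrt Qmax" "\<bar>v2 z\<bar> \<le> sqrt Qmax"
    using n abs_Re_le_cmod[of "v z"] abs_Im_le_cmod[of "v z"] by linarith+
  then have "r (q z) * \<bar>v1 z\<bar> \<le> r 0 * sqrt Qmax" "r (q z) * \<bar>v2 z\<bar> \<le> r 0 * sqrt Qmax"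
    using r by (auto intro!: mult_mono)
  moreover have "\<bar>\<psi>y z\<bar> = r (q z) * \<bar>v1 z\<bar>" "\<bar>\<psi>x z\<bar> = r (q z) * \<bar>v2 z\<bar>"
    using momentum_components[OF assms] r(1) by (metis abs_mult abs_of_pos, metis abs_minus_cancel abs_mult abs_of_pos)
  ultimately show ?thesis by simp
qed

text \<open>
  Otherwise \<open>\<psi>\<close> would be positive in \<open>D\<close> by the strong maximum principle, although its gradient is bounded.
\<close>

lemma zero_if_nonneg_near_corner:
  assumes D: "open D" "connected D" "D \<subseteq> \<Omega>" and nonneg: "\<And>z. z \<in> D \<Longrightarrow> \<psi> z \<ge> 0"
    and slip: "(\<psi> \<longlongrightarrow> 0) (at p within \<Omega>)" and p: "p \<notin> \<Omega>"
    and sector: "open_sector p \<epsilon> \<alpha> \<delta> \<subseteq> D" "\<epsilon> > 0" "pi < \<delta>" "\<delta> \<le> 2 * pi"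
    and z: "z \<in> D"
  shows "\<psi> z = 0"
proof (rule ccontr)
  assume nz: "\<psi> z \<noteq> 0"
  have op: "\<exists>n. (norm n)\<^sup>2 \<le> \<mu> \<and> elliptic_op n (\<psi>xx z) (\<psi>xy z) (\<psi>yy z) \<le> 0" if "z \<in> D" for z
    using that D(3) norm_n[of z] stream_elliptic[of z] by (intro exI[of _ "n z"]) auto
  note C2 = C2_on_subset[OF psi_C2 D(3)]
  have pos: "\<psi> y > 0" if "y \<in> D" for y
    using strong_max_principle[OF \<mu>(2) D(1,2) C2 op nonneg that _ z] nz nonneg[OF that] by force
  show False
  proof (rule unbounded_gradient_at_corner[OF \<mu> D(1) C2 op sector])
    show "(\<psi> \<longlongrightarrow> 0) (at p within D)" by (rule tendsto_within_subset[OF slip D(3)])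
    fix y assume "y \<in> open_sector p \<epsilon> \<alpha> \<delta>"
    then have y: "y \<in> D" using sector(1) by blast
    then show "\<psi> y > 0" by (rule pos)
    show "\<bar>\<psi>x y\<bar> + \<bar>\<psi>y y\<bar> \<le> 2 * (r 0 * sqrt Qmax)" using y D(3) by (intro gradient_bounded) auto
  qed (use p D(3) in auto)
qed

lemma trivial_if_psi_zero:
  assumes "\<And>z. z \<in> \<Omega> \<Longrightarrow> \<psi> z = 0" and z: "z \<in> \<Omega>"
  shows "v z = 0"
proof -
  have "has_gradient (\<lambda>z. 0) (\<psi>x z) (\<psi>y z) z"
    by (rule has_derivative_transform_within_open[OF C1_onD(1)[OF psi_C1(1) z] \<Omega>(1) z]) (simp add: assms)
  moreover have "has_gradient (\<lambda>z. 0) 0 0 z" by simp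
  ultimately have "\<psi>x z = 0" "\<psi>y z = 0" using has_gradient_unique by blast+
  then show ?thesis using momentum_components[OF z] r_pos[OF q_in[OF z]] by (simp add: complex_eq_iff)
qed

text \<open>
  Far from the body $\psi_y$ is close to its limit, which is positive.
\<close>

lemma psi_increases_upwards:
  assumes "u > 0"
  shows "\<exists>R m. R > 0 \<and> m > 0 \<and> (\<forall>x y0 y1. y0 \<le> y1 \<longrightarrow> (\<forall>t\<in>{y0..y1}. norm (Complex x t) \<ge> R) \<longrightarrow>
      \<psi> (Complex x y1) \<ge> \<psi> (Complex x y0) + m * (y1 - y0)) \<and> (\<forall>z. norm z \<ge> R \<longrightarrow> z \<in> \<Omega>)"
proof -
  define m where "m = flow_rate / 2"
  have m: "m > 0" using assms r_pos[OF u_in] by (simp add: m_def flow_rate_def)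
  then have "\<forall>\<^sub>F z in at_infinity. \<psi>y z > m"
    by (intro order_tendstoD(1)[OF gradient_lim(1)]) (simp add: m_def)
  then have "\<forall>\<^sub>F z in at_infinity. z \<in> \<Omega> \<and> \<psi>y z > m" using eventually_in by eventually_elim simp
  then obtain R0 where R0: "\<And>z. norm z \<ge> R0 \<Longrightarrow> z \<in> \<Omega> \<and> \<psi>y z > m" unfolding eventually_at_infinity by blast
  define R where "R = max R0 1"
  have R: "R > 0" "\<And>z. norm z \<ge> R \<Longrightarrow> z \<in> \<Omega> \<and> \<psi>y z > m" using R0 by (auto simp: R_def)
  have "\<psi> (Complex x y1) \<ge> \<psi> (Complex x y0) + m * (y1 - y0)"
    if "y0 \<le> y1" and far: "\<And>t. t \<in> {y0..y1} \<Longrightarrow> norm (Complex x t) \<ge> R" for x y0 y1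
  proof -
    have "\<psi> (Complex x y0) - m * y0 \<le> \<psi> (Complex x y1) - m * y1"
    proof (rule DERIV_nonneg_imp_nondecreasing[OF \<open>y0 \<le> y1\<close>])
      fix t assume "y0 \<le> t" "t \<le> y1"
      then have t: "Complex x t \<in> \<Omega>" "\<psi>y (Complex x t) > m" using far R(2) by auto
      have "((\<lambda>t. \<psi> (Complex x t)) has_real_derivative \<psi>y (Complex x t)) (at t)"
        using has_gradient_along[OF C1_onD(1)[OF psi_C1(1) t(1)] coordinate_line_derivs(2)] by simp
      then have "((\<lambda>t. \<psi> (Complex x t) - m * t) has_real_derivative \<psi>y (Complex x t) - m) (at t)"
        by (auto intro!: derivative_eq_intros)
      then show "\<exists>y. ((\<lambda>t. \<psi> (Complex x t) - m * t) has_real_derivative y) (at t) \<and> 0 \<le> y"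
        using t(2) by (intro exI[of _ "\<psi>y (Complex x t) - m"]) auto
    qed
    then show ?thesis by (simp add: algebra_simps)
  qed
  then show ?thesis using R m by (intro exI[of _ R] exI[of _ m]) auto
qed

text \<open>
  The weak maximum principle in a large half disk. On its arc \<open>\<psi>\<close> is nonnegative: over points of the axis far from
  the body because \<open>\<psi>\<close> increases upwards from a nonnegative value, and over the remaining bounded interval because
  the increase eventually outweighs the minimum on a horizontal segment.
\<close>

lemma nonneg_on_upper_half:
  assumes u: "u > 0" and slip: "\<And>y. y \<in> frontier \<Omega> \<Longrightarrow> (\<psi> \<longlongrightarrow> 0) (at y within \<Omega>)"
    and axis: "\<And>z. z \<in> \<Omega> \<Longrightarrow> Im z = 0 \<Longrightarrow> \<psi> z \<ge> 0"
    and z0: "z0 \<in> \<Omega>" "Im z0 > 0"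
  shows "\<psi> z0 \<ge> 0"
proof -
  obtain R m where R: "R > 0" "m > 0" and far: "\<And>z. norm z \<ge> R \<Longrightarrow> z \<in> \<Omega>"
    and up: "\<And>x y0 y1. y0 \<le> y1 \<Longrightarrow> (\<And>t. t \<in> {y0..y1} \<Longrightarrow> norm (Complex x t) \<ge> R) \<Longrightarrow> \<psi> (Complex x y1) \<ge> \<psi> (Complex x y0) + m * (y1 - y0)"
    using psi_increases_upwards[OF u] by metis
  have nRe: "norm (Complex x t) \<ge> R" if "\<bar>x\<bar> \<ge> R" for x t
    using abs_Re_le_cmod[of "Complex x t"] that by simp
  have nIm: "norm (Complex x t) \<ge> R" if "t \<ge> R" for x t
    using abs_Im_le_cmod[of "Complex x t"] that by simp
  define A where "A = (\<lambda>x. Complex x R) ` {-R..R}"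
  have "compact A"
    unfolding A_def complex_eq_iff
    by (intro compact_continuous_image continuous_intros) (simp_all add: Complex_eq continuous_intros)
  moreover have "A \<subseteq> \<Omega>" using nIm far by (auto simp: A_def)
  then have "continuous_on A \<psi>" using continuous_on_subset[OF C1_onD(4)[OF psi_C1(1)]] by blast
  ultimately have "bounded (\<psi> ` A)" using compact_continuous_image compact_imp_bounded by blast
  then obtain M where M: "\<forall>y\<in>\<psi> ` A. norm y \<le> M" unfolding bounded_iff by blast
  \<comment> \<open>on the circle of radius \<open>R1\<close> a point over the segment \<open>{-R..R}\<close> has height
     at least \<open>R + \<bar>M\<bar> / m\<close>, which makes up for a value \<open>- \<bar>M\<bar>\<close> at height \<open>R\<close>\<close>
  define R1 where "R1 = max (2 * R + \<bar>M\<bar> / m) (norm z0 + 1)"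
  have circle: "\<psi> y \<ge> 0" if y: "norm y \<ge> R1" "Im y \<ge> 0" for y
  proof -
    obtain x t where y_eq: "y = Complex x t" by (cases y)
    show ?thesis
    proof (cases "\<bar>x\<bar> \<ge> R")
      case True
      have "\<psi> (Complex x 0) \<ge> 0" using axis[OF far[OF nRe[OF True]]] by simp
      moreover have "\<psi> (Complex x t) \<ge> \<psi> (Complex x 0) + m * (t - 0)"
        using y y_eq by (intro up nRe True) auto
      moreover have "m * (t - 0) \<ge> 0" using R y y_eq by simp
      ultimately show ?thesis by (simp add: y_eq)
    next
      case False
      have "norm y \<le> \<bar>x\<bar> + \<bar>t\<bar>" using cmod_le[of y] by (simp add: y_eq)
      moreover have "2 * R + \<bar>M\<bar> / m \<le> norm y" using y by (simp add: R1_def)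
      ultimately have t: "t \<ge> R + \<bar>M\<bar> / m" using False y y_eq by simp
      have "\<bar>M\<bar> / m \<ge> 0" using R by simp
      then have "\<psi> (Complex x t) \<ge> \<psi> (Complex x R) + m * (t - R)" using t by (intro up nIm) auto
      moreover have "m * (t - R) \<ge> m * (\<bar>M\<bar> / m)" using t R by (intro mult_left_mono) auto
      moreover have "m * (\<bar>M\<bar> / m) = \<bar>M\<bar>" using R by simp
      moreover have "\<psi> (Complex x R) \<in> \<psi> ` A" using False unfolding A_def by (intro imageI) auto
      then have "\<bar>\<psi> (Complex x R)\<bar> \<le> M" using M by auto
      ultimately show ?thesis unfolding y_eq by linarith
    qed
  qed
  define U where "U = \<Omega> \<inter> {z. Im z > 0} \<inter> ball 0 R1"
  have U: "open U" "bounded U" "U \<subseteq> \<Omega>"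
    using \<Omega>(1) by (auto simp: U_def intro!: open_Int open_halfspace_Im_gt intro: bounded_subset[OF bounded_ball])
  show ?thesis
  proof (rule weak_max_principle[OF U(1,2) \<mu>(2) C2_on_subset[OF psi_C2 U(3)]])
    fix K assume "K \<subseteq> U"
    then show "\<exists>C. \<forall>z\<in>K. \<exists>n. (norm n)\<^sup>2 \<le> \<mu> \<and> elliptic_op n (\<psi>xx z) (\<psi>xy z) (\<psi>yy z) \<le> C * (\<bar>\<psi>x z\<bar> + \<bar>\<psi>y z\<bar>)"
      using U(3) norm_n stream_elliptic by (intro exI[of _ 0] ballI exI[of _ "n z" for z]) auto
  next
    show "z0 \<in> U" using z0 by (auto simp: U_def R1_def)
  next
    fix y and \<epsilon> :: real assume y: "y \<in> frontier U" and \<epsilon>: "\<epsilon> > 0"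
    have yc: "y \<in> closure U" "y \<notin> U" using y U(1) by (auto simp: frontier_def interior_open)
    show "\<forall>\<^sub>F z in at y within U. \<psi> z \<ge> - \<epsilon>"
    proof (cases "y \<in> \<Omega>")
      case False
      then have "y \<in> frontier \<Omega>" using yc closure_mono[OF U(3)] \<Omega>(1) by (auto simp: frontier_def interior_open)
      from tendsto_within_subset[OF slip[OF this] U(3)]
      have "\<forall>\<^sub>F z in at y within U. \<psi> z > - \<epsilon>" using \<epsilon> by (intro order_tendstoD(1)[of _ 0]) auto
      then show ?thesis by eventually_elim simp
    next
      case True
      have "closure U \<subseteq> {z. Im z \<ge> 0} \<inter> cball 0 R1"
        by (rule closure_minimal) (auto simp: U_def closed_halfspace_Im_ge closed_Int)
      then have yy: "Im y \<ge> 0" "norm y \<le> R1" using yc by auto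
      have "\<psi> y \<ge> 0"
      proof (cases "Im y = 0")
        case True then show ?thesis using axis \<open>y \<in> \<Omega>\<close> by blast
      next
        case False
        then have "norm y \<ge> R1" using yc(2) yy True by (auto simp: U_def)
        then show ?thesis using circle yy by blast
      qed
      then show ?thesis
        using eventually_ge_neg_within[OF C1_on_continuous_at[OF psi_C1(1) True]] \<epsilon> by blast
    qed
  qed
qed

lemma not_nonneg_on_axis:
  assumes u: "u > 0" and conn: "connected (\<Omega> \<inter> {z. Im z > 0})"
    and slip: "\<And>y. y \<in> frontier \<Omega> \<Longrightarrow> (\<psi> \<longlongrightarrow> 0) (at y within \<Omega>)"
    and p: "p \<in> frontier \<Omega>" "Im p > 0"
    and sector: "open_sector p \<epsilon> \<alpha> \<delta> \<subseteq> \<Omega>" "\<epsilon> > 0" "pi < \<delta>" "\<delta> \<le> 2 * pi"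
    and axis: "\<And>z. z \<in> \<Omega> \<Longrightarrow> Im z = 0 \<Longrightarrow> \<psi> z \<ge> 0"
  shows False
proof -
  define D where "D = \<Omega> \<inter> {z. Im z > 0}"
  have D: "open D" "connected D" "D \<subseteq> \<Omega>"
    using conn \<Omega>(1) by (auto simp: D_def intro!: open_Int open_halfspace_Im_gt)
  have pn: "p \<notin> \<Omega>" using p(1) \<Omega>(1) by (auto simp: frontier_def interior_open)
  define e where "e = min \<epsilon> (Im p)"
  have e: "e > 0" using sector p by (simp add: e_def)
  have sD: "open_sector p e \<alpha> \<delta> \<subseteq> D"
  proof
    fix z assume "z \<in> open_sector p e \<alpha> \<delta>"
    then obtain t \<theta> where z: "z = p + of_real t * cis \<theta>" "0 < t" "t < e" "\<alpha> < \<theta>" "\<theta> < \<alpha> + \<delta>"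
      unfolding open_sector_def by blast
    have "t < \<epsilon>" "t < Im p" using z by (auto simp: e_def)
    then have "z \<in> open_sector p \<epsilon> \<alpha> \<delta>" unfolding open_sector_def using z by blast
    moreover have "Im z > 0"
    proof -
      have "t * - 1 \<le> t * sin \<theta>" using z(2) by (intro mult_left_mono) auto
      then show ?thesis using \<open>t < Im p\<close> by (simp add: z(1))
    qed
    ultimately show "z \<in> D" using sector(1) by (auto simp: D_def)
  qed
  have zero: "\<psi> z = 0" if "z \<in> D" for z
  proof (rule zero_if_nonneg_near_corner[OF D _ slip[OF p(1)] pn sD e sector(3,4) that])
    fix y assume "y \<in> D"
    then have y: "y \<in> \<Omega>" "Im y > 0" by (auto simp: D_def)
    show "\<psi> y \<ge> 0" by (rule nonneg_on_upper_half[OF u slip axis y])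
  qed
  obtain R m where R: "R > 0" "m > 0" and far: "\<And>z. norm z \<ge> R \<Longrightarrow> z \<in> \<Omega>"
    and up: "\<And>x y0 y1. y0 \<le> y1 \<Longrightarrow> (\<And>t. t \<in> {y0..y1} \<Longrightarrow> norm (Complex x t) \<ge> R) \<Longrightarrow> \<psi> (Complex x y1) \<ge> \<psi> (Complex x y0) + m * (y1 - y0)"
    using psi_increases_upwards[OF u] by metis
  have n: "norm (Complex 0 t) \<ge> R" if "t \<ge> R" for t using abs_Im_le_cmod[of "Complex 0 t"] that by simp
  have "\<psi> (Complex 0 (R + 1)) \<ge> \<psi> (Complex 0 R) + m * (R + 1 - R)" using n by (intro up) auto
  moreover have "Complex 0 (R + 1) \<in> D" "Complex 0 R \<in> D" using n far R(1) by (auto simp: D_def)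
  ultimately show False using zero R(2) by simp
qed

end

text \<open>
  Fold a path in \<open>\<Omega>\<close> into the closed upper half plane by reflecting its lower parts, then lift it by a small
  amount, which stays in \<open>\<Omega>\<close> by compactness.
\<close>

lemma connected_upper_half:
  fixes \<Omega> :: "complex set"
  assumes \<Omega>: "open \<Omega>" "connected \<Omega>" and sym: "\<And>z. z \<in> \<Omega> \<Longrightarrow> cnj z \<in> \<Omega>"
  shows "connected (\<Omega> \<inter> {z. Im z > 0})"
proof -
  define D where "D = \<Omega> \<inter> {z. Im z > 0}"
  have "path_connected D"
    unfolding path_connected_component
  proof (intro ballI)
    fix x y assume x: "x \<in> D" and y: "y \<in> D"
    have "path_connected \<Omega>" using \<Omega> connected_open_path_connected by blast
    then obtain g where g: "path g" "path_image g \<subseteq> \<Omega>" "pathstart g = x" "pathfinish g = y"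
      using x y unfolding path_connected_def D_def by blast
    define h where "h t = Complex (Re (g t)) \<bar>Im (g t)\<bar>" for t
    have hp: "path h"
      using g(1) unfolding path_def h_def Complex_eq by (intro continuous_intros)
    have "h t \<in> {g t, cnj (g t)}" for t by (auto simp: h_def complex_eq_iff abs_if)
    then have "path_image h \<subseteq> \<Omega>" using g(2) sym unfolding path_image_def by fastforce
    then obtain e where e: "e > 0" "(\<Union>z\<in>path_image h. cball z e) \<subseteq> \<Omega>"
      using compact_subset_open_imp_cball_epsilon_subset[OF compact_path_image[OF hp] \<Omega>(1)] by blast
    have h01: "h 0 = x" "h 1 = y" using g(3,4) x y by (auto simp: h_def pathstart_def pathfinish_def D_def complex_eq_iff)
    have up: "h t + \<i> * of_real s \<in> D" if "t \<in> {0..1}" "0 \<le> s" "s \<le> e" "0 < s \<or> Im (h t) > 0" for t s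
    proof -
      have "h t + \<i> * of_real s \<in> cball (h t) e" using that by (simp add: dist_norm norm_mult)
      then have "h t + \<i> * of_real s \<in> \<Omega>" using e(2) that(1) unfolding path_image_def by blast
      then show ?thesis using that by (auto simp: D_def h_def)
    qed
    have lift: "path_component D z (z + \<i> * of_real e)" if z: "z \<in> D" "z = h t" "t \<in> {0..1}" for z t
    proof -
      have "h t + \<i> * of_real (s * e) \<in> D" if "s \<in> {0..1}" for s
        using that z e(1) by (intro up) (auto simp: D_def mult_left_le_one_le)
      moreover have "path (\<lambda>s. h t + \<i> * of_real (s * e))" unfolding path_def by (intro continuous_intros)
      ultimately show ?thesis unfolding path_component_def
        by (intro exI[of _ "\<lambda>s. h t + \<i> * of_real (s * e)"]) (auto simp: path_image_def pathstart_def pathfinish_def z(2))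
    qed
    have "path_component D (x + \<i> * of_real e) (y + \<i> * of_real e)"
    proof -
      have "path (\<lambda>t. h t + \<i> * of_real e)" using hp unfolding path_def by (intro continuous_intros)
      then show ?thesis unfolding path_component_def using up[of _ e] e(1) h01
        by (intro exI[of _ "\<lambda>t. h t + \<i> * of_real e"]) (auto simp: path_image_def pathstart_def pathfinish_def)
    qed
    moreover have "path_component D x (x + \<i> * of_real e)" by (rule lift[OF x h01(1)[symmetric]]) simp
    moreover have "path_component D (y + \<i> * of_real e) y"
      by (rule path_component_sym, rule lift[OF y h01(2)[symmetric]]) simp
    ultimately show "path_component D x y" using path_component_trans by metis
  qed
  then show ?thesis using path_connected_imp_connected by (simp add: D_def)
qed

lemma frontier_cnj:
  assumes "cnj ` B = B" "p \<in> frontier B"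
  shows "cnj p \<in> frontier B"
proof -
  have sym: "cnj z \<in> B \<longleftrightarrow> z \<in> B" for z using assms(1) by (metis complex_cnj_cnj imageI)
  have d: "dist (cnj p) (cnj z) = dist p z" for z
    by (metis complex_cnj_diff complex_mod_cnj dist_norm)
  show ?thesis
    unfolding frontier_straddle
  proof (intro allI impI)
    fix e :: real assume "e > 0"
    then obtain x y where "x \<in> B" "dist p x < e" "y \<notin> B" "dist p y < e"
      using assms(2) unfolding frontier_straddle by blast
    then show "(\<exists>x\<in>B. dist (cnj p) x < e) \<and> (\<exists>x. x \<notin> B \<and> dist (cnj p) x < e)"
      using sym d by metis
  qed
qed

lemma protruding_corner_cnj:
  assumes B: "cnj ` B = B" and p: "protruding_corner B p"
  shows "protruding_corner B (cnj p)"
proof -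
  obtain \<epsilon> \<alpha> \<delta> where s: "\<epsilon> > 0" "pi < \<delta>" "\<delta> \<le> 2 * pi" "open_sector p \<epsilon> \<alpha> \<delta> \<subseteq> - B" and pf: "p \<in> frontier B"
    using p unfolding protruding_corner_def by blast
  have sym: "cnj z \<in> B \<longleftrightarrow> z \<in> B" for z using B by (metis complex_cnj_cnj imageI)
  have "open_sector (cnj p) \<epsilon> (- \<alpha> - \<delta>) \<delta> \<subseteq> - B"
  proof
    fix z assume "z \<in> open_sector (cnj p) \<epsilon> (- \<alpha> - \<delta>) \<delta>"
    then obtain r \<theta> where z: "z = cnj p + of_real r * cis \<theta>" "0 < r" "r < \<epsilon>" "- \<alpha> - \<delta> < \<theta>" "\<theta> < - \<alpha> - \<delta> + \<delta>"
      unfolding open_sector_def by blast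
    have "cnj z = p + of_real r * cis (- \<theta>)" by (simp add: z(1) cis_cnj)
    then have "cnj z \<in> open_sector p \<epsilon> \<alpha> \<delta>"
      unfolding open_sector_def mem_Collect_eq using z by (intro exI[of _ r] exI[of _ "- \<theta>"]) auto
    then show "z \<in> - B" using s(4) sym[of z] by auto
  qed
  then show ?thesis unfolding protruding_corner_def using s frontier_cnj[OF B pf] by blast
qed

context density_law
begin

text \<open>
  The mirror image of a corner is another corner, so the upper half plane contains one, at which both \<open>\<psi>\<close> and the
  reflected stream function can be tested.
\<close>

lemma symmetric_flow_trivial:
  assumes flow: "planar_flow r k Qmax \<mu> L (- B) \<psi> v u" and u: "u \<ge> 0"
    and slip: "slip_condition B \<psi>"
    and B: "connected (- B)" "cnj ` B = B"
    and corner: "protruding_corner B p" "Im p \<noteq> 0"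
    and z: "z \<in> - B"
  shows "v z = 0"
proof -
  interpret A: planar_flow r k Qmax \<mu> L "- B" \<psi> v u by (rule flow)
  have sym: "cnj w \<in> - B" if "w \<in> - B" for w using that B(2) by (metis ComplD ComplI complex_cnj_cnj imageI)
  have fr: "frontier (- B) = frontier B" by (rule frontier_complement)
  have slipA: "(\<psi> \<longlongrightarrow> 0) (at y within - B)" if "y \<in> frontier (- B)" for y
    using slip that unfolding slip_condition_def fr by blast
  interpret R: planar_flow r k Qmax \<mu> L "- B" "\<lambda>z. - \<psi> (cnj z)" "\<lambda>z. cnj (v (cnj z))" u
    by (rule A.planar_flow_reflect[OF sym])
  have slipR: "((\<lambda>z. - \<psi> (cnj z)) \<longlongrightarrow> 0) (at y within - B)" if "y \<in> frontier (- B)" for y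
  proof -
    have "cnj y \<in> frontier (- B)" using frontier_cnj[OF B(2)] that unfolding fr by blast
    from slipA[OF this] have 1: "(\<psi> \<longlongrightarrow> 0) (at (cnj y) within - B)" .
    have "filterlim cnj (at (cnj y) within - B) (at y within - B)"
      unfolding filterlim_at
    proof
      show "(cnj \<longlongrightarrow> cnj y) (at y within - B)" by (intro tendsto_intros)
      show "\<forall>\<^sub>F x in at y within - B. cnj x \<in> - B \<and> cnj x \<noteq> cnj y"
        using sym by (auto simp: eventually_at_filter)
    qed
    from tendsto_minus[OF filterlim_compose[OF 1 this]] show ?thesis by simp
  qed
  define p' where "p' = (if Im p > 0 then p else cnj p)"
  have p': "protruding_corner B p'" "Im p' > 0"
    using corner protruding_corner_cnj[OF B(2) corner(1)] by (auto simp: p'_def)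
  then obtain \<epsilon> \<alpha> \<delta> where sec: "\<epsilon> > 0" "pi < \<delta>" "\<delta> \<le> 2 * pi" "open_sector p' \<epsilon> \<alpha> \<delta> \<subseteq> - B" and pf: "p' \<in> frontier (- B)"
    unfolding protruding_corner_def fr by blast
  have pn: "p' \<notin> - B" using pf A.\<Omega>(1) by (auto simp: frontier_def interior_open)
  have conn: "connected (- B \<inter> {z. Im z > 0})" by (rule connected_upper_half[OF A.\<Omega>(1) B(1) sym])
  show ?thesis
  proof (cases "u = 0")
    case True
    interpret Z: planar_flow r k Qmax \<mu> L "- B" "\<lambda>z. 0" "\<lambda>z. 0" u
      unfolding True by (rule planar_flow_zero[OF A.\<Omega>])
    interpret pair: flow_pair r k Qmax \<mu> L "- B" \<psi> v u "\<lambda>z. 0" "\<lambda>z. 0" ..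
    have "(\<forall>w\<in>- B. \<psi> w \<ge> 0) \<or> (\<forall>w\<in>- B. \<psi> w \<le> 0)"
      using pair.W_sign[OF slipA] unfolding pair.W_def by simp
    then have "\<psi> w = 0" if w: "w \<in> - B" for w
    proof
      assume nn: "\<forall>w\<in>- B. \<psi> w \<ge> 0"
      show ?thesis
        by (rule A.zero_if_nonneg_near_corner[OF A.\<Omega>(1) B(1) _ _ slipA[OF pf] pn sec(4,1,2,3) w]) (use nn in auto)
    next
      assume np: "\<forall>w\<in>- B. \<psi> w \<le> 0"
      have "- \<psi> (cnj (cnj w)) = 0"
        by (rule R.zero_if_nonneg_near_corner[OF A.\<Omega>(1) B(1) _ _ slipR[OF pf] pn sec(4,1,2,3) sym[OF w]]) (use np sym in auto)
      then show ?thesis by simp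
    qed
    then show ?thesis using A.trivial_if_psi_zero z by blast
  next
    case False
    then have u: "u > 0" using u by simp
    interpret pair: flow_pair r k Qmax \<mu> L "- B" \<psi> v u "\<lambda>z. - \<psi> (cnj z)" "\<lambda>z. cnj (v (cnj z))" ..
    have axis: "cnj w = w" if "Im w = 0" for w using that by (simp add: complex_eq_iff)
    have "(\<forall>w\<in>- B. pair.W w \<ge> 0) \<or> (\<forall>w\<in>- B. pair.W w \<le> 0)"
      by (rule pair.W_sign[OF slipA slipR])
    then have False
    proof
      assume nn: "\<forall>w\<in>- B. pair.W w \<ge> 0"
      show False
      proof (rule A.not_nonneg_on_axis[OF u conn slipA pf p'(2) sec(4,1,2,3)])
        fix w assume "w \<in> - B" "Im w = 0"
        then show "\<psi> w \<ge> 0" using nn[rule_format, of w] by (simp add: pair.W_def axis)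
      qed
    next
      assume np: "\<forall>w\<in>- B. pair.W w \<le> 0"
      show False
      proof (rule R.not_nonneg_on_axis[OF u conn slipR pf p'(2) sec(4,1,2,3)])
        fix w assume "w \<in> - B" "Im w = 0"
        then show "- \<psi> (cnj w) \<ge> 0" using np[rule_format, of w] by (simp add: pair.W_def axis)
      qed
    qed
    then show ?thesis ..
  qed
qed

end

section \<open>Subsonic and incompressible flows\<close>

text \<open>
  The Bernoulli relation solved for the density. The Mach number condition $q\le m\,c^2$ with $c^2=(\gamma-1)(K-q/2)$ is
  the bound $q\le$ \<open>Qmax\<close> on the squared speed.
\<close>

lemma isentropic_density_law:
  fixes \<gamma> K m :: real
  assumes \<gamma>: "\<gamma> > 1" and K: "K > 0" and m: "0 \<le> m" "m < 1"
  defines "Qmax \<equiv> m * (\<gamma> - 1) * K / (1 + m * (\<gamma> - 1) / 2)"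
  shows "density_law (\<lambda>q. ((\<gamma> - 1) / \<gamma> * (K - q / 2)) powr (1 / (\<gamma> - 1))) (\<lambda>q. 1 / ((\<gamma> - 1) * (K - q / 2)))
      Qmax m (1 / (2 * (\<gamma> - 1) * (K - Qmax / 2)\<^sup>2))"
proof -
  define g where "g = \<gamma> - 1"
  have g: "g > 0" using \<gamma> by (simp add: g_def)
  define K0 where "K0 = K - Qmax / 2"
  have den: "1 + m * g / 2 > 0" using g m by (simp add: add_pos_nonneg)
  have Q: "Qmax = m * g * K / (1 + m * g / 2)" by (simp add: Qmax_def g_def)
  have K0_eq: "K0 = K / (1 + m * g / 2)" using den by (simp add: K0_def Q field_simps)
  have K0: "K0 > 0" using K den by (simp add: K0_eq)
  have Qm: "Qmax = m * g * K0" using den by (simp add: Q K0_eq)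
  have ge: "K - q / 2 \<ge> K0" if "q \<in> {0..Qmax}" for q using that by (simp add: K0_def)
  have pos: "K - q / 2 > 0" if "q \<in> {0..Qmax}" for q using ge[OF that] K0 by linarith
  show ?thesis
    unfolding g_def[symmetric] K0_def[symmetric]
  proof unfold_locales
    show "0 \<le> Qmax" using Qm m g K0 by simp
    show "0 \<le> m" "m < 1" by (rule m)+
  next
    fix q assume q: "q \<in> {0..Qmax}"
    note p = pos[OF q]
    have b: "g / \<gamma> * (K - q / 2) > 0" using p g \<gamma> by simp
    then show "(g / \<gamma> * (K - q / 2)) powr (1 / g) > 0" unfolding powr_gt_zero by linarith
    show "1 / (g * (K - q / 2)) \<ge> 0" using p g by simp
    have "((\<lambda>q. (g / \<gamma> * (K - q / 2)) powr (1 / g)) has_real_derivative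
        (1 / g) * (g / \<gamma> * (K - q / 2)) powr (1 / g - 1) * (g / \<gamma> * (- (1 / 2)))) (at q)"
      using b by (auto intro!: derivative_eq_intros DERIV_chain2[OF has_real_derivative_powr])
    moreover have "(1 / g) * (g / \<gamma> * (K - q / 2)) powr (1 / g - 1) * (g / \<gamma> * (- (1 / 2)))
        = - (1 / (g * (K - q / 2)) * (g / \<gamma> * (K - q / 2)) powr (1 / g) / 2)"
    proof -
      define P where "P = (g / \<gamma> * (K - q / 2)) powr (1 / g)"
      have "(g / \<gamma> * (K - q / 2)) powr (1 / g - 1) = P / (g / \<gamma> * (K - q / 2))"
        using b by (simp only: P_def powr_diff powr_one less_imp_le)
      then show ?thesis unfolding P_def[symmetric] using p g \<gamma> by (simp add: divide_simps)
    qed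
    ultimately show "((\<lambda>q. (g / \<gamma> * (K - q / 2)) powr (1 / g)) has_real_derivative
        - (1 / (g * (K - q / 2)) * (g / \<gamma> * (K - q / 2)) powr (1 / g) / 2)) (at q)" by simp
    have "q \<le> m * g * (K - q / 2)"
    proof -
      have "q \<le> m * g * K0" using q Qm by simp
      also have "\<dots> \<le> m * g * (K - q / 2)" using ge[OF q] m g by (intro mult_left_mono) auto
      finally show ?thesis .
    qed
    then show "q * (1 / (g * (K - q / 2))) \<le> m" using p g by (simp add: divide_le_eq mult.assoc)
  next
    fix q q' assume q: "q \<in> {0..Qmax}" "q' \<in> {0..Qmax}"
    define a b where "a = K - q / 2" and "b = K - q' / 2"
    have ab: "a \<ge> K0" "b \<ge> K0" "a > 0" "b > 0" using ge pos q by (auto simp: a_def b_def)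
    have "1 / (g * a) - 1 / (g * b) = (b - a) / (g * (a * b))" using ab g by (simp add: field_simps)
    moreover have "b - a = (q - q') / 2" by (simp add: a_def b_def field_simps)
    ultimately have "\<bar>1 / (g * a) - 1 / (g * b)\<bar> = \<bar>q - q'\<bar> / (2 * (g * (a * b)))" using ab g by (simp add: abs_mult)
    also have "\<dots> \<le> \<bar>q - q'\<bar> / (2 * (g * (K0 * K0)))"
      using ab g K0 by (intro divide_left_mono mult_left_mono mult_mono mult_pos_pos) auto
    also have "\<dots> = 1 / (2 * g * K0\<^sup>2) * \<bar>q - q'\<bar>" by (simp add: power2_eq_square mult.assoc)
    finally show "\<bar>1 / (g * (K - q / 2)) - 1 / (g * (K - q' / 2))\<bar> \<le> 1 / (2 * g * K0\<^sup>2) * \<bar>q - q'\<bar>"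
      by (simp add: a_def b_def)
  qed
qed

lemma uniformly_subsonic_flow_planar_flow:
  assumes \<gamma>: "\<gamma> > 1" and K: "K > 0" and B: "closed B" "bounded B"
    and flow: "uniformly_subsonic_flow \<gamma> K B \<psi> v \<rho>" and lim: "(v \<longlongrightarrow> Complex u 0) at_infinity"
  shows "\<exists>r k Qmax \<mu> L. planar_flow r k Qmax \<mu> L (- B) \<psi> v u"
proof -
  obtain \<delta> where \<delta>: "\<delta> > 0" and mach: "\<And>z. z \<in> - B \<Longrightarrow> norm (v z) / sound_speed \<gamma> (\<rho> z) \<le> 1 - \<delta>"
    and smooth: "smooth_on (- B) \<psi>"
    and eqs: "\<And>z. z \<in> - B \<Longrightarrow> \<rho> z > 0 \<and> of_real (\<rho> z) * v z = Complex (partial_y \<psi> z) (- partial_x \<psi> z) \<and>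
        (norm (v z))\<^sup>2 / 2 + enthalpy \<gamma> (\<rho> z) = K \<and> v differentiable at z \<and> curl v z = 0"
    using flow unfolding uniformly_subsonic_flow_def smooth_up_to_sides_def by blast
  \<comment> \<open>\<open>\<delta>\<close> may exceed \<open>1\<close>; squaring the bound on the Mach number needs a nonnegative base\<close>
  define m where "m = (max 0 (1 - \<delta>))\<^sup>2"
  have m: "0 \<le> m" "m < 1" using \<delta> by (auto simp: m_def max_def power_less_one_iff abs_square_less_1)
  define Qmax where "Qmax = m * (\<gamma> - 1) * K / (1 + m * (\<gamma> - 1) / 2)"
  interpret density_law "\<lambda>q. ((\<gamma> - 1) / \<gamma> * (K - q / 2)) powr (1 / (\<gamma> - 1))" "\<lambda>q. 1 / ((\<gamma> - 1) * (K - q / 2))"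
      Qmax m "1 / (2 * (\<gamma> - 1) * (K - Qmax / 2)\<^sup>2)"
    unfolding Qmax_def by (rule isentropic_density_law[OF \<gamma> K m])
  have "planar_flow (\<lambda>q. ((\<gamma> - 1) / \<gamma> * (K - q / 2)) powr (1 / (\<gamma> - 1))) (\<lambda>q. 1 / ((\<gamma> - 1) * (K - q / 2)))
      Qmax m (1 / (2 * (\<gamma> - 1) * (K - Qmax / 2)\<^sup>2)) (- B) \<psi> v u"
  proof unfold_locales
    show "open (- B)" "bounded (- (- B))" using B by auto
    show "smooth_on (- B) \<psi>" by (rule smooth)
    show "(v \<longlongrightarrow> Complex u 0) at_infinity" by (rule lim)
  next
    fix z assume z: "z \<in> - B"
    note e = eqs[OF z]
    show "v differentiable at z" "curl v z = 0" using e by auto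
    define q where "q = (norm (v z))\<^sup>2"
    have \<rho>: "\<rho> z > 0" using e by simp
    define h where "h = \<rho> z powr (\<gamma> - 1)"
    have h: "h > 0" using \<rho> by (simp add: h_def)
    have bern: "\<gamma> * h = (\<gamma> - 1) * (K - q / 2)"
      using e \<gamma> by (simp add: enthalpy_def h_def[symmetric] q_def field_simps)
    have hh: "(\<gamma> - 1) / \<gamma> * (K - q / 2) = h" using bern \<gamma> by (simp add: field_simps)
    have "((\<gamma> - 1) / \<gamma> * (K - q / 2)) powr (1 / (\<gamma> - 1)) = \<rho> z"
      unfolding hh h_def using \<rho> \<gamma> by (simp add: powr_powr)
    then show "of_real (((\<gamma> - 1) / \<gamma> * (K - (norm (v z))\<^sup>2 / 2)) powr (1 / (\<gamma> - 1))) * v z = Complex (partial_y \<psi> z) (- partial_x \<psi> z)"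
      using e by (simp add: q_def)
    have c: "sound_speed \<gamma> (\<rho> z) > 0" "(sound_speed \<gamma> (\<rho> z))\<^sup>2 = \<gamma> * h"
      using h \<gamma> by (auto simp: sound_speed_def h_def[symmetric])
    have "norm (v z) / sound_speed \<gamma> (\<rho> z) \<le> max 0 (1 - \<delta>)" using mach[OF z] by linarith
    then have "norm (v z) \<le> max 0 (1 - \<delta>) * sound_speed \<gamma> (\<rho> z)" using c(1) by (simp add: divide_le_eq)
    then have "q \<le> (max 0 (1 - \<delta>) * sound_speed \<gamma> (\<rho> z))\<^sup>2" unfolding q_def by (rule power_mono) simp
    then have "q \<le> m * (\<gamma> * h)" by (simp only: power_mult_distrib m_def c(2))
    then have "q \<le> m * ((\<gamma> - 1) * (K - q / 2))" by (simp only: bern)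
    moreover have "1 + m * (\<gamma> - 1) / 2 > 0" using m \<gamma> by (simp add: add_pos_nonneg)
    ultimately show "(norm (v z))\<^sup>2 \<le> Qmax" unfolding Qmax_def q_def[symmetric]
      by (simp add: pos_le_divide_eq) (simp add: algebra_simps)
  qed
  then show ?thesis by blast
qed

lemma incompressible_flow_planar_flow:
  assumes B: "closed B" "bounded B"
    and flow: "incompressible_flow B \<psi> v" and lim: "(v \<longlongrightarrow> Complex u 0) at_infinity"
    and bdd: "bounded (v ` (- B))"
  shows "\<exists>r k Qmax \<mu> L. planar_flow r k Qmax \<mu> L (- B) \<psi> v u"
proof -
  have smooth: "smooth_on (- B) \<psi>" and harm: "\<And>z. z \<in> - B \<Longrightarrow> partial_x (partial_x \<psi>) z + partial_y (partial_y \<psi>) z = 0"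
    and v: "\<And>z. z \<in> - B \<Longrightarrow> v z = Complex (partial_y \<psi> z) (- partial_x \<psi> z)"
    using flow unfolding incompressible_flow_def harmonic_on_def smooth_up_to_sides_def by blast+
  obtain M where M: "\<And>z. z \<in> - B \<Longrightarrow> norm (v z) \<le> M" using bdd unfolding bounded_iff by auto
  have op: "open (- B)" using B by auto
  have 2: "Ck_on (Suc (Suc 0)) (- B) \<psi>" using smooth unfolding smooth_on_def by blast
  note C = Ck_on_C1_on[OF Ck_on_Suc_partials(1)[OF 2]] Ck_on_C1_on[OF Ck_on_Suc_partials(2)[OF 2]]
  have "planar_flow (\<lambda>q. 1) (\<lambda>q. 0) (M\<^sup>2) 0 0 (- B) \<psi> v u"
  proof unfold_locales
    show "open (- B)" "bounded (- (- B))" using B by auto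
    show "smooth_on (- B) \<psi>" by (rule smooth)
    show "(v \<longlongrightarrow> Complex u 0) at_infinity" by (rule lim)
  next
    fix z assume z: "z \<in> - B"
    note g = C1_onD(1)[OF C(1) z] C1_onD(1)[OF C(2) z]
    have "((\<lambda>w. of_real (partial_y \<psi> w) + \<i> * of_real (- partial_x \<psi> w)) has_derivative
        (\<lambda>h. of_real (partial_x (partial_y \<psi>) z * Re h + partial_y (partial_y \<psi>) z * Im h) +
            \<i> * of_real (- (partial_x (partial_x \<psi>) z * Re h + partial_y (partial_x \<psi>) z * Im h)))) (at z)"
      by (intro has_derivative_add has_derivative_mult_right has_derivative_of_real has_derivative_minus g)
    then have "(v has_derivative
        (\<lambda>h. of_real (partial_x (partial_y \<psi>) z * Re h + partial_y (partial_y \<psi>) z * Im h) +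
            \<i> * of_real (- (partial_x (partial_x \<psi>) z * Re h + partial_y (partial_x \<psi>) z * Im h)))) (at z)"
      by (rule has_derivative_transform_within_open[OF _ op z]) (simp add: v complex_eq_iff)
    then show "v differentiable at z" unfolding differentiable_def by blast
    have "has_gradient (\<lambda>w. - partial_x \<psi> w) (- partial_x (partial_x \<psi>) z) (- partial_y (partial_x \<psi>) z) z"
      by (rule has_derivative_eq_rhs[OF has_derivative_minus[OF g(1)]]) (auto simp: algebra_simps)
    then have im: "has_gradient (\<lambda>w. Im (v w)) (- partial_x (partial_x \<psi>) z) (- partial_y (partial_x \<psi>) z) z"
      by (rule has_derivative_transform_within_open[OF _ op z]) (simp add: v)
    have re: "has_gradient (\<lambda>w. Re (v w)) (partial_x (partial_y \<psi>) z) (partial_y (partial_y \<psi>) z) z"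
      by (rule has_derivative_transform_within_open[OF g(2) op z]) (simp add: v)
    show "curl v z = 0"
      unfolding curl_def has_gradient_partials(1)[OF im] has_gradient_partials(2)[OF re] using harm[OF z] by simp
    show "of_real 1 * v z = Complex (partial_y \<psi> z) (- partial_x \<psi> z)" using v[OF z] by simp
    show "(norm (v z))\<^sup>2 \<le> M\<^sup>2" using M[OF z] by (intro power_mono) auto
  qed auto
  then show ?thesis by blast
qed

theorem theorem1:
  fixes \<gamma> K :: real and B :: "complex set"
  assumes "\<gamma> > 1" and "K > 0"
    and "solid_body B"
    and "cnj ` B = B"
    and "\<exists>p q. p \<noteq> q \<and> protruding_corner B p \<and> protruding_corner B q \<and> Im p \<noteq> 0 \<and> Im q \<noteq> 0"
  shows "\<not> (\<exists>\<psi> v \<rho>. uniformly_subsonic_flow \<gamma> K B \<psi> v \<rho> \<and> horizontal_at_infinity v \<and>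
              \<not> trivial_flow B v)
       \<and> \<not> (\<exists>\<psi> v. incompressible_flow B \<psi> v \<and> horizontal_at_infinity v \<and>
              bounded (v ` (- B)) \<and> \<not> trivial_flow B v)"
proof -
  have B: "closed B" "bounded B" "connected (- B)" using assms(3) unfolding solid_body_def by auto
  obtain p where p: "protruding_corner B p" "Im p \<noteq> 0" using assms(5) by blast
  have trivial: "trivial_flow B v"
    if "planar_flow r k Qmax \<mu> L (- B) \<psi> v u" "u \<ge> 0" "slip_condition B \<psi>" for r k Qmax \<mu> L \<psi> v u
  proof -
    interpret planar_flow r k Qmax \<mu> L "- B" \<psi> v u by (rule that(1))
    show ?thesis unfolding trivial_flow_def
      using symmetric_flow_trivial[OF that B(3) assms(4) p] by blast
  qed
  show ?thesis
  proof (intro conjI notI)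
    assume "\<exists>\<psi> v \<rho>. uniformly_subsonic_flow \<gamma> K B \<psi> v \<rho> \<and> horizontal_at_infinity v \<and> \<not> trivial_flow B v"
    then obtain \<psi> v \<rho> u where "uniformly_subsonic_flow \<gamma> K B \<psi> v \<rho>" "\<not> trivial_flow B v" "u \<ge> 0" "(v \<longlongrightarrow> Complex u 0) at_infinity"
      unfolding horizontal_at_infinity_def by blast
    moreover from this have "slip_condition B \<psi>" unfolding uniformly_subsonic_flow_def by blast
    ultimately show False
      using uniformly_subsonic_flow_planar_flow[OF assms(1,2) B(1,2)] trivial by blast
  next
    assume "\<exists>\<psi> v. incompressible_flow B \<psi> v \<and> horizontal_at_infinity v \<and> bounded (v ` (- B)) \<and> \<not> trivial_flow B v"
    then obtain \<psi> v u where "incompressible_flow B \<psi> v" "bounded (v ` (- B))" "\<not> trivial_flow B v" "u \<ge> 0" "(v \<longlongrightarrow> Complex u 0) at_infinity"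
      unfolding horizontal_at_infinity_def by blast
    moreover from this have "slip_condition B \<psi>" unfolding incompressible_flow_def by blast
    ultimately show False
      using incompressible_flow_planar_flow[OF B(1,2)] trivial by blast
  qed
qed

end
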